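(* Let $\mathcal{G}$ be a minor-closed class of graphs. If $\mathcal{G}$ has bounded treewidth, then $\mathrm{pcol}_\star(\mathcal{G})=p(\mathcal{G})=\mathrm{col}_\star(\mathcal{G})$, and this common value equals the smallest integer $t\ge1$ such that for some $m\ge0$ neither $K_{t,m}$ nor $I_{t-1}+P_m$ belongs to $\mathcal{G}$.
   Context: All graphs are finite and simple. A class $\mathcal{G}$ is a (proper) minor-closed class if it does not contain all graphs and is closed under taking minors; it has bounded treewidth if some integer bounds the treewidth of all its members. $I_n+P_m$ is a path on $m$ vertices plus $n$ additional pairwise non-adjacent vertices each adjacent to all vertices of the path. A $t$-island in $G$ is a non-empty $S\subseteq V(G)$ such that every vertex of $S$ has fewer than $t$ neighbors in $V(G)\setminus S$. $\mathrm{col}_C(G)$ is the smallest $t$ such that every non-empty subgraph of $G$ contains a $t$-island of size at most $C$; $\mathrm{col}_\star(\mathcal{G})$ is the smallest $t$ such that there is $C\ge1$ with $\mathrm{col}_C(G)\le t$ for all $G\in\mathcal{G}$. $t$-percolation: starting from an active set $A_0\subseteq V(G)$, repeatedly activate any inactive vertex with at least $t$ active neighbors; $A_0$ $t$-percolates if eventually all vertices are active. $G$ is $\varepsilon$-resistant to $t$-percolation if no set of at most $\varepsilon|V(G)|$ vertices $t$-percolates. $p(\mathcal{G})$ is the minimum integer $t$ such that for some $\varepsilon>0$ all graphs in $\mathcal{G}$ with at least one vertex are $\varepsilon$-resistant to $t$-percolation. $\mathrm{pcol}_\star(\mathcal{G})$ is the minimum integer $t$ such that for some $\varepsilon>0$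 every $G\in\mathcal{G}$ contains at least $\varepsilon|V(G)|$ pairwise disjoint $t$-islands. Each parameter is $\infty$ if no such $t$ exists. *)

theory Defs
  imports "Graph_Theory.Graph_Theory" "HOL-Library.Extended_Nat" "HOL-Library.Disjoint_Sets" Complex_Main
begin

(* Finite simple graphs are the objects satisfying pair_graph: every edge uv is stored as both
   arcs (u,v) and (v,u).  Every finite graph is isomorphic to one on natural numbers, so a class
   of graphs is a set of graphs with vertices in nat. *)
type_synonym graph_class = "nat pair_pre_digraph set"


(* A minor model: disjoint connected branch sets.  The library's connected requires at least one
   vertex, so branch sets are non-empty.  As H and its model need not share vertices, every
   isomorphic copy of a minor is a minor. *)
definition minor :: "'b pair_pre_digraph \<Rightarrow> 'a pair_pre_digraph \<Rightarrow> bool" where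
  "minor H G \<longleftrightarrow> (\<exists>B :: 'b \<Rightarrow> 'a set.
      (\<forall>x\<in>pverts H. B x \<subseteq> pverts G \<and> connected (with_proj G \<restriction> B x)) \<and>
      (\<forall>x\<in>pverts H. \<forall>y\<in>pverts H. x \<noteq> y \<longrightarrow> B x \<inter> B y = {}) \<and>
      (\<forall>(x, y)\<in>parcs H. \<exists>u\<in>B x. \<exists>v\<in>B y. (u, v) \<in> parcs G))"

(* Closure under minors includes closure under isomorphism. *)
definition minor_closed_class :: "graph_class \<Rightarrow> bool" where
  "minor_closed_class \<G> \<longleftrightarrow>
      (\<forall>G\<in>\<G>. pair_graph G) \<and>
      (\<exists>G. pair_graph G \<and> G \<notin> \<G>) \<and>
      (\<forall>G\<in>\<G>. \<forall>H. pair_graph H \<and> minor H G \<longrightarrow> H \<in> \<G>)"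


(* The library's tree is unsuitable here: in a symmetric digraph the two arcs of one edge already
   form a cycle.  A directed cycle with at least three arcs is a cycle of the undirected graph. *)
definition undirected_tree :: "'a pair_pre_digraph \<Rightarrow> bool" where
  "undirected_tree T \<longleftrightarrow> pair_graph T \<and> connected (with_proj T) \<and>
      \<not> (\<exists>p. pre_digraph.cycle (with_proj T) p \<and> 3 \<le> length p)"

definition tree_decomposition ::
  "'a pair_pre_digraph \<Rightarrow> 'b pair_pre_digraph \<Rightarrow> ('b \<Rightarrow> 'a set) \<Rightarrow> bool" where
  "tree_decomposition G T bag \<longleftrightarrow>
      undirected_tree T \<and>
      (\<Union>x\<in>pverts T. bag x) = pverts G \<and>
      (\<forall>(u, v)\<in>parcs G. \<exists>x\<in>pverts T. u \<in> bag x \<and> v \<in> bag x) \<and>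
      (\<forall>v\<in>pverts G. connected (with_proj T \<restriction> {x \<in> pverts T. v \<in> bag x}))"

(* Width is the largest bag size minus one.  The minimum exists for finite graphs, because a single
   bag containing all vertices is a tree decomposition; the graph without vertices gets 0. *)
definition treewidth :: "'a pair_pre_digraph \<Rightarrow> nat" where
  "treewidth G = (LEAST k. \<exists>(T :: nat pair_pre_digraph) bag.
      tree_decomposition G T bag \<and> (\<forall>x\<in>pverts T. card (bag x) \<le> k + 1))"

definition bounded_treewidth :: "graph_class \<Rightarrow> bool" where
  "bounded_treewidth \<G> \<longleftrightarrow> (\<exists>k. \<forall>G\<in>\<G>. treewidth G \<le> k)"


(* The graph I_n + P_m: U is the set of n additional vertices and xs lists the path in order. *)
definition indep_join_path :: "nat \<Rightarrow> nat \<Rightarrow> 'a pair_pre_digraph \<Rightarrow> bool" where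
  "indep_join_path n m G \<longleftrightarrow> (\<exists>U xs.
      finite U \<and> card U = n \<and> distinct xs \<and> length xs = m \<and> U \<inter> set xs = {} \<and>
      pverts G = U \<union> set xs \<and>
      parcs G = U \<times> set xs \<union> set xs \<times> U \<union>
        {(xs ! i, xs ! Suc i) | i. Suc i < m} \<union> {(xs ! Suc i, xs ! i) | i. Suc i < m})"


definition t_island :: "'a pair_pre_digraph \<Rightarrow> nat \<Rightarrow> 'a set \<Rightarrow> bool" where
  "t_island G t S \<longleftrightarrow> S \<noteq> {} \<and> S \<subseteq> pverts G \<and>
      (\<forall>v\<in>S. card {u \<in> pverts G - S. (v, u) \<in> parcs G} < t)"

(* In all parameters below t ranges over the positive integers.  As soon as a graph with a vertex is
   involved no t \<le> 0 qualifies anyway: there are no 0-islands, and the empty set 0-percolates.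
   Otherwise every integer qualifies vacuously and there would be no minimum over all integers.
   The infimum of the empty set is \<infinity>. *)

definition col :: "nat \<Rightarrow> 'a pair_pre_digraph \<Rightarrow> enat" where
  "col C G = Inf {enat t | t. 1 \<le> t \<and>
      (\<forall>H. pair_graph H \<and> subgraph (with_proj H) (with_proj G) \<and> pverts H \<noteq> {} \<longrightarrow>
        (\<exists>S. t_island H t S \<and> card S \<le> C))}"

definition col_star :: "graph_class \<Rightarrow> enat" where
  "col_star \<G> = Inf {enat t | t. 1 \<le> t \<and> (\<exists>C\<ge>1. \<forall>G\<in>\<G>. col C G \<le> enat t)}"

definition pcol_star :: "graph_class \<Rightarrow> enat" where
  "pcol_star \<G> = Inf {enat t | t. 1 \<le> t \<and>
      (\<exists>\<epsilon>>0::real. \<forall>G\<in>\<G>. \<exists>\<S>. (\<forall>S\<in>\<S>. t_island G t S) \<and> disjoint \<S> \<and>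
        real (card \<S>) \<ge> \<epsilon> * real (card (pverts G)))}"


inductive activates :: "'a pair_pre_digraph \<Rightarrow> nat \<Rightarrow> 'a set \<Rightarrow> 'a set \<Rightarrow> bool"
  for G t A\<^sub>0 where
  start: "activates G t A\<^sub>0 A\<^sub>0"
| step: "activates G t A\<^sub>0 A \<Longrightarrow> v \<in> pverts G - A \<Longrightarrow> t \<le> card {u \<in> A. (v, u) \<in> parcs G} \<Longrightarrow>
    activates G t A\<^sub>0 (insert v A)"

definition percolates :: "'a pair_pre_digraph \<Rightarrow> nat \<Rightarrow> 'a set \<Rightarrow> bool" where
  "percolates G t A\<^sub>0 \<longleftrightarrow> activates G t A\<^sub>0 (pverts G)"

definition resistant :: "real \<Rightarrow> nat \<Rightarrow> 'a pair_pre_digraph \<Rightarrow> bool" where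
  "resistant \<epsilon> t G \<longleftrightarrow> \<not> (\<exists>A\<^sub>0 \<subseteq> pverts G.
      real (card A\<^sub>0) \<le> \<epsilon> * real (card (pverts G)) \<and> percolates G t A\<^sub>0)"

definition percolation_threshold :: "graph_class \<Rightarrow> enat" where
  "percolation_threshold \<G> = Inf {enat t | t. 1 \<le> t \<and>
      (\<exists>\<epsilon>>0. \<forall>G\<in>\<G>. pverts G \<noteq> {} \<longrightarrow> resistant \<epsilon> t G)}"


(* By closure under isomorphism, membership of a graph is membership of any of its copies. *)
definition excludes_both :: "graph_class \<Rightarrow> nat \<Rightarrow> nat \<Rightarrow> bool" where
  "excludes_both \<G> t m \<longleftrightarrow>
      \<not> (\<exists>G\<in>\<G>. complete_bipartite_digraph t m (with_proj G)) \<and>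
      \<not> (\<exists>G\<in>\<G>. indep_join_path (t - 1) m G)"

end

theory Submission
  imports Defs
begin

text \<open>In a minor-closed class, a set that \<open>t\<close>-percolates meets every \<open>t\<close>-island, and among linearly many
  disjoint islands some are small, so \<open>pcol\<^sub>\<star>\<close> bounds the other two parameters.  The graphs \<open>K\<^sub>t\<^sub>,\<^sub>m\<close> and
  \<open>I\<^sub>t\<^sub>-\<^sub>1 + P\<^sub>m\<close> have \<open>t\<close>-percolating sets of size \<open>t\<close> and no small \<open>t\<close>-islands, which gives the lower
  bounds.  It remains to find linearly many disjoint \<open>t\<close>-islands in a graph of bounded treewidth without
  these two minors.

  Consider the elimination forest of the graph and write \<open>D v\<close> for the descendants of \<open>v\<close>, a set with at
  most \<open>k\<close> outside neighbours.  If many children of one vertex have a \<open>D c\<close> that is not an island, then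
  each of these sets contains a vertex with \<open>t\<close> neighbours in the same bounded set, which yields
  \<open>K\<^sub>t\<^sub>,\<^sub>m\<close>.  Along a long path of the forest the sets \<open>D v\<close> form a nested chain.  By Menger's theorem, a
  long subchain has boundaries of equal size that are joined by disjoint paths, and the boundaries pairwise
  meet in the same set.  If the regions between consecutive boundaries are not islands, then each contains
  a vertex with \<open>t\<close> neighbours in a single boundary, that is, on \<open>t\<close> different paths.  By the pigeonhole
  principle many of these vertices see the same \<open>t\<close> paths and either all avoid the linkage, which gives
  \<open>K\<^sub>t\<^sub>,\<^sub>m\<close>, or all lie on the same path, which gives \<open>I\<^sub>t\<^sub>-\<^sub>1 + P\<^sub>m\<close>.  Hence
  there is an island below every vertex with many children and along every long path of the forest, and
  counting gives linearly many disjoint ones.\<close>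

section \<open>Connected sets and Menger's theorem\<close>

text \<open>Connectivity of a bare relation, so that edges can be deleted freely in inductions. It
  is the undirected notion whenever \<open>E\<close> is symmetric.\<close>

definition conn :: "'a rel \<Rightarrow> 'a set \<Rightarrow> bool" where
  "conn E C \<longleftrightarrow> C \<noteq> {} \<and> (\<forall>x\<in>C. \<forall>y\<in>C. (x, y) \<in> (E \<inter> C \<times> C)\<^sup>*)"

lemma conn_singleton [simp]: "conn E {x}"
  by (auto simp: conn_def)

lemma conn_mono: "conn E C \<Longrightarrow> E \<subseteq> E' \<Longrightarrow> conn E' C"
  unfolding conn_def by (meson Int_mono order_refl rtrancl_mono subsetD)

lemma conn_Un:
  assumes C: "conn E C" and D: "conn E D" and "x \<in> C" "y \<in> D"
    and xy: "x = y \<or> (x, y) \<in> E \<and> (y, x) \<in> E"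
  shows "conn E (C \<union> D)"
proof -
  let ?R = "E \<inter> (C \<union> D) \<times> (C \<union> D)"
  have C': "(a, b) \<in> ?R\<^sup>*" if "a \<in> C" "b \<in> C" for a b
    using C that rtrancl_mono[of "E \<inter> C \<times> C" ?R] unfolding conn_def by blast
  have D': "(a, b) \<in> ?R\<^sup>*" if "a \<in> D" "b \<in> D" for a b
    using D that rtrancl_mono[of "E \<inter> D \<times> D" ?R] unfolding conn_def by blast
  have "(x, y) \<in> ?R\<^sup>*" "(y, x) \<in> ?R\<^sup>*"
    using xy \<open>x \<in> C\<close> \<open>y \<in> D\<close> by auto
  then have "(a, b) \<in> ?R\<^sup>*" if "a \<in> C \<union> D" "b \<in> C \<union> D" for a b
    using that C'[of a x] D'[of y b] D'[of a y] C'[of x b] C'[of a b] D'[of a b] \<open>x \<in> C\<close> \<open>y \<in> D\<close>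
    by (auto intro: rtrancl_trans)
  with C show ?thesis
    unfolding conn_def by auto
qed

lemma conn_subset:
  assumes "conn E C" "C \<inter> X \<noteq> {}" "\<And>u v. (u, v) \<in> E \<Longrightarrow> u \<in> X \<Longrightarrow> v \<in> X"
  shows "C \<subseteq> X"
proof
  fix y assume y: "y \<in> C"
  obtain x where x: "x \<in> C" "x \<in> X"
    using assms(2) by auto
  have "(x, y) \<in> (E \<inter> C \<times> C)\<^sup>*"
    using assms(1) x y unfolding conn_def by auto
  then show "y \<in> X"
    using \<open>x \<in> X\<close> assms(3) by (induction rule: rtrancl_induct) auto
qed

lemma conn_crosses:
  assumes "conn E C" "C \<inter> X \<noteq> {}" "\<not> C \<subseteq> X"
  obtains u v where "(u, v) \<in> E" "u \<in> C \<inter> X" "v \<in> C - X"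
proof -
  \<comment> \<open>Restricting the relation to \<open>C\<close> makes a failure of closure produce
    an arc with both ends in \<open>C\<close>.\<close>
  have "conn (E \<inter> C \<times> C) C"
    using assms(1) unfolding conn_def by (simp add: Int_assoc)
  then show thesis
    using conn_subset[of "E \<inter> C \<times> C" C X] assms(2,3) that by blast
qed

text \<open>The disjoint paths of Menger's theorem appear as disjoint connected sets that meet both
  ends. Sets are easier to glue, and genuine paths are extracted only where they are needed.\<close>

definition linkage :: "'a rel \<Rightarrow> 'a set \<Rightarrow> 'a set \<Rightarrow> 'a set set \<Rightarrow> bool" where
  "linkage E A B \<Q> \<longleftrightarrow> disjoint \<Q> \<and> (\<forall>Q\<in>\<Q>. conn E Q \<and> Q \<inter> A \<noteq> {} \<and> Q \<inter> B \<noteq> {})"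

text \<open>Choosing a point of \<open>Z\<close> in each member is injective by disjointness and, as
  the cardinalities agree, onto \<open>Z\<close>. The inverse indexes the members by the points of
  \<open>Z\<close>.\<close>

lemma disjoint_transversal:
  assumes "disjoint \<C>" "\<And>C. C \<in> \<C> \<Longrightarrow> C \<inter> Z \<noteq> {}" "finite Z" "card \<C> = card Z" "finite \<C>"
  obtains c where "c ` Z = \<C>" "inj_on c Z" "\<And>z. z \<in> Z \<Longrightarrow> z \<in> c z"
proof -
  define f where "f C = (SOME z. z \<in> C \<inter> Z)" for C
  have f: "f C \<in> C \<inter> Z" if "C \<in> \<C>" for C
    unfolding f_def using assms(2)[OF that] by (meson ex_in_conv someI_ex)
  have inj: "inj_on f \<C>"
    using f assms(1) by (intro inj_onI) (metis IntD1 disjnt_iff pairwiseD disjoint_def Int_iff empty_iff)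
  have "f ` \<C> = Z"
    using f inj assms by (intro card_subset_eq) (auto simp: card_image)
  then have bij: "bij_betw f \<C> Z"
    using inj by (simp add: bij_betw_def)
  show thesis
  proof (rule that)
    show "the_inv_into \<C> f ` Z = \<C>" "inj_on (the_inv_into \<C> f) Z"
      using bij_betw_the_inv_into[OF bij] by (auto simp: bij_betw_def)
    show "z \<in> the_inv_into \<C> f z" if "z \<in> Z" for z
      using f f_the_inv_into_f_bij_betw[OF bij] that
      by (metis IntD1 \<open>f ` \<C> = Z\<close> inj order_refl the_inv_into_into)
  qed
qed

text \<open>A separator \<open>Z\<close> comes with a side \<open>W\<close> that contains the rest
  of \<open>A\<close>, which replaces quantification over paths.\<close>

definition separates :: "'a rel \<Rightarrow> 'a set \<Rightarrow> 'a set \<Rightarrow> 'a set \<Rightarrow> 'a set \<Rightarrow> bool" where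
  "separates E A B W Z \<longleftrightarrow> A \<subseteq> W \<union> Z \<and> W \<inter> Z = {} \<and> W \<inter> B = {} \<and> (\<forall>(u, v)\<in>E. u \<in> W \<longrightarrow> v \<in> W \<union> Z)"

lemma linkage_mono: "linkage E A B \<Q> \<Longrightarrow> E \<subseteq> E' \<Longrightarrow> linkage E' A B \<Q>"
  unfolding linkage_def using conn_mono[of E _ E'] by auto

text \<open>Induction on the number of edges. If deleting an edge creates a separator
  \<open>Z\<close> of size below \<open>p\<close>, then \<open>Z\<close> together with either end of
  the edge has size \<open>p\<close>; the linkages that the induction gives on the two sides are
  glued along \<open>Z\<close> and the edge.\<close>

theorem menger:
  assumes "finite E" "sym E" "finite A" "finite B"
    and "\<And>W Z. finite Z \<Longrightarrow> separates E A B W Z \<Longrightarrow> p \<le> card Z"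
  shows "\<exists>\<Q>. finite \<Q> \<and> card \<Q> = p \<and> linkage E A B \<Q>"
  using assms
proof (induction "card E" arbitrary: E A B rule: less_induct)
  case less
  show ?case
  proof (cases "E = {}")
    case True
    have "separates E A B (A - B) (A \<inter> B)"
      using True by (auto simp: separates_def)
    then have "p \<le> card (A \<inter> B)"
      using less.prems by blast
    then obtain S where S: "S \<subseteq> A \<inter> B" "card S = p" "finite S"
      by (meson obtain_subset_with_card_n)
    have "linkage E A B ((\<lambda>x. {x}) ` S)"
      using S by (auto simp: linkage_def disjoint_def)
    moreover have "card ((\<lambda>x. {x}) ` S) = p"
      using S by (simp add: card_image)
    ultimately show ?thesis
      using S(3) by blast
  next
    case False
    then obtain x0 y0 where e0: "(x0, y0) \<in> E"
      by auto
    define E' where "E' = E - {(x0, y0), (y0, x0)}"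
    have E': "E' \<subseteq> E" "sym E'" "finite E'" "card E' < card E"
      using less.prems(1,2) e0 by (auto simp: E'_def sym_def intro!: psubset_card_mono)
    show ?thesis
    proof (cases "\<forall>W Z. finite Z \<longrightarrow> separates E' A B W Z \<longrightarrow> p \<le> card Z")
      case True
      then obtain \<Q> where "finite \<Q>" "card \<Q> = p" "linkage E' A B \<Q>"
        using less.hyps[OF E'(4) E'(3) E'(2) less.prems(3,4)] by blast
      then show ?thesis
        using linkage_mono[OF _ E'(1)] by auto
    next
      case False
      then obtain X Z where XZ: "finite Z" "separates E' A B X Z" and small: "card Z < p"
        by (meson not_le)
      then have "\<not> separates E A B X Z"
        using less.prems(5) by (meson not_le)
      \<comment> \<open>Only the deleted edge can leave the side \<open>X\<close> past
        \<open>Z\<close>; its ends are renamed so that \<open>x\<close> lies in \<open>X\<close> and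
        \<open>y\<close> beyond \<open>Z\<close>.\<close>
      then obtain x y where xy: "(x, y) \<in> E" "x \<in> X" "y \<notin> X \<union> Z"
        using XZ(2) unfolding separates_def by blast
      then have "(x, y) \<notin> E'"
        using XZ(2) unfolding separates_def by blast
      then have E'_eq: "E' = E - {(x, y), (y, x)}"
        using xy by (auto simp: E'_def)
      have X: "A \<subseteq> X \<union> Z" "X \<inter> Z = {}" "X \<inter> B = {}" "\<And>u v. (u, v) \<in> E' \<Longrightarrow> u \<in> X \<Longrightarrow> v \<in> X \<union> Z"
        using XZ(2) by (auto simp: separates_def)
      have X': "w \<notin> X \<Longrightarrow> w \<in> Z \<or> u \<notin> X" if "(w, u) \<in> E'" for w u
        using X(4)[of u w] symD[OF E'(2) that] by blast
      \<comment> \<open>Moving \<open>x\<close> into the separator repairs it for \<open>E\<close>,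
        which forces \<open>card Z\<close> to be exactly one less than \<open>p\<close>.\<close>
      have "separates E A B (X - {x}) (insert x Z)"
        using X xy unfolding separates_def E'_eq by blast
      then have "p \<le> card (insert x Z)"
        using less.prems(5) XZ(1) by blast
      then have cards: "card (insert x Z) = p" "card (insert y Z) = p"
        using small XZ(1) X(2) xy by (auto simp: card_insert_if split: if_splits)
      \<comment> \<open>\<open>E1\<close> has the remaining edges on the side of \<open>A\<close>,
        \<open>E2\<close> those on the side of \<open>B\<close>; edges within \<open>Z\<close>
        belong to both.\<close>
      define E1 where "E1 = E' \<inter> (X \<union> Z) \<times> (X \<union> Z)"
      define E2 where "E2 = E' \<inter> (- X) \<times> (- X)"
      have E12: "E1 \<subseteq> E'" "E2 \<subseteq> E'"
        by (auto simp: E1_def E2_def)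
      \<comment> \<open>A set that separates \<open>A\<close> from \<open>insert x Z\<close> on the
        first side separates \<open>A\<close> from \<open>B\<close> in \<open>E\<close>: the side is
        \<open>W \<inter> X\<close>, because \<open>W\<close> contains neither \<open>x\<close> nor
        a vertex of \<open>Z\<close>.\<close>
      have 1: "p \<le> card Y" if "finite Y" "separates E1 A (insert x Z) W Y" for W Y
      proof -
        have "separates E A B (W \<inter> X) Y"
          unfolding separates_def
        proof (intro conjI ballI, goal_cases)
          case (4 e)
          obtain u v where e: "e = (u, v)"
            by fastforce
          have W: "W \<inter> insert x Z = {}" "\<And>u v. (u, v) \<in> E1 \<Longrightarrow> u \<in> W \<Longrightarrow> v \<in> W \<union> Y"
            using that(2) by (auto simp: separates_def)
          have "v \<in> (W \<inter> X) \<union> Y" if "u \<in> W" "u \<in> X"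
          proof -
            have "u \<noteq> x" "u \<noteq> y"
              using that W(1) xy by auto
            then have *: "(u, v) \<in> E'"
              using 4 by (auto simp: e E'_eq)
            then have "v \<in> X \<union> Z"
              using X(4) that by blast
            then show ?thesis
              using * W that by (auto simp: E1_def)
          qed
          then show ?case
            by (auto simp: e)
        qed (use that(2) X in \<open>auto simp: separates_def\<close>)
        then show ?thesis
          using less.prems(5) that(1) by blast
      qed
      \<comment> \<open>On the second side all of \<open>X\<close> joins the side of
        \<open>A\<close>: an arc that leaves \<open>X\<close> ends in \<open>insert y Z\<close>,
        hence in \<open>W\<close> or \<open>Y\<close>.\<close>
      have 2: "p \<le> card Y" if "finite Y" "separates E2 (insert y Z) B W Y" for W Y
      proof -
        have "separates E A B ((X \<union> W) - Y) Y"
          unfolding separates_def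
        proof (intro conjI ballI, goal_cases)
          case (4 e)
          obtain u v where e: "e = (u, v)"
            by fastforce
          have W: "y \<in> W \<union> Y" "Z \<subseteq> W \<union> Y" "\<And>u v. (u, v) \<in> E2 \<Longrightarrow> u \<in> W \<Longrightarrow> v \<in> W \<union> Y"
            using that(2) by (auto simp: separates_def)
          have "v \<in> X \<union> W \<union> Y" if "u \<in> X \<union> W"
          proof (cases "u \<in> X")
            case True
            then show ?thesis
              using X(4)[of u v] W 4 xy by (auto simp: e E'_eq)
          next
            case False
            then show ?thesis
              using W(3)[of u v] that 4 xy unfolding E2_def e E'_eq by blast
          qed
          then show ?case
            by (auto simp: e)
        qed (use that(2) X in \<open>auto simp: separates_def\<close>)
        then show ?thesis
          using less.prems(5) that(1) by blast
      qed
      have fs: "finite E1" "finite E2" "sym E1" "sym E2" "card E1 < card E" "card E2 < card E"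
      proof -
        show "finite E1" "finite E2"
          using E12 finite_subset[OF _ E'(3)] by auto
        show "sym E1" "sym E2"
          using E'(2) by (auto simp: E1_def E2_def sym_def)
        show "card E1 < card E" "card E2 < card E"
          using card_mono[OF E'(3) E12(1)] card_mono[OF E'(3) E12(2)] E'(4) by auto
      qed
      have "\<exists>\<C>. finite \<C> \<and> card \<C> = p \<and> linkage E1 A (insert x Z) \<C>"
        by (rule less.hyps[OF fs(5,1,3) less.prems(3)]) (use XZ(1) 1 in auto)
      then obtain \<C> where C: "finite \<C>" "card \<C> = p" "linkage E1 A (insert x Z) \<C>"
        by auto
      have "\<exists>\<D>. finite \<D> \<and> card \<D> = p \<and> linkage E2 (insert y Z) B \<D>"
        by (rule less.hyps[OF fs(6,2,4) _ less.prems(4)]) (use XZ(1) 2 in auto)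
      then obtain \<D> where D: "finite \<D>" "card \<D> = p" "linkage E2 (insert y Z) B \<D>"
        by auto
      obtain c where c: "c ` insert x Z = \<C>" "inj_on c (insert x Z)" "\<And>z. z \<in> insert x Z \<Longrightarrow> z \<in> c z"
      proof (rule disjoint_transversal[of \<C> "insert x Z"])
      qed (use C cards XZ(1) in \<open>auto simp: linkage_def\<close>)
      obtain d where d: "d ` insert y Z = \<D>" "inj_on d (insert y Z)" "\<And>z. z \<in> insert y Z \<Longrightarrow> z \<in> d z"
      proof (rule disjoint_transversal[of \<D> "insert y Z"])
      qed (use D cards XZ(1) in \<open>auto simp: linkage_def\<close>)
      have cX: "c z \<subseteq> X \<union> Z" "conn E1 (c z)" "c z \<inter> A \<noteq> {}" if "z \<in> insert x Z" for z
      proof -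
        have "c z \<in> \<C>"
          using c(1) that by blast
        then show *: "conn E1 (c z)" "c z \<inter> A \<noteq> {}"
          using C(3) unfolding linkage_def by blast+
        show "c z \<subseteq> X \<union> Z"
        proof (rule conn_subset[OF *(1)])
          show "c z \<inter> (X \<union> Z) \<noteq> {}"
            using *(2) X(1) by blast
        qed (auto simp: E1_def)
      qed
      have dX: "d z \<subseteq> - X" "conn E2 (d z)" "d z \<inter> B \<noteq> {}" if "z \<in> insert y Z" for z
      proof -
        have "d z \<in> \<D>"
          using d(1) that by blast
        then show *: "conn E2 (d z)" "d z \<inter> B \<noteq> {}"
          using D(3) unfolding linkage_def by blast+
        show "d z \<subseteq> - X"
        proof (rule conn_subset[OF *(1)])
          show "d z \<inter> - X \<noteq> {}"
            using *(2) X(3) by blast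
        qed (auto simp: E2_def)
      qed
      have cdisj: "c z \<inter> c z' = {}" if "z \<in> insert x Z" "z' \<in> insert x Z" "z \<noteq> z'" for z z'
      proof -
        have "c z \<in> \<C>" "c z' \<in> \<C>" "c z \<noteq> c z'"
          using c(1,2) that by (auto simp: inj_on_def)
        then show ?thesis
          using C(3) by (auto simp: linkage_def disjoint_def)
      qed
      have ddisj: "d z \<inter> d z' = {}" if "z \<in> insert y Z" "z' \<in> insert y Z" "z \<noteq> z'" for z z'
      proof -
        have "d z \<in> \<D>" "d z' \<in> \<D>" "d z \<noteq> d z'"
          using d(1,2) that by (auto simp: inj_on_def)
        then show ?thesis
          using D(3) by (auto simp: linkage_def disjoint_def)
      qed
      \<comment> \<open>\<open>h\<close> matches the ends of the first linkage with the starts of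
        the second: \<open>x\<close> continues over the deleted edge to \<open>y\<close>, a point of
        \<open>Z\<close> continues from itself.\<close>
      define h where "h z = (if z = x then y else z)" for z
      have h: "h z \<in> insert y Z" "h z = h z' \<Longrightarrow> z = z'" if "z \<in> insert x Z" "z' \<in> insert x Z" for z z'
        using that xy by (auto simp: h_def split: if_splits)
      \<comment> \<open>The two sides overlap only in \<open>Z\<close>, and a point of
        \<open>Z\<close> lies only in the members indexed by itself.\<close>
      have cd: "c z \<inter> d (h z') = {}" if "z \<in> insert x Z" "z' \<in> insert x Z" "z \<noteq> z'" for z z'
      proof (rule ccontr)
        assume "c z \<inter> d (h z') \<noteq> {}"
        then obtain s where s: "s \<in> c z" "s \<in> d (h z')"
          by auto
        have hz: "h z' \<in> insert y Z"
          using h(1) that by blast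
        have sZ: "s \<in> Z"
          using cX(1)[OF that(1)] dX(1)[OF hz] s by blast
        have "s = z"
          using s(1) c(3)[of s] cdisj[OF that(1), of s] sZ by blast
        moreover have "s = h z'"
          using s(2) d(3)[of s] ddisj[OF hz, of s] sZ by blast
        ultimately have "s = z" "s = h z'" .
        with that sZ xy show False
          by (auto simp: h_def split: if_splits)
      qed
      define q where "q z = c z \<union> d (h z)" for z
      have qdisj: "q z \<inter> q z' = {}" if "z \<in> insert x Z" "z' \<in> insert x Z" "z \<noteq> z'" for z z'
      proof -
        have "d (h z) \<inter> d (h z') = {}"
          using ddisj h that by metis
        then show ?thesis
          using cdisj[OF that] cd[OF that] cd[OF that(2,1)] that(3) by (auto simp: q_def)
      qed
      have inj: "inj_on q (insert x Z)"
      proof (rule inj_onI, rule ccontr)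
        fix z z' assume *: "z \<in> insert x Z" "z' \<in> insert x Z" "q z = q z'" "z \<noteq> z'"
        then have "q z = {}"
          using qdisj[of z z'] by auto
        then show False
          using c(3)[OF *(1)] by (auto simp: q_def)
      qed
      have "conn E (q z)" if "z \<in> insert x Z" for z
        unfolding q_def
      proof (rule conn_Un[of _ _ _ z "h z"])
        show "conn E (c z)"
          using conn_mono[OF cX(2)[OF that]] E12(1) E'(1) by auto
        show "conn E (d (h z))"
          using conn_mono[OF dX(2)[OF h(1)[OF that that]]] E12(2) E'(1) by auto
        show "z = h z \<or> (z, h z) \<in> E \<and> (h z, z) \<in> E"
          using xy(1) symD[OF less.prems(2)] by (auto simp: h_def)
      qed (use c(3) d(3) h(1) that in auto)
      moreover have "q z \<inter> A \<noteq> {}" "q z \<inter> B \<noteq> {}" if "z \<in> insert x Z" for z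
        using cX(3)[OF that] dX(3)[OF h(1)[OF that that]] by (auto simp: q_def)
      moreover have "disjoint (q ` insert x Z)"
      proof (rule disjointI)
        fix a b assume "a \<in> q ` insert x Z" "b \<in> q ` insert x Z" "a \<noteq> b"
        then obtain z z' where "a = q z" "b = q z'" "z \<in> insert x Z" "z' \<in> insert x Z" "z \<noteq> z'"
          by auto
        then show "a \<inter> b = {}"
          using qdisj by simp
      qed
      ultimately have "linkage E A B (q ` insert x Z)"
        unfolding linkage_def by blast
      moreover have "card (q ` insert x Z) = p"
        using card_image[OF inj] cards by simp
      moreover have "finite (q ` insert x Z)"
        using XZ(1) by simp
      ultimately show ?thesis
        by metis
    qed
  qed
qed

section \<open>Vertex paths in connected sets\<close>

lemma conn_set:
  assumes "sym E" "successively (\<lambda>x y. (x, y) \<in> E) xs" "xs \<noteq> []"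
  shows "conn E (set xs)"
  using assms(2,3)
proof (induction xs rule: induct_list012)
  case (3 x y zs)
  then have "conn E ({x} \<union> set (y # zs))"
    using symD[OF assms(1)] by (intro conn_Un[of _ _ _ x y]) auto
  then show ?case
    by (simp add: insert_commute)
qed auto

lemma conn_imp_path:
  assumes "conn E C" "u \<in> C" "w \<in> C"
  obtains xs where "distinct xs" "xs \<noteq> []" "hd xs = u" "last xs = w" "set xs \<subseteq> C"
    "successively (\<lambda>x y. (x, y) \<in> E) xs"
proof -
  have "(u, w) \<in> (E \<inter> C \<times> C)\<^sup>*"
    using assms unfolding conn_def by auto
  then have "\<exists>xs. distinct xs \<and> xs \<noteq> [] \<and> hd xs = u \<and> last xs = w \<and> set xs \<subseteq> C
      \<and> successively (\<lambda>x y. (x, y) \<in> E) xs"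
    using \<open>u \<in> C\<close>
  proof (induction rule: converse_rtrancl_induct)
    case base
    then show ?case
      by (intro exI[of _ "[w]"]) (use assms in auto)
  next
    case (step x y)
    then obtain xs where xs: "distinct xs" "xs \<noteq> []" "hd xs = y" "last xs = w" "set xs \<subseteq> C"
        "successively (\<lambda>x y. (x, y) \<in> E) xs"
      by blast
    show ?case
    proof (cases "x \<in> set xs")
      \<comment> \<open>A repetition is avoided by keeping only the suffix that starts at
        \<open>x\<close>.\<close>
      case True
      then obtain ys zs where "xs = ys @ x # zs"
        by (auto simp: in_set_conv_decomp)
      then show ?thesis
        using xs by (intro exI[of _ "x # zs"]) (auto simp: successively_append_iff)
    next
      case False
      then show ?thesis
        using xs step by (intro exI[of _ "x # xs"]) (auto simp: successively_Cons)
    qed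
  qed
  then show thesis
    using that by blast
qed

lemma card_disjoint_le:
  assumes "disjoint \<Q>" "\<And>Q. Q \<in> \<Q> \<Longrightarrow> Q \<inter> Z \<noteq> {}" "finite Z"
  shows "card \<Q> \<le> card Z"
proof -
  define f where "f Q = (SOME z. z \<in> Q \<inter> Z)" for Q
  have f: "f Q \<in> Q \<inter> Z" if "Q \<in> \<Q>" for Q
    unfolding f_def using assms(2)[OF that] by (meson ex_in_conv someI_ex)
  have "inj_on f \<Q>"
  proof (rule inj_onI, rule ccontr)
    fix P Q assume "P \<in> \<Q>" "Q \<in> \<Q>" "f P = f Q" "P \<noteq> Q"
    then show False
      using f[of P] f[of Q] disjointD[OF assms(1), of P Q] by auto
  qed
  then show ?thesis
    using f assms(3) by (intro card_inj_on_le[of f]) auto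
qed

section \<open>Nested chains of separations\<close>

text \<open>The set \<open>D\<close> alone encodes the separation with sides
  \<open>D \<union> nbh E D\<close> and the complement of \<open>D\<close>; \<open>nbh E D\<close>
  is its boundary.\<close>

definition nbh :: "'a rel \<Rightarrow> 'a set \<Rightarrow> 'a set" where
  "nbh E D = E `` D - D"

lemma finite_nbh [simp]: "finite E \<Longrightarrow> finite (nbh E D)"
  by (simp add: nbh_def finite_Image)

lemma nbh_subset_Un: "D' \<subseteq> D \<Longrightarrow> nbh E D' \<subseteq> D \<union> nbh E D"
  by (auto simp: nbh_def)

text \<open>A common boundary vertex lies outside the largest set and has a neighbour in the
  smallest one, so both hold for every set between them.\<close>

lemma nbh_between: "D'' \<subseteq> D' \<Longrightarrow> D' \<subseteq> D \<Longrightarrow> nbh E D \<inter> nbh E D'' \<subseteq> nbh E D'"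
  by (auto simp: nbh_def)

text \<open>If \<open>Q\<close> meets \<open>D'\<close>, it must also leave it, because its point of
  \<open>nbh E D\<close> lies outside \<open>D'\<close>, and the exit vertex is in the boundary.
  Otherwise its point of \<open>nbh E D''\<close> is already in the boundary of
  \<open>D'\<close>.\<close>

lemma conn_meets_nbh:
  assumes "conn E Q" "Q \<inter> nbh E D \<noteq> {}" "Q \<inter> nbh E D'' \<noteq> {}" "D'' \<subseteq> D'" "D' \<subseteq> D"
  shows "Q \<inter> nbh E D' \<noteq> {}"
proof (cases "Q \<inter> D' = {}")
  case True
  then show ?thesis
    using assms(3) nbh_subset_Un[OF assms(4), of E] by blast
next
  case False
  have "\<not> Q \<subseteq> D'"
    using assms(2,5) by (auto simp: nbh_def)
  with False obtain u v where "(u, v) \<in> E" "u \<in> Q \<inter> D'" "v \<in> Q - D'"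
    using conn_crosses[OF assms(1)] by metis
  then show ?thesis
    by (auto simp: nbh_def)
qed

text \<open>When the linkage does not exist, the small separator is turned back into a possible
  member of the chain: remove the separator and its outer side from \<open>D\<close> and add
  \<open>D'\<close> back; the boundary of the result lies in the separator.\<close>

lemma nested_menger:
  assumes "finite E" "sym E" "D' \<subseteq> D"
  obtains \<Q> where "finite \<Q>" "card \<Q> = q" "linkage E (nbh E D) (nbh E D') \<Q>"
    | D'' where "D' \<subseteq> D''" "D'' \<subseteq> D" "card (nbh E D'') < q"
proof (cases "\<forall>W Z. finite Z \<longrightarrow> separates E (nbh E D) (nbh E D') W Z \<longrightarrow> q \<le> card Z")
  case True
  then show thesis
    using menger[OF assms(1,2), of "nbh E D" "nbh E D'" q] assms(1) that(1) by auto
next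
  case False
  then obtain W Z where Z: "finite Z" "separates E (nbh E D) (nbh E D') W Z" "card Z < q"
    by (meson not_le)
  define D'' where "D'' = D' \<union> (D - (W \<union> Z))"
  have W: "nbh E D \<subseteq> W \<union> Z" "W \<inter> nbh E D' = {}" "\<And>u v. (u, v) \<in> E \<Longrightarrow> u \<in> W \<Longrightarrow> v \<in> W \<union> Z"
    using Z(2) by (auto simp: separates_def)
  have "u \<in> Z" if u: "(w, u) \<in> E" "w \<in> D''" "u \<notin> D''" for w u
  proof (rule ccontr)
    assume "u \<notin> Z"
    have "u \<in> D \<union> nbh E D"
      using u assms(3) by (auto simp: D''_def nbh_def)
    then have "u \<in> W"
      using W(1) u(3) \<open>u \<notin> Z\<close> by (auto simp: D''_def)
    then have "w \<in> W \<union> Z" "u \<notin> nbh E D'"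
      using W(2,3) symD[OF assms(2) u(1)] by blast+
    then show False
      using u by (auto simp: D''_def nbh_def)
  qed
  then have "nbh E D'' \<subseteq> Z"
    by (auto simp: nbh_def)
  then have "card (nbh E D'') < q"
    using card_mono[OF Z(1)] Z(3) by (meson le_less_trans)
  then show thesis
    using that(2)[of D''] assms(3) by (auto simp: D''_def)
qed

text \<open>Gaps larger than \<open>K\<close> keep a region non-empty after a boundary of at most
  \<open>K\<close> vertices is removed from it.\<close>

definition gapped :: "nat \<Rightarrow> (nat \<Rightarrow> 'a set) \<Rightarrow> nat \<Rightarrow> bool" where
  "gapped K D n \<longleftrightarrow> (\<forall>i<n. D (Suc i) \<subseteq> D i \<and> K < card (D i - D (Suc i)))"

lemma gapped_antimono: "gapped K D n \<Longrightarrow> i \<le> j \<Longrightarrow> j \<le> n \<Longrightarrow> D j \<subseteq> D i"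
proof (induction j)
  case (Suc j)
  then show ?case
    by (cases "i = Suc j") (auto simp: gapped_def dest!: spec[of _ j])
qed auto

text \<open>The single gap \<open>D j - D (Suc j)\<close> lies inside \<open>A - B\<close>. This is
  how gaps survive the passage to sets squeezed between members of the chain.\<close>

lemma gapped_gap:
  assumes "gapped K D n" "finite (D 0)" "i \<le> j" "Suc j \<le> k" "k \<le> n" "A \<subseteq> D i" "D j \<subseteq> A" "D k \<subseteq> B" "B \<subseteq> D (Suc j)"
  shows "K < card (A - B)"
proof -
  have "A \<subseteq> D 0"
    using gapped_antimono[OF assms(1), of 0 i] assms by auto
  then have "finite (A - B)"
    using assms(2) finite_subset by blast
  then have "card (D j - D (Suc j)) \<le> card (A - B)"
    using assms by (intro card_mono) auto
  moreover have "K < card (D j - D (Suc j))"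
    using assms by (auto simp: gapped_def)
  ultimately show ?thesis
    by simp
qed

text \<open>In the recursion the chain is cut into \<open>link_length q r + 1\<close> blocks of
  \<open>r + 1\<close> consecutive indices each, and the value is the last index of the last
  block.\<close>

fun link_length :: "nat \<Rightarrow> nat \<Rightarrow> nat" where
  "link_length 0 r = r"
| "link_length (Suc q) r = link_length q r * Suc r + r"

text \<open>Induction on the bound for the boundary sizes. If the ends of some block are joined by
  \<open>Suc q\<close> disjoint connected sets, that block is as wanted. Otherwise every block
  contains a set with boundary at most \<open>q\<close>, and these sets form a chain for the
  induction hypothesis.\<close>

lemma linked_subchain:
  assumes "finite E" "sym E"
  shows "gapped K D (link_length q r) \<Longrightarrow> finite (D 0) \<Longrightarrow>
    (\<And>i. i \<le> link_length q r \<Longrightarrow> card (nbh E (D i)) \<le> q) \<Longrightarrow>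
    \<exists>p\<le>q. \<exists>D' \<Q>. gapped K D' r \<and> D' 0 \<subseteq> D 0 \<and> D (link_length q r) \<subseteq> D' r \<and>
      (\<forall>i\<le>r. card (nbh E (D' i)) = p) \<and> finite \<Q> \<and> card \<Q> = p \<and> linkage E (nbh E (D' 0)) (nbh E (D' r)) \<Q>"
proof (induction q arbitrary: D)
  case 0
  then have "linkage E (nbh E (D 0)) (nbh E (D r)) {}"
    by (simp add: linkage_def)
  then show ?case
    using 0 by (intro exI[of _ 0] conjI exI[of _ D] exI[of _ "{}"]) auto
next
  case (Suc q)
  define n where "n = link_length q r"
  \<comment> \<open>Block \<open>i\<close> consists of the indices from \<open>a i\<close> to
    \<open>a i + r\<close>.\<close>
  define a where "a i = i * Suc r" for i
  have bound: "a i + r \<le> link_length (Suc q) r" if "i \<le> n" for i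
    using mult_le_mono1[OF that, of "Suc r"] by (simp add: a_def n_def del: mult_Suc_right)
  have a_Suc: "a (Suc i) = Suc (a i + r)" for i
    by (simp add: a_def)
  have anti: "D (a i + r) \<subseteq> D (a i)" if "i \<le> n" for i
    using gapped_antimono[OF Suc.prems(1)] bound[OF that] by auto
  show ?case
  proof (cases "\<exists>i\<le>n. \<exists>\<Q>. finite \<Q> \<and> card \<Q> = Suc q \<and> linkage E (nbh E (D (a i))) (nbh E (D (a i + r))) \<Q>")
    case True
    then obtain i \<Q> where i: "i \<le> n" and Q: "finite \<Q>" "card \<Q> = Suc q"
        "linkage E (nbh E (D (a i))) (nbh E (D (a i + r))) \<Q>"
      by blast
    define D' where "D' j = D (a i + j)" for j
    \<comment> \<open>Every member of the linkage crosses each boundary of the block, which gives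
      the lower bound; the upper bound is assumed.\<close>
    have "card (nbh E (D' j)) = Suc q" if "j \<le> r" for j
    proof (rule antisym)
      show "card (nbh E (D' j)) \<le> Suc q"
        using Suc.prems(3) bound[OF i] that by (simp add: D'_def)
      have sub: "D (a i + r) \<subseteq> D' j" "D' j \<subseteq> D (a i)"
        using gapped_antimono[OF Suc.prems(1)] bound[OF i] that by (auto simp: D'_def)
      have "Q \<inter> nbh E (D' j) \<noteq> {}" if "Q \<in> \<Q>" for Q
        using Q(3) that conn_meets_nbh[OF _ _ _ sub] by (auto simp: linkage_def)
      then have "card \<Q> \<le> card (nbh E (D' j))"
        using Q(3) assms(1) by (intro card_disjoint_le) (auto simp: linkage_def)
      then show "Suc q \<le> card (nbh E (D' j))"
        using Q(2) by simp
    qed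
    moreover have "gapped K D' r"
      using Suc.prems(1) bound[OF i] by (auto simp: gapped_def D'_def)
    moreover have "linkage E (nbh E (D' 0)) (nbh E (D' r)) \<Q>"
      using Q(3) by (simp add: D'_def)
    moreover have "D' 0 \<subseteq> D 0" "D (link_length (Suc q) r) \<subseteq> D' r"
      using gapped_antimono[OF Suc.prems(1)] bound[OF i] by (auto simp: D'_def)
    ultimately show ?thesis
      using Q by (intro exI[of _ "Suc q"] conjI exI[of _ D'] exI[of _ \<Q>]) auto
  next
    case False
    have "\<exists>D''. D (a i + r) \<subseteq> D'' \<and> D'' \<subseteq> D (a i) \<and> card (nbh E D'') < Suc q" if "i \<le> n" for i
      using nested_menger[OF assms anti[OF that], of "Suc q"] False that by metis
    then obtain D'' where D'': "\<And>i. i \<le> n \<Longrightarrow> D (a i + r) \<subseteq> D'' i \<and> D'' i \<subseteq> D (a i) \<and> card (nbh E (D'' i)) < Suc q"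
      by metis
    have gap: "gapped K D'' n"
      unfolding gapped_def
    proof (intro allI impI conjI)
      fix i assume "i < n"
      then have i: "i \<le> n" "Suc i \<le> n"
        by auto
      \<comment> \<open>The step from the last index of block \<open>i\<close> to the first index of
        the next block lies between the two chosen sets and supplies the gap.\<close>
      show "K < card (D'' i - D'' (Suc i))"
      proof (rule gapped_gap[OF Suc.prems(1,2), of "a i" "a i + r" "a (Suc i) + r"])
        show "a (Suc i) + r \<le> link_length (Suc q) r"
          by (rule bound[OF i(2)])
      qed (use D''[OF i(1)] D''[OF i(2)] a_Suc in auto)
      have "D (a (Suc i)) \<subseteq> D (a i + r)"
        using gapped_antimono[OF Suc.prems(1)] bound[OF i(2)] a_Suc by auto
      then show "D'' (Suc i) \<subseteq> D'' i"
        using D''[OF i(1)] D''[OF i(2)] by blast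
    qed
    have ends: "D'' 0 \<subseteq> D 0" "D (link_length (Suc q) r) \<subseteq> D'' n"
      using D''[of 0] D''[of n] by (auto simp: a_def n_def)
    then have "finite (D'' 0)"
      using Suc.prems(2) finite_subset by blast
    then obtain p D' \<Q> where p: "p \<le> q" "gapped K D' r" "D' 0 \<subseteq> D'' 0" "D'' n \<subseteq> D' r"
      "\<forall>i\<le>r. card (nbh E (D' i)) = p" "finite \<Q>" "card \<Q> = p" "linkage E (nbh E (D' 0)) (nbh E (D' r)) \<Q>"
      using Suc.IH[of D''] gap D'' less_Suc_eq_le unfolding n_def[symmetric] by metis
    then show ?thesis
      using ends by (intro exI[of _ p] conjI exI[of _ D'] exI[of _ \<Q>]) auto
  qed
qed

text \<open>Induction on \<open>g\<close>, which bounds how far the common part of the two end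
  boundaries falls short of \<open>p\<close>. Split the interval into \<open>r\<close> equal parts.
  If the ends of some part share more vertices, the induction continues there; otherwise all
  consecutive intersections equal the intersection of the two ends.\<close>

lemma constant_intersections:
  fixes D :: "nat \<Rightarrow> 'a set" and r :: nat
  assumes anti: "\<And>i j. i \<le> j \<Longrightarrow> j \<le> n \<Longrightarrow> D j \<subseteq> D i"
    and card: "\<And>i. i \<le> n \<Longrightarrow> card (nbh E (D i)) = p" and "finite E" and "0 < r"
  shows "a + r ^ g \<le> n \<Longrightarrow> p < g + card (nbh E (D a) \<inter> nbh E (D (a + r ^ g))) \<Longrightarrow>
    \<exists>f F. strict_mono f \<and> f r \<le> n \<and>
      (\<forall>i j. i < j \<longrightarrow> j \<le> r \<longrightarrow> nbh E (D (f i)) \<inter> nbh E (D (f j)) = F)"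
proof (induction g arbitrary: a)
  case 0
  have "card (nbh E (D a) \<inter> nbh E (D (a + 1))) \<le> card (nbh E (D a))"
    using \<open>finite E\<close> by (intro card_mono) auto
  then show ?case
  proof -
    have "a \<le> n"
      using 0(1) by simp
    then have "card (nbh E (D a)) = p"
      by (rule card)
    then have False
      using 0 \<open>card (nbh E (D a) \<inter> _) \<le> _\<close> by simp
    then show ?thesis ..
  qed
next
  case (Suc g)
  define f where "f i = a + i * r ^ g" for i
  have f_Suc: "f (Suc i) = f i + r ^ g" for i
    by (simp add: f_def)
  have mono: "strict_mono f"
    using \<open>0 < r\<close> by (simp add: strict_mono_Suc_iff f_Suc)
  have fr: "f r = a + r ^ Suc g" "f 0 = a"
    by (auto simp: f_def)
  have le: "f i \<le> n" if "i \<le> r" for i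
    using strict_mono_less_eq[OF mono, of i r] that fr Suc.prems(1) by linarith
  define F where "F = nbh E (D a) \<inter> nbh E (D (f r))"
  show ?case
  proof (cases "\<exists>i<r. p < g + card (nbh E (D (f i)) \<inter> nbh E (D (f (Suc i))))")
    case True
    then obtain i where "i < r" "p < g + card (nbh E (D (f i)) \<inter> nbh E (D (f i + r ^ g)))"
      by (auto simp: f_Suc)
    then show ?thesis
      using Suc.IH[of "f i"] le[of "Suc i"] by (simp add: f_Suc)
  next
    case False
    have sub: "nbh E (D (f i)) \<inter> nbh E (D (f j)) \<subseteq> nbh E (D (f k))" if "i \<le> k" "k \<le> j" "j \<le> r" for i j k
      using that le[OF that(3)] le[of k] mono by (intro nbh_between anti) (auto simp: strict_mono_less_eq)
    have F: "F \<subseteq> nbh E (D (f i))" if "i \<le> r" for i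
      using sub[of 0 i r] that fr by (auto simp: F_def)
    have step: "nbh E (D (f i)) \<inter> nbh E (D (f (Suc i))) = F" if "i < r" for i
    proof (rule card_seteq[symmetric])
      show "F \<subseteq> nbh E (D (f i)) \<inter> nbh E (D (f (Suc i)))"
        using F that by auto
      show "card (nbh E (D (f i)) \<inter> nbh E (D (f (Suc i)))) \<le> card F"
        using False that Suc.prems(2) fr unfolding F_def by fastforce
    qed (use \<open>finite E\<close> in auto)
    \<comment> \<open>A vertex common to the boundaries \<open>i\<close> and \<open>j\<close> is
      also in the boundary \<open>Suc i\<close>, so the consecutive case suffices.\<close>
    have "nbh E (D (f i)) \<inter> nbh E (D (f j)) = F" if "i < j" "j \<le> r" for i j
      using sub[of i "Suc i" j] step[of i] F[of i] F[of j] that by auto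
    then show ?thesis
      using mono Suc.prems(1) fr by (intro exI[of _ f] exI[of _ F]) auto
  qed
qed

text \<open>The exponent \<open>Suc q\<close> covers every boundary size \<open>p \<le> q\<close>:
  for \<open>g = Suc p\<close> the size condition of \<open>constant_intersections\<close> holds
  trivially.\<close>

definition chain_length :: "nat \<Rightarrow> nat \<Rightarrow> nat" where
  "chain_length q r = link_length q (r ^ Suc q)"

lemma uniform_subchain:
  assumes "finite E" "sym E" "0 < r"
    and gap: "gapped K D (chain_length q r)" and fin: "finite (D 0)"
    and q: "\<And>i. i \<le> chain_length q r \<Longrightarrow> card (nbh E (D i)) \<le> q"
  obtains p D' F \<Q> where "p \<le> q" "gapped K D' r" "D' 0 \<subseteq> D 0" "D (chain_length q r) \<subseteq> D' r"
    "\<And>i. i \<le> r \<Longrightarrow> card (nbh E (D' i)) = p"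
    "finite \<Q>" "card \<Q> = p" "linkage E (nbh E (D' 0)) (nbh E (D' r)) \<Q>"
    "\<And>i j. i < j \<Longrightarrow> j \<le> r \<Longrightarrow> nbh E (D' i) \<inter> nbh E (D' j) = F"
proof -
  define n where "n = r ^ Suc q"
  obtain p D1 \<Q> where p: "p \<le> q" and D1: "gapped K D1 n" "D1 0 \<subseteq> D 0" "D (chain_length q r) \<subseteq> D1 n"
    "\<And>i. i \<le> n \<Longrightarrow> card (nbh E (D1 i)) = p"
    and Q: "finite \<Q>" "card \<Q> = p" "linkage E (nbh E (D1 0)) (nbh E (D1 n)) \<Q>"
    using linked_subchain[OF assms(1,2), of K D q n] gap fin q
    unfolding chain_length_def n_def by metis
  have anti: "D1 j \<subseteq> D1 i" if "i \<le> j" "j \<le> n" for i j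
    using gapped_antimono[OF D1(1) that] .
  have "r ^ Suc p \<le> n"
    unfolding n_def using p \<open>0 < r\<close> by (intro power_increasing) auto
  then obtain f F where f: "strict_mono f" "f r \<le> n"
      "\<forall>i j. i < j \<longrightarrow> j \<le> r \<longrightarrow> nbh E (D1 (f i)) \<inter> nbh E (D1 (f j)) = F"
    using constant_intersections[where n = n and D = D1 and a = 0 and g = "Suc p", OF anti D1(4) assms(1,3)]
    by auto
  have le: "f i \<le> n" if "i \<le> r" for i
    using f(1,2) that by (meson le_trans strict_mono_less_eq)
  have fin1: "finite (D1 0)"
    using D1(2) fin finite_subset by blast
  show thesis
  proof (rule that[of p "D1 \<circ> f" \<Q> F])
    show "gapped K (D1 \<circ> f) r"
      unfolding gapped_def
    proof (intro allI impI conjI)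
      fix i assume "i < r"
      then have i: "f i < f (Suc i)" "f (Suc i) \<le> n"
        using f(1) le[of "Suc i"] by (auto simp: strict_mono_Suc_iff)
      show "(D1 \<circ> f) (Suc i) \<subseteq> (D1 \<circ> f) i"
        using anti i by auto
      show "K < card ((D1 \<circ> f) i - (D1 \<circ> f) (Suc i))"
        by (rule gapped_gap[OF D1(1) fin1, of "f i" "f i" "f (Suc i)"]) (use i anti in auto)
    qed
    \<comment> \<open>The linkage joins the ends of the longer chain; its members cross all
      boundaries in between and therefore also link the ends of the subchain.\<close>
    have "Q \<inter> nbh E (D1 (f i)) \<noteq> {}" if "Q \<in> \<Q>" "i \<le> r" for i Q
    proof (rule conn_meets_nbh)
      show "conn E Q" "Q \<inter> nbh E (D1 0) \<noteq> {}" "Q \<inter> nbh E (D1 n) \<noteq> {}"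
        using Q(3) that(1) by (auto simp: linkage_def)
      show "D1 n \<subseteq> D1 (f i)" "D1 (f i) \<subseteq> D1 0"
        using anti[of "f i" n] anti[of 0 "f i"] le[OF that(2)] by auto
    qed
    then show "linkage E (nbh E ((D1 \<circ> f) 0)) (nbh E ((D1 \<circ> f) r)) \<Q>"
      using Q(3) unfolding linkage_def by (metis comp_apply le0 order_refl)
    show "(D1 \<circ> f) 0 \<subseteq> D 0" "D (chain_length q r) \<subseteq> (D1 \<circ> f) r"
      using D1(2,3) anti[of 0 "f 0"] anti[of "f r" n] le[of 0] f(2) by auto
    show "card (nbh E ((D1 \<circ> f) i)) = p" if "i \<le> r" for i
      using D1(4)[OF le[OF that]] by simp
    show "nbh E ((D1 \<circ> f) i) \<inter> nbh E ((D1 \<circ> f) j) = F" if "i < j" "j \<le> r" for i j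
      using f(3) that by auto
  qed (fact p Q(1,2))+
qed

lemma pigeonhole_fibre:
  assumes "finite A" "finite B" "f ` A \<subseteq> B" "card B * m < card A"
  obtains b where "b \<in> B" "m < card {a \<in> A. f a = b}"
proof -
  have "\<exists>b\<in>B. m < card {a \<in> A. f a = b}"
  proof (rule ccontr)
    assume "\<not> ?thesis"
    then have "(\<Sum>b\<in>B. card {a \<in> A. f a = b}) \<le> card B * m"
      using sum_bounded_above[of B "\<lambda>b. card {a \<in> A. f a = b}" m] by (simp add: not_less)
    moreover have "card A \<le> (\<Sum>b\<in>B. card {a \<in> A. f a = b})"
    proof -
      have "A = (\<Union>b\<in>B. {a \<in> A. f a = b})"
        using assms(3) by auto
      then show ?thesis
        using card_UN_le[OF assms(2), of "\<lambda>b. {a \<in> A. f a = b}"] by metis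
    qed
    ultimately show False
      using assms(4) by simp
  qed
  then show thesis
    using that by blast
qed

section \<open>Models of the two obstructions\<close>

text \<open>The part common to both obstructions: the branch sets that are adjacent to all of
  \<open>W\<close>.\<close>

definition hubs :: "'a set \<Rightarrow> 'a rel \<Rightarrow> nat \<Rightarrow> 'a set set \<Rightarrow> 'a set \<Rightarrow> bool" where
  "hubs V E n \<Q> W \<longleftrightarrow> disjoint \<Q> \<and> finite \<Q> \<and> card \<Q> = n \<and>
    (\<forall>Q\<in>\<Q>. conn E Q \<and> Q \<subseteq> V \<and> (\<forall>w\<in>W. E `` {w} \<inter> Q \<noteq> {}))"

text \<open>A model of \<open>K_{t,m}\<close> in which the side of size \<open>m\<close> is
  represented by single vertices.\<close>

definition star_model :: "'a set \<Rightarrow> 'a rel \<Rightarrow> nat \<Rightarrow> nat \<Rightarrow> bool" where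
  "star_model V E t m \<longleftrightarrow> (\<exists>\<Q> W. hubs V E t \<Q> W \<and> finite W \<and> card W = m \<and> W \<subseteq> V \<and> W \<inter> \<Union>\<Q> = {})"

text \<open>A model of \<open>I_n + P_m\<close>. The path \<open>xs\<close> may have more than
  \<open>m\<close> vertices; it is later cut into \<open>m\<close> pieces, each with a marked vertex
  from \<open>W\<close>.\<close>

definition path_model :: "'a set \<Rightarrow> 'a rel \<Rightarrow> nat \<Rightarrow> nat \<Rightarrow> bool" where
  "path_model V E n m \<longleftrightarrow> (\<exists>\<Q> W xs. hubs V E n \<Q> W \<and> finite W \<and> card W = m \<and> W \<subseteq> set xs \<and>
    distinct xs \<and> successively (\<lambda>x y. (x, y) \<in> E) xs \<and> set xs \<subseteq> V \<and> set xs \<inter> \<Union>\<Q> = {})"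

definition island :: "'a rel \<Rightarrow> nat \<Rightarrow> 'a set \<Rightarrow> bool" where
  "island E t S \<longleftrightarrow> S \<noteq> {} \<and> (\<forall>v\<in>S. card (E `` {v} - S) < t)"

text \<open>If no \<open>D i\<close> is an island, each has a vertex with at least \<open>t\<close>
  neighbours outside \<open>D i\<close>, all of them in \<open>X\<close>. There are at most
  \<open>2 ^ card X\<close> such outside neighbourhoods, so \<open>m\<close> of these vertices share
  one; \<open>t\<close> of its elements serve as singleton hubs.\<close>

lemma island_if_no_star_model:
  assumes E: "E \<subseteq> V \<times> V" "finite V"
    and D: "\<And>i. i \<in> I \<Longrightarrow> D i \<noteq> {} \<and> D i \<subseteq> V \<and> nbh E (D i) \<subseteq> X" "disjoint_family_on D I"
    and I: "2 ^ card X * m < card I" and X: "finite X" "X \<subseteq> V"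
    and disj: "\<And>i. i \<in> I \<Longrightarrow> D i \<inter> X = {}"
    and no: "\<not> star_model V E t m"
  shows "\<exists>i\<in>I. island E t (D i)"
proof (rule ccontr)
  assume "\<not> ?thesis"
  then have "\<forall>i\<in>I. \<exists>v\<in>D i. t \<le> card (E `` {v} - D i)"
    using D(1) by (auto simp: island_def not_less)
  then obtain v where v: "\<And>i. i \<in> I \<Longrightarrow> v i \<in> D i \<and> t \<le> card (E `` {v i} - D i)"
    by metis
  have "finite I"
    using I by (metis card.infinite not_less_zero)
  then obtain Y where Y: "Y \<in> Pow X" "m < card {i \<in> I. E `` {v i} - D i = Y}"
  proof (rule pigeonhole_fibre[of I "Pow X" "\<lambda>i. E `` {v i} - D i" m])
    show "(\<lambda>i. E `` {v i} - D i) ` I \<subseteq> Pow X"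
    proof (intro subsetI PowI)
      fix Y u assume "Y \<in> (\<lambda>i. E `` {v i} - D i) ` I" "u \<in> Y"
      then obtain i where i: "i \<in> I" "u \<in> E `` {v i}" "u \<notin> D i"
        by blast
      then have "u \<in> nbh E (D i)"
        using v[OF i(1)] by (auto simp: nbh_def)
      then show "u \<in> X"
        using D(1)[OF i(1)] by blast
    qed
  qed (use X I \<open>finite I\<close> in \<open>auto simp: card_Pow\<close>)
  obtain L where L: "L \<subseteq> {i \<in> I. E `` {v i} - D i = Y}" "card L = m" "finite L"
    by (rule obtain_subset_with_card_n[OF less_imp_le[OF Y(2)]])
  have "{i \<in> I. E `` {v i} - D i = Y} \<noteq> {}"
    using Y(2) by (metis card.empty not_less_zero)
  then have "t \<le> card Y"
    using v by auto
  then obtain T where T: "T \<subseteq> Y" "card T = t" "finite T"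
    by (meson obtain_subset_with_card_n)
  have "inj_on v L"
  proof (rule inj_onI, rule ccontr)
    fix i j assume ij: "i \<in> L" "j \<in> L" "v i = v j" "i \<noteq> j"
    then have "v i \<in> D i \<inter> D j"
      using L(1) v[of i] v[of j] by auto
    then show False
      using D(2) ij L(1) by (auto simp: disjoint_family_on_def)
  qed
  have "hubs V E t ((\<lambda>x. {x}) ` T) (v ` L)"
    unfolding hubs_def using T Y(1) X(2) L(1) by (auto simp: disjoint_def card_image)
  moreover have "card (v ` L) = m"
    using \<open>inj_on v L\<close> L(2) by (simp add: card_image)
  moreover have "v ` L \<subseteq> V" "v ` L \<inter> \<Union>((\<lambda>x. {x}) ` T) = {}"
    using L(1) v D(1) disj T(1) Y(1) by fastforce+
  ultimately show False
    using no L(3) unfolding star_model_def by blast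
qed

text \<open>A connected set contains a path between its two ends. Passing to the vertex sets of such
  paths prepares the list required by \<open>path_model\<close>.\<close>

lemma linkage_by_paths:
  assumes "linkage E A B \<Q>" "sym E" "finite \<Q>"
  obtains \<P> where "linkage E A B \<P>" "card \<P> = card \<Q>" "finite \<P>"
    "\<And>P. P \<in> \<P> \<Longrightarrow> \<exists>xs. set xs = P \<and> distinct xs \<and> successively (\<lambda>x y. (x, y) \<in> E) xs"
proof -
  have "\<exists>xs. xs \<noteq> [] \<and> set xs \<subseteq> Q \<and> distinct xs \<and> successively (\<lambda>x y. (x, y) \<in> E) xs \<and>
      set xs \<inter> A \<noteq> {} \<and> set xs \<inter> B \<noteq> {}" if "Q \<in> \<Q>" for Q
  proof -
    obtain a b where ab: "a \<in> Q" "a \<in> A" "b \<in> Q" "b \<in> B" and "conn E Q"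
      using assms(1) \<open>Q \<in> \<Q>\<close> unfolding linkage_def by blast
    then obtain xs where xs: "distinct xs" "xs \<noteq> []" "hd xs = a" "last xs = b" "set xs \<subseteq> Q"
        "successively (\<lambda>x y. (x, y) \<in> E) xs"
      using conn_imp_path by metis
    moreover have "a \<in> set xs" "b \<in> set xs"
      using xs hd_in_set last_in_set by metis+
    ultimately show ?thesis
      using ab by blast
  qed
  then obtain f where f: "\<And>Q. Q \<in> \<Q> \<Longrightarrow> f Q \<noteq> [] \<and> set (f Q) \<subseteq> Q \<and> distinct (f Q) \<and>
      successively (\<lambda>x y. (x, y) \<in> E) (f Q) \<and> set (f Q) \<inter> A \<noteq> {} \<and> set (f Q) \<inter> B \<noteq> {}"
    by metis
  have disj: "set (f P) \<inter> set (f Q) = {}" if "P \<in> \<Q>" "Q \<in> \<Q>" "P \<noteq> Q" for P Q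
    using f[OF that(1)] f[OF that(2)] disjointD[of \<Q> P Q] assms(1) that unfolding linkage_def by blast
  have inj: "inj_on (\<lambda>Q. set (f Q)) \<Q>"
  proof (rule inj_onI, rule ccontr)
    fix P Q assume "P \<in> \<Q>" "Q \<in> \<Q>" "set (f P) = set (f Q)" "P \<noteq> Q"
    then show False
      using disj[of P Q] f[of P] by auto
  qed
  show thesis
  proof (rule that)
    show "linkage E A B ((\<lambda>Q. set (f Q)) ` \<Q>)"
      unfolding linkage_def
    proof (intro conjI ballI)
      show "disjoint ((\<lambda>Q. set (f Q)) ` \<Q>)"
        using disj by (intro disjointI) auto
      show "conn E Q" if "Q \<in> (\<lambda>Q. set (f Q)) ` \<Q>" for Q
        using that f conn_set[OF assms(2)] by auto
    qed (use f in auto)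
    show "card ((\<lambda>Q. set (f Q)) ` \<Q>) = card \<Q>"
      using inj by (rule card_image)
    show "\<exists>xs. set xs = P \<and> distinct xs \<and> successively (\<lambda>x y. (x, y) \<in> E) xs"
      if "P \<in> (\<lambda>Q. set (f Q)) ` \<Q>" for P
      using that f by auto
  qed (use assms(3) in simp)
qed

text \<open>All outside neighbours lie in the two end boundaries, and \<open>D1\<close> or
  \<open>D2\<close> shields \<open>v\<close> from one of them. If \<open>v\<close> is in
  \<open>D1\<close>, a neighbour in the outer boundary is also in \<open>nbh E D1\<close>, hence in
  \<open>F\<close>; otherwise a neighbour in the inner boundary is in \<open>F\<close>. Both end
  boundaries contain \<open>F\<close>.\<close>

lemma one_sided_boundary:
  assumes "sym E" "D1 \<subseteq> D0" "D2 \<subseteq> D1" "D3 \<subseteq> D2"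
    and F: "nbh E D0 \<inter> nbh E D1 = F" "nbh E D0 \<inter> nbh E D3 = F" "nbh E D1 \<inter> nbh E D2 = F"
      "nbh E D1 \<inter> nbh E D3 = F" "nbh E D2 \<inter> nbh E D3 = F"
    and v: "v \<in> D0 - D3 - nbh E D3"
  shows "E `` {v} - (D0 - D3 - nbh E D3) \<subseteq> nbh E D0 \<or> E `` {v} - (D0 - D3 - nbh E D3) \<subseteq> nbh E D3"
proof -
  let ?X = "E `` {v} - (D0 - D3 - nbh E D3)"
  have out: "u \<notin> D" if "u \<in> ?X" "v \<notin> D" "v \<notin> nbh E D" for u D
    using that symD[OF assms(1)] by (auto simp: nbh_def)
  have X: "?X \<subseteq> nbh E D0 \<union> nbh E D3"
  proof
    fix u assume u: "u \<in> ?X"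
    have "u \<notin> D3"
      using out[OF u, of D3] v by blast
    then have "u \<in> nbh E D3 \<or> u \<notin> D0"
      using u by blast
    then show "u \<in> nbh E D0 \<union> nbh E D3"
      using u v unfolding nbh_def by blast
  qed
  \<comment> \<open>Here \<open>v\<close> lies outside \<open>D\<close> and its boundary, so it has
    no neighbour in \<open>D\<close>; a neighbour in \<open>nbh E D3\<close> must then be in
    \<open>nbh E D\<close>, hence in \<open>F\<close>.\<close>
  have case2: ?thesis if "v \<notin> D" "v \<notin> nbh E D" "D3 \<subseteq> D" "nbh E D \<inter> nbh E D3 = F" for D
  proof -
    have "u \<in> nbh E D0" if "u \<in> ?X" for u
    proof (cases "u \<in> nbh E D0")
      case False
      then have "u \<in> nbh E D3"
        using X that by blast
      moreover have "u \<in> D \<union> nbh E D"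
        using nbh_subset_Un[OF \<open>D3 \<subseteq> D\<close>] calculation by blast
      ultimately show ?thesis
        using out[OF \<open>u \<in> ?X\<close>] \<open>v \<notin> D\<close> \<open>v \<notin> nbh E D\<close> F(2) \<open>nbh E D \<inter> nbh E D3 = F\<close> by blast
    qed
    then show ?thesis
      by blast
  qed
  show ?thesis
  proof (cases "v \<in> D1")
    case True
    have "u \<in> nbh E D3" if "u \<in> ?X" "u \<in> nbh E D0" for u
    proof -
      have "u \<in> nbh E D1"
        using True that assms(2) by (auto simp: nbh_def)
      then show ?thesis
        using that F by blast
    qed
    then show ?thesis
      using X by blast
  next
    case False
    show ?thesis
    proof (cases "v \<in> nbh E D1")
      case True
      \<comment> \<open>A vertex on the boundary of \<open>D1\<close> is shielded by
        \<open>D2\<close> instead: the boundaries of \<open>D1\<close> and \<open>D2\<close> share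
        only \<open>F\<close>, and \<open>F\<close> lies in the excluded boundary of
        \<open>D3\<close>.\<close>
      have "v \<notin> F"
        using F(2) v by blast
      then have "v \<notin> nbh E D2"
        using F(3) True by blast
      moreover have "v \<notin> D2"
        using False assms(3) by blast
      ultimately show ?thesis
        using case2 assms(4) F(5) by blast
    next
      case nv: False
      show ?thesis
        using case2[OF False nv _ F(4)] assms(3,4) by blast
    qed
  qed
qed

text \<open>Three chain steps make one region, and \<open>4 ^ q * m + 1\<close> regions force more
  than \<open>m\<close> vertices of equal type, a type being a pair of subsets of a set of at most
  \<open>q\<close> paths.\<close>

definition path_length :: "nat \<Rightarrow> nat \<Rightarrow> nat" where
  "path_length q m = chain_length q (3 * Suc (4 ^ q * m))"

text \<open>Region \<open>l\<close> lies between the members \<open>3 * l\<close> and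
  \<open>3 * l + 3\<close> of a uniform subchain. Vertices that violate the island property, one
  from each region, combine with the linkage to one of the two models.\<close>

lemma island_if_no_model:
  assumes E: "E \<subseteq> V \<times> V" "finite V" "sym E"
    and gap: "gapped q D (path_length q m)" and D0: "D 0 \<subseteq> V"
    and q: "\<And>i. i \<le> path_length q m \<Longrightarrow> card (nbh E (D i)) \<le> q"
    and no: "\<not> star_model V E t m" "\<not> path_model V E (t - 1) m"
  shows "\<exists>S. island E t S \<and> S \<subseteq> D 0 - D (path_length q m)"
proof (rule ccontr)
  assume no_island: "\<not> ?thesis"
  define M where "M = Suc (4 ^ q * m)"
  have finE: "finite E"
    using E finite_subset by blast
  have finD: "finite (D 0)"
    using D0 E(2) finite_subset by blast
  have plen: "path_length q m = chain_length q (3 * M)"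
    by (simp add: path_length_def M_def)
  have "0 < 3 * M"
    by (simp add: M_def)
  then obtain p D' F \<Q>0 where p: "p \<le> q" and D': "gapped q D' (3 * M)" "D' 0 \<subseteq> D 0"
      "D (path_length q m) \<subseteq> D' (3 * M)" "\<And>i. i \<le> 3 * M \<Longrightarrow> card (nbh E (D' i)) = p"
      and Q0: "finite \<Q>0" "card \<Q>0 = p" "linkage E (nbh E (D' 0)) (nbh E (D' (3 * M))) \<Q>0"
      and F: "\<And>i j. i < j \<Longrightarrow> j \<le> 3 * M \<Longrightarrow> nbh E (D' i) \<inter> nbh E (D' j) = F"
    using uniform_subchain[OF finE E(3), of "3 * M" q D q] gap finD q unfolding plen by metis
  obtain \<Q> where Q: "linkage E (nbh E (D' 0)) (nbh E (D' (3 * M))) \<Q>" "card \<Q> = p" "finite \<Q>"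
      "\<And>Q. Q \<in> \<Q> \<Longrightarrow> \<exists>xs. set xs = Q \<and> distinct xs \<and> successively (\<lambda>x y. (x, y) \<in> E) xs"
    using linkage_by_paths[OF Q0(3) E(3) Q0(1)] Q0(2) by metis
  have disjQ: "disjoint \<Q>" and connQ: "\<And>Q. Q \<in> \<Q> \<Longrightarrow> conn E Q"
    using Q(1) by (auto simp: linkage_def)
  have QV: "Q \<subseteq> V" if "Q \<in> \<Q>" for Q
  proof (rule conn_subset[OF connQ[OF that]])
    show "Q \<inter> V \<noteq> {}"
      using Q(1) that E(1) unfolding linkage_def nbh_def by blast
  qed (use E(1) in auto)
  have anti: "D' j \<subseteq> D' i" if "i \<le> j" "j \<le> 3 * M" for i j
    using gapped_antimono[OF D'(1) that] .
  \<comment> \<open>The inner boundary is taken out of the region, so that its vertices count as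
    outside neighbours.\<close>
  define R where "R l = D' (3 * l) - D' (3 * l + 3) - nbh E (D' (3 * l + 3))" for l
  have R_subset: "R l \<subseteq> D 0 - D (path_length q m)" if "l < M" for l
    using anti[of 0 "3 * l"] anti[of "3 * l + 3" "3 * M"] that D'(2,3) by (auto simp: R_def)
  \<comment> \<open>The gap has more than \<open>q\<close> vertices and the removed boundary only
    \<open>p \<le> q\<close>.\<close>
  have "R l \<noteq> {}" if "l < M" for l
  proof
    assume "R l = {}"
    then have "D' (3 * l) - D' (3 * l + 3) \<subseteq> nbh E (D' (3 * l + 3))"
      by (auto simp: R_def)
    then have "card (D' (3 * l) - D' (3 * l + 3)) \<le> p"
      using D'(4)[of "3 * l + 3"] that finE by (metis Suc_leI card_mono finite_nbh mult_Suc_right add.commute mult_le_mono2)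
    moreover have "q < card (D' (3 * l) - D' (3 * l + 3))"
    proof (rule gapped_gap[OF D'(1), of "3 * l" "3 * l" "3 * l + 3"])
      show "finite (D' 0)"
        using finD D'(2) finite_subset by blast
      show "D' (3 * l + 3) \<subseteq> D' (Suc (3 * l))"
        using anti that by simp
    qed (use that in auto)
    ultimately show False
      using p by simp
  qed
  then have "\<exists>v\<in>R l. t \<le> card (E `` {v} - R l)" if "l < M" for l
    using no_island R_subset[OF that] that unfolding island_def by (metis not_less)
  then obtain v where v: "\<And>l. l < M \<Longrightarrow> v l \<in> R l \<and> t \<le> card (E `` {v l} - R l)"
    by metis
  have vV: "v l \<in> V" if "l < M" for l
    using v[OF that] R_subset[OF that] D0 by blast
  define J where "J x = {Q \<in> \<Q>. E `` {x} \<inter> Q \<noteq> {}}" for x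
  \<comment> \<open>Each boundary has exactly \<open>p\<close> vertices, one on each of the
    \<open>p\<close> paths. Hence \<open>t\<close> neighbours in a single boundary lie on
    \<open>t\<close> different paths.\<close>
  have J: "t \<le> card (J (v l))" if "l < M" for l
  proof -
    have le: "3 * l + 3 \<le> 3 * M"
      using that by simp
    have "E `` {v l} - R l \<subseteq> nbh E (D' (3 * l)) \<or> E `` {v l} - R l \<subseteq> nbh E (D' (3 * l + 3))"
      unfolding R_def
    proof (rule one_sided_boundary[OF E(3), of "D' (3 * l + 1)" _ "D' (3 * l + 2)"])
      show "v l \<in> D' (3 * l) - D' (3 * l + 3) - nbh E (D' (3 * l + 3))"
        using v[OF that] by (simp add: R_def)
      show "D' (3 * l + 1) \<subseteq> D' (3 * l)" "D' (3 * l + 2) \<subseteq> D' (3 * l + 1)"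
        "D' (3 * l + 3) \<subseteq> D' (3 * l + 2)"
        using le by (simp_all add: anti)
    qed (rule F; use le in simp)+
    then obtain i where i: "i \<le> 3 * M" "E `` {v l} - R l \<subseteq> nbh E (D' i)"
      using le by (metis le_add1 le_trans)
    have sub: "D' (3 * M) \<subseteq> D' i" "D' i \<subseteq> D' 0"
      using anti i(1) by auto
    have meets: "Q \<inter> nbh E (D' i) \<noteq> {}" if "Q \<in> \<Q>" for Q
      using conn_meets_nbh[OF connQ[OF that] _ _ sub] Q(1) that by (auto simp: linkage_def)
    obtain c where c: "c ` nbh E (D' i) = \<Q>" "inj_on c (nbh E (D' i))"
        "\<And>z. z \<in> nbh E (D' i) \<Longrightarrow> z \<in> c z"
      using disjoint_transversal[OF disjQ meets] finE Q(2,3) D'(4)[OF i(1)] by (metis finite_nbh)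
    have "c ` (E `` {v l} - R l) \<subseteq> J (v l)"
      using c i(2) by (auto simp: J_def)
    moreover have "finite (J (v l))"
      using Q(3) by (simp add: J_def)
    moreover have "card (c ` (E `` {v l} - R l)) = card (E `` {v l} - R l)"
      using c(2) i(2) by (meson card_image inj_on_subset)
    ultimately show ?thesis
      using v[OF that] by (metis card_mono le_trans)
  qed
  have inj: "inj_on v {..<M}"
  proof -
    have "v l \<noteq> v l'" if "l < l'" "l' < M" for l l'
      using v[of l] v[of l'] that anti[of "3 * l + 3" "3 * l'"] by (auto simp: R_def)
    then show ?thesis
      by (intro inj_onI) (metis lessThan_iff nat_neq_iff)
  qed
  \<comment> \<open>The type of \<open>v l\<close>: the paths on which it has neighbours, and the
    path that contains it, if any.\<close>
  define g where "g l = (J (v l), {Q \<in> \<Q>. v l \<in> Q})" for l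
  have "card (Pow \<Q> \<times> Pow \<Q>) = 4 ^ p"
    using Q(2,3) by (simp add: card_cartesian_product card_Pow flip: power_mult_distrib)
  also have "\<dots> \<le> 4 ^ q"
    using p by (intro power_increasing) auto
  finally have large: "card (Pow \<Q> \<times> Pow \<Q>) * m < card {..<M}"
    by (simp add: M_def le_imp_less_Suc)
  have types: "g ` {..<M} \<subseteq> Pow \<Q> \<times> Pow \<Q>"
    by (auto simp: g_def J_def)
  have "finite (Pow \<Q> \<times> Pow \<Q>)"
    using Q(3) by simp
  then obtain b where b: "m < card {l \<in> {..<M}. g l = b}"
    by (rule pigeonhole_fibre[OF finite_lessThan _ types large])
  obtain L where L: "L \<subseteq> {l \<in> {..<M}. g l = b}" "card L = m" "finite L"
    by (rule obtain_subset_with_card_n[OF less_imp_le[OF b]])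
  define W where "W = v ` L"
  have W: "finite W" "card W = m" "W \<subseteq> V"
    using L vV inj card_image[of v L] inj_on_subset[of v "{..<M}" L] by (auto simp: W_def)
  have "{l \<in> {..<M}. g l = b} \<noteq> {}"
    using b by (metis card.empty not_less_zero)
  then obtain l where l: "l < M" "g l = b"
    by auto
  have tJ: "t \<le> card (J (v l))"
    by (rule J[OF l(1)])
  have same: "J w = J (v l)" "{Q \<in> \<Q>. w \<in> Q} = {Q \<in> \<Q>. v l \<in> Q}" if "w \<in> W" for w
    using that L(1) l(2) by (auto simp: W_def g_def)
  have hubs: "hubs V E n \<P> W" if "\<P> \<subseteq> J (v l)" "card \<P> = n" "finite \<P>" for \<P> n
    unfolding hubs_def
  proof (intro conjI ballI)
    have sub: "\<P> \<subseteq> \<Q>"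
      using that by (auto simp: J_def)
    show "disjoint \<P>"
      by (rule pairwise_subset[OF disjQ sub])
    show "conn E P" "P \<subseteq> V" if "P \<in> \<P>" for P
      using connQ QV sub that by auto
    show "E `` {w} \<inter> P \<noteq> {}" if "P \<in> \<P>" "w \<in> W" for P w
      using same(1)[OF that(2)] that(1) \<open>\<P> \<subseteq> J (v l)\<close> by (auto simp: J_def)
  qed (use that in auto)
  show False
  proof (cases "\<exists>Q\<in>\<Q>. v l \<in> Q")
    case False
    obtain \<P> where P: "\<P> \<subseteq> J (v l)" "card \<P> = t" "finite \<P>"
      by (rule obtain_subset_with_card_n[OF tJ])
    have "W \<inter> \<Union>\<P> = {}"
      using same(2) False P(1) by (fastforce simp: J_def)
    then show False
      using hubs[OF P] W no(1) unfolding star_model_def by blast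
  next
    case True
    then obtain Q where Q': "Q \<in> \<Q>" "v l \<in> Q"
      by auto
    obtain xs where xs: "set xs = Q" "distinct xs" "successively (\<lambda>x y. (x, y) \<in> E) xs"
      using Q(4)[OF Q'(1)] by auto
    \<comment> \<open>The path \<open>Q\<close> that carries \<open>W\<close> cannot be a hub; this
      loss of one accounts for the \<open>t - 1\<close> independent vertices of the second
      obstruction.\<close>
    have "t - 1 \<le> card (J (v l) - {Q})"
      using tJ diff_card_le_card_Diff[of "{Q}" "J (v l)"] by simp
    then obtain \<P> where P: "\<P> \<subseteq> J (v l) - {Q}" "card \<P> = t - 1" "finite \<P>"
      by (meson obtain_subset_with_card_n)
    have "W \<subseteq> Q"
      using same(2) Q' by blast
    moreover have "Q \<inter> P = {}" if "P \<in> \<P>" for P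
      using that P(1) Q'(1) by (intro disjointD[OF disjQ]) (auto simp: J_def)
    then have "Q \<inter> \<Union>\<P> = {}"
      by blast
    moreover have "\<P> \<subseteq> J (v l)"
      using P(1) by blast
    ultimately have "path_model V E (t - 1) m"
      unfolding path_model_def using hubs[OF _ P(2,3)] W xs QV[OF Q'(1)] by metis
    with no(2) show False
      by simp
  qed
qed

section \<open>Elimination orders\<close>

text \<open>The sets \<open>U v\<close> are the earlier neighbours of \<open>v\<close> in a chordal supergraph with perfect
  elimination order \<open>ord\<close>; the latest element of \<open>U v\<close> is the parent of \<open>v\<close> in the elimination forest.\<close>

locale elimination =
  fixes V :: "'a set" and E :: "'a rel" and ord :: "'a \<Rightarrow> nat" and U :: "'a \<Rightarrow> 'a set" and k :: nat
  assumes finite_V: "finite V" and E_subset: "E \<subseteq> V \<times> V" and sym_E: "sym E"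
    and inj_ord: "inj_on ord V"
    and U_subset: "v \<in> V \<Longrightarrow> U v \<subseteq> V"
    and U_less: "v \<in> V \<Longrightarrow> u \<in> U v \<Longrightarrow> ord u < ord v"
    and U_card: "v \<in> V \<Longrightarrow> card (U v) \<le> k"
    and U_edge: "(u, v) \<in> E \<Longrightarrow> u \<in> U v \<or> v \<in> U u"
    and U_clique: "v \<in> V \<Longrightarrow> u \<in> U v \<Longrightarrow> w \<in> U v \<Longrightarrow> ord u < ord w \<Longrightarrow> u \<in> U w"
begin

definition P :: "'a rel" where
  "P = {(w, p). w \<in> V \<and> p \<in> U w \<and> (\<forall>u\<in>U w. ord u \<le> ord p)}"

definition D :: "'a \<Rightarrow> 'a set" where
  "D v = {w \<in> V. (w, v) \<in> P\<^sup>*}"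

lemma finite_U: "v \<in> V \<Longrightarrow> finite (U v)"
  using U_subset finite_V finite_subset by blast

lemma P_in_V: "(w, p) \<in> P \<Longrightarrow> w \<in> V \<and> p \<in> V"
  using U_subset by (auto simp: P_def)

lemma P_less: "(w, p) \<in> P \<Longrightarrow> ord p < ord w"
  using U_less by (auto simp: P_def)

lemma P_single_valued: "single_valued P"
proof (rule single_valuedI)
  fix w p q assume *: "(w, p) \<in> P" "(w, q) \<in> P"
  then have "ord p = ord q"
    unfolding P_def by (simp add: antisym)
  then show "p = q"
    using inj_ord * P_in_V by (meson inj_onD)
qed

lemma P_rtrancl_le: "(w, v) \<in> P\<^sup>* \<Longrightarrow> ord v \<le> ord w"
  by (induction rule: rtrancl_induct) (auto dest!: P_less)

lemma parent_exists: "w \<in> V \<Longrightarrow> U w \<noteq> {} \<Longrightarrow> \<exists>p. (w, p) \<in> P"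
proof -
  assume w: "w \<in> V" "U w \<noteq> {}"
  have "Max (ord ` U w) \<in> ord ` U w"
    using finite_U[OF w(1)] w(2) by (intro Max_in) auto
  then obtain p where p: "Max (ord ` U w) = ord p" "p \<in> U w"
    by (rule imageE)
  then have "\<forall>u\<in>U w. ord u \<le> ord p"
    using finite_U[OF w(1)] by (metis Max_ge finite_imageI imageI)
  with p w show ?thesis
    by (auto simp: P_def)
qed

text \<open>The parent is the latest element of \<open>U w\<close>, so the clique condition puts all
  other elements of \<open>U w\<close> into \<open>U p\<close>.\<close>

lemma U_parent: "(w, p) \<in> P \<Longrightarrow> U w \<subseteq> insert p (U p)"
proof
  fix u assume "(w, p) \<in> P" "u \<in> U w"
  then have "ord u \<le> ord p" "w \<in> V" "p \<in> U w" "u \<in> V" "p \<in> V"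
    using U_subset by (auto simp: P_def)
  then show "u \<in> insert p (U p)"
    using U_clique[of w u p] \<open>u \<in> U w\<close> inj_ord by (auto simp: le_less dest: inj_onD)
qed

lemma U_ancestor: "(w, v) \<in> P\<^sup>* \<Longrightarrow> U w \<subseteq> D v \<union> U v"
proof (induction rule: converse_rtrancl_induct)
  case (step w p)
  then have "p \<in> D v"
    using P_in_V by (auto simp: D_def)
  then show ?case
    using step U_parent[of w p] by blast
qed auto

text \<open>Either \<open>u\<close> is the parent of \<open>w\<close>, or it is an earlier neighbour
  of the parent, and the induction continues there.\<close>

lemma U_imp_ancestor: "w \<in> V \<Longrightarrow> u \<in> U w \<Longrightarrow> (w, u) \<in> P\<^sup>*"
proof (induction "ord w" arbitrary: w rule: less_induct)
  case less
  then obtain p where p: "(w, p) \<in> P"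
    using parent_exists by blast
  then have "u = p \<or> u \<in> U p"
    using U_parent less.prems(2) by blast
  then show ?case
    using p less.hyps[of p] P_less P_in_V by (meson converse_rtrancl_into_rtrancl r_into_rtrancl)
qed

lemma D_subset_V: "D v \<subseteq> V"
  by (auto simp: D_def)

lemma finite_D: "finite (D v)"
  using D_subset_V finite_V finite_subset by blast

lemma in_D_self: "v \<in> V \<Longrightarrow> v \<in> D v"
  by (simp add: D_def)

lemma D_le: "w \<in> D v \<Longrightarrow> ord v \<le> ord w"
  using P_rtrancl_le by (auto simp: D_def)

lemma D_mono: "(w, v) \<in> P\<^sup>* \<Longrightarrow> D w \<subseteq> D v"
  by (auto simp: D_def)

text \<open>An edge that leaves \<open>D v\<close> at \<open>w\<close> ends in \<open>U w\<close>,
  since otherwise its other end would be a descendant of \<open>w\<close> and thus of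
  \<open>v\<close>. Outside \<open>D v\<close>, the set \<open>U w\<close> is contained in
  \<open>U v\<close>.\<close>

lemma nbh_D: "v \<in> V \<Longrightarrow> nbh E (D v) \<subseteq> U v"
proof
  fix u assume "v \<in> V" "u \<in> nbh E (D v)"
  then obtain w where w: "w \<in> D v" "(w, u) \<in> E" "u \<notin> D v"
    by (auto simp: nbh_def)
  then have "u \<in> V" "w \<in> V" "(w, v) \<in> P\<^sup>*"
    using E_subset by (auto simp: D_def)
  have "w \<notin> U u"
    using U_imp_ancestor[OF \<open>u \<in> V\<close>, of w] w(3) \<open>(w, v) \<in> P\<^sup>*\<close> \<open>u \<in> V\<close>
    by (auto simp: D_def dest: rtrancl_trans)
  then have "u \<in> U w"
    using U_edge[OF w(2)] by blast
  then show "u \<in> U v"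
    using U_ancestor[OF \<open>(w, v) \<in> P\<^sup>*\<close>] w(3) by blast
qed

lemma card_nbh_D: "v \<in> V \<Longrightarrow> card (nbh E (D v)) \<le> k"
  using card_mono[OF finite_U nbh_D] U_card by (meson le_trans)

definition children :: "'a \<Rightarrow> 'a set" where
  "children v = {c. (c, v) \<in> P}"

lemma children_subset_V: "children v \<subseteq> V"
  using P_in_V by (auto simp: children_def)

lemma finite_children: "finite (children v)"
  using children_subset_V finite_V finite_subset by blast

text \<open>The last two hypotheses treat siblings and roots at once: neither node is an ancestor of
  the other, while the ancestors of a common descendant would form a chain, because \<open>P\<close>
  is single-valued.\<close>

lemma D_disjoint:
  assumes "c \<noteq> c'" "\<And>p p'. (c, p) \<in> P \<Longrightarrow> (c', p') \<in> P \<Longrightarrow> p = p'"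
    "(\<exists>p. (c, p) \<in> P) \<longleftrightarrow> (\<exists>p. (c', p) \<in> P)"
  shows "D c \<inter> D c' = {}"
proof -
  have *: "(c, c') \<notin> P\<^sup>*" if ne: "c \<noteq> c'" and same: "\<And>p p'. (c, p) \<in> P \<Longrightarrow> (c', p') \<in> P \<Longrightarrow> p = p'"
    "(\<exists>p. (c, p) \<in> P) \<longleftrightarrow> (\<exists>p. (c', p) \<in> P)" for c c'
  proof
    assume "(c, c') \<in> P\<^sup>*"
    then obtain p where p: "(c, p) \<in> P" "(p, c') \<in> P\<^sup>*"
      using ne by (blast elim: converse_rtranclE)
    then have "(c', p) \<in> P"
      using same by blast
    then show False
      using P_less[of c' p] P_rtrancl_le[OF p(2)] by simp
  qed
  show ?thesis
  proof (rule ccontr)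
    assume "D c \<inter> D c' \<noteq> {}"
    then obtain w where "(w, c) \<in> P\<^sup>*" "(w, c') \<in> P\<^sup>*"
      by (auto simp: D_def)
    then have "(c, c') \<in> P\<^sup>* \<or> (c', c) \<in> P\<^sup>*"
      using single_valued_confluent[OF P_single_valued] by metis
    then show False
      using *[of c c'] *[of c' c] assms by metis
  qed
qed

lemma children_disjoint: "disjoint_family_on D (children v)"
  unfolding disjoint_family_on_def
proof (intro ballI impI D_disjoint)
  fix c c' p p' assume "c \<in> children v" "c' \<in> children v" "(c, p) \<in> P" "(c', p') \<in> P"
  then show "p = p'"
    using P_single_valued unfolding children_def by (metis mem_Collect_eq single_valuedD)
qed (auto simp: children_def)

lemma D_children: "v \<in> V \<Longrightarrow> D v = insert v (\<Union>c\<in>children v. D c)"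
  unfolding D_def children_def
  by (auto elim: rtranclE intro: rtrancl_into_rtrancl)

lemma not_in_D_child: "c \<in> children v \<Longrightarrow> v \<notin> D c"
  using P_less[of c v] D_le[of v c] by (auto simp: children_def)

lemma card_D_children: "v \<in> V \<Longrightarrow> card (D v) = Suc (\<Sum>c\<in>children v. card (D c))"
  using D_children[of v] not_in_D_child[of _ v] finite_D finite_children[of v]
    card_UN_disjoint'[OF children_disjoint[of v]] by (simp add: card_insert_if)

lemma relpow_in_V: "(y, v) \<in> P ^^ j \<Longrightarrow> v \<in> V \<Longrightarrow> y \<in> V"
  by (metis P_in_V relpow_0_E relpow_E2)

lemma relpow_rtrancl: "(y, v) \<in> P ^^ j \<Longrightarrow> (y, v) \<in> P\<^sup>*"
  by (rule relpow_imp_rtrancl)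

definition roots :: "'a set" where
  "roots = {v \<in> V. \<forall>p. (v, p) \<notin> P}"

lemma UN_roots: "(\<Union>v\<in>roots. D v) = V"
proof -
  have "\<exists>r\<in>roots. (w, r) \<in> P\<^sup>*" if "w \<in> V" for w
    using that
  proof (induction "ord w" arbitrary: w rule: less_induct)
    case less
    show ?case
    proof (cases "w \<in> roots")
      case False
      then obtain p where "(w, p) \<in> P"
        using less.prems by (auto simp: roots_def)
      then show ?thesis
        using less.hyps[of p] P_less P_in_V by (meson converse_rtrancl_into_rtrancl)
    qed auto
  qed
  then show ?thesis
    by (auto simp: D_def)
qed

lemma roots_disjoint: "disjoint_family_on D roots"
  unfolding disjoint_family_on_def by (intro ballI impI D_disjoint) (auto simp: roots_def)

lemma finite_roots: "finite roots"
  using finite_V by (simp add: roots_def)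

lemma nbh_root: "v \<in> roots \<Longrightarrow> nbh E (D v) = {}"
  using nbh_D[of v] parent_exists[of v] by (auto simp: roots_def)

end

section \<open>Packings of disjoint islands\<close>

definition pack :: "'a rel \<Rightarrow> nat \<Rightarrow> 'a set \<Rightarrow> nat \<Rightarrow> bool" where
  "pack E t X a \<longleftrightarrow> (\<exists>\<S>. disjoint \<S> \<and> finite \<S> \<and> card \<S> = a \<and> (\<forall>S\<in>\<S>. island E t S \<and> S \<subseteq> X))"

lemma pack_0: "pack E t X 0"
  unfolding pack_def by (intro exI[of _ "{}"]) auto

lemma pack_1: "island E t S \<Longrightarrow> S \<subseteq> X \<Longrightarrow> pack E t X 1"
  unfolding pack_def by (intro exI[of _ "{S}"]) auto

lemma pack_mono: "pack E t X a \<Longrightarrow> X \<subseteq> Y \<Longrightarrow> pack E t Y a"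
  unfolding pack_def by (elim ex_forward) auto

lemma pack_Un:
  assumes "pack E t X a" "pack E t Y b" "X \<inter> Y = {}"
  shows "pack E t (X \<union> Y) (a + b)"
proof -
  obtain \<S> \<T> where S: "disjoint \<S>" "finite \<S>" "card \<S> = a" "\<And>S. S \<in> \<S> \<Longrightarrow> island E t S \<and> S \<subseteq> X"
    and T: "disjoint \<T>" "finite \<T>" "card \<T> = b" "\<And>S. S \<in> \<T> \<Longrightarrow> island E t S \<and> S \<subseteq> Y"
    using assms(1,2) unfolding pack_def by metis
  \<comment> \<open>Islands are non-empty and so cannot lie in both of the disjoint sets; hence the
    cardinalities add.\<close>
  have "\<S> \<inter> \<T> = {}"
    using S(4) T(4) assms(3) by (fastforce simp: island_def)
  moreover have "disjoint (\<S> \<union> \<T>)"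
    using S(1,4) T(1,4) assms(3) by (intro disjoint_union) blast+
  ultimately show ?thesis
    unfolding pack_def using S T by (intro exI[of _ "\<S> \<union> \<T>"]) (auto simp: card_Un_disjoint)
qed

lemma pack_UN:
  assumes "finite I" "disjoint_family_on X I" "\<And>i. i \<in> I \<Longrightarrow> pack E t (X i) (a i)"
  shows "pack E t (\<Union>i\<in>I. X i) (\<Sum>i\<in>I. a i)"
  using assms
proof (induction I rule: finite_induct)
  case (insert i I)
  have "X i \<inter> (\<Union>j\<in>I. X j) = {}"
    using insert.prems(1) insert.hyps(2) unfolding disjoint_family_on_def by fastforce
  then show ?case
    using insert pack_Un[of E t "X i" "a i" "\<Union>j\<in>I. X j" "\<Sum>j\<in>I. a j"]
    by (auto simp: disjoint_family_on_def)
qed (simp add: pack_0)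

section \<open>Counting islands in the elimination forest\<close>

locale obstruction_free = elimination +
  fixes t m :: nat
  assumes t_pos: "1 \<le> t"
    and no_star: "\<not> star_model V E t m" and no_path: "\<not> path_model V E (t - 1) m"
begin

text \<open>Every \<open>Suc k\<close> consecutive vertices of a forest path supply one gap larger
  than \<open>k\<close>, and \<open>path_length k m\<close> gaps are needed.\<close>

definition depth :: nat where
  "depth = path_length k m * Suc k"

text \<open>For a child \<open>c\<close> of \<open>v\<close> the boundary of \<open>D c\<close> lies
  in \<open>insert v (U v)\<close>, which has at most \<open>Suc k\<close> elements; this is the
  exponent in the pigeonhole bound.\<close>

definition degree :: nat where
  "degree = 2 ^ Suc k * m"

definition has_island :: "'a \<Rightarrow> bool" where
  "has_island v \<longleftrightarrow> (\<exists>S. island E t S \<and> S \<subseteq> D v)"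

lemma island_on_path:
  assumes "(y, v) \<in> P ^^ depth" "v \<in> V"
  shows "\<exists>S. island E t S \<and> S \<subseteq> D v - D y"
proof -
  define n where "n = path_length k m"
  obtain f where f: "f 0 = y" "f depth = v" "\<And>i. i < depth \<Longrightarrow> (f i, f (Suc i)) \<in> P"
    using assms(1) relpow_fun_conv by metis
  have ord: "ord (f j) < ord (f i)" if "i < j" "j \<le> depth" for i j
    using that
  proof (induction j)
    case (Suc j)
    then show ?case
      using P_less[OF f(3)[of j]] by (cases "i = j") auto
  qed simp
  have anc: "(f i, f j) \<in> P\<^sup>*" if "i \<le> j" "j \<le> depth" for i j
    using that
  proof (induction j)
    case (Suc j)
    then show ?case
      using f(3)[of j] by (cases "i = Suc j") (auto intro: rtrancl_into_rtrancl)
  qed simp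
  have fV: "f i \<in> V" if "i \<le> depth" for i
    using f(2,3) assms(2) P_in_V that by (metis le_neq_implies_less)
  \<comment> \<open>Every \<open>Suc k\<close>-th vertex on the way down is taken, from
    \<open>D v\<close> at index \<open>0\<close> to \<open>D y\<close> at index
    \<open>n\<close>.\<close>
  define D' where "D' i = D (f (depth - i * Suc k))" for i
  have "gapped k D' n"
    unfolding gapped_def
  proof (intro allI impI)
    fix i assume "i < n"
    then have "Suc i * Suc k \<le> depth"
      unfolding depth_def n_def[symmetric] by (intro mult_le_mono1) simp
    \<comment> \<open>Writing \<open>depth\<close> as a sum removes the truncated subtraction: gap
      \<open>i\<close> lies between \<open>f (a + Suc k)\<close> and \<open>f a\<close>.\<close>
    then obtain a where a: "depth = a + Suc i * Suc k"
      by (metis add.commute le_Suc_ex)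
    have eq: "D' i = D (f (a + Suc k))" "D' (Suc i) = D (f a)"
      by (auto simp: D'_def a)
    have le: "a + Suc k \<le> depth"
      by (simp add: a)
    have "inj_on f {a<..a + Suc k}"
      using ord le by (intro inj_onI) (metis greaterThanAtMost_iff le_trans less_irrefl linorder_neqE_nat)
    then have "card (f ` {a<..a + Suc k}) = Suc k"
      by (simp add: card_image)
    moreover have "f ` {a<..a + Suc k} \<subseteq> D' i - D' (Suc i)"
    proof
      fix x assume "x \<in> f ` {a<..a + Suc k}"
      then obtain j where j: "x = f j" "a < j" "j \<le> a + Suc k"
        by auto
      then have "x \<in> D' i"
        using anc[of j "a + Suc k"] fV[of j] le unfolding eq D_def by auto
      moreover have "x \<notin> D' (Suc i)"
        using D_le[of x "f a"] ord[of a j] j le unfolding eq by auto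
      ultimately show "x \<in> D' i - D' (Suc i)"
        by simp
    qed
    ultimately have "Suc k \<le> card (D' i - D' (Suc i))"
      using finite_D by (metis D'_def card_mono finite_Diff)
    then show "D' (Suc i) \<subseteq> D' i \<and> k < card (D' i - D' (Suc i))"
      using D_mono[OF anc[of a "a + Suc k"]] le unfolding eq by auto
  qed
  moreover have "card (nbh E (D' i)) \<le> k" for i
    unfolding D'_def by (intro card_nbh_D fV) simp
  ultimately have "\<exists>S. island E t S \<and> S \<subseteq> D' 0 - D' n"
    unfolding n_def
    using island_if_no_model[OF E_subset finite_V sym_E _ _ _ no_star no_path, of k D'] D_subset_V
    by (auto simp: D'_def)
  then show ?thesis
    using f by (simp add: D'_def depth_def n_def)
qed

text \<open>With \<open>depth = 0\<close> the trivial path at \<open>v\<close> would carry an island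
  inside the empty set \<open>D v - D v\<close>.\<close>

lemma depth_pos: "v \<in> V \<Longrightarrow> 0 < depth"
  using island_on_path[of v v] by (auto simp: island_def intro: gr0I)

text \<open>With more such children, \<open>island_if_no_star_model\<close> for
  \<open>X = insert v (U v)\<close> would make \<open>D c\<close> itself an island for one of
  them.\<close>

lemma few_clean_children:
  assumes "v \<in> V"
  shows "card {c \<in> children v. \<not> has_island c} \<le> degree"
proof (rule ccontr)
  let ?I = "{c \<in> children v. \<not> has_island c}"
  assume "\<not> ?thesis"
  then have large: "degree < card ?I"
    by simp
  have "card (insert v (U v)) \<le> Suc k"
    using U_card[OF assms] finite_U[OF assms] by (simp add: card_insert_if)
  then have "2 ^ card (insert v (U v)) * m \<le> degree"
    unfolding degree_def by (intro mult_le_mono1 power_increasing) auto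
  then have "\<exists>c\<in>?I. island E t (D c)"
  proof (intro island_if_no_star_model[OF E_subset finite_V _ _ _ _ _ _ no_star, of _ _ "insert v (U v)"])
    fix c assume "c \<in> ?I"
    then have c: "(c, v) \<in> P" "c \<in> V"
      using P_in_V by (auto simp: children_def)
    show "D c \<noteq> {} \<and> D c \<subseteq> V \<and> nbh E (D c) \<subseteq> insert v (U v)"
      using in_D_self[OF c(2)] D_subset_V nbh_D[OF c(2)] U_parent[OF c(1)] by blast
    show "D c \<inter> insert v (U v) = {}"
      using D_le[of _ c] P_less[OF c(1)] U_less[OF assms] by fastforce
  next
    show "disjoint_family_on D ?I"
      using children_disjoint[of v] by (rule disjoint_family_on_mono[rotated]) auto
  qed (use large finite_U U_subset assms in auto)
  then show False
    by (auto simp: has_island_def)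
qed

text \<open>The number of vertices of a tree with levels \<open>0\<close> to
  \<open>depth - 1\<close> in which each inner vertex has \<open>degree\<close> children.\<close>

definition clean_size :: nat where
  "clean_size = (\<Sum>i<depth. degree ^ i)"

lemma has_island_mono: "has_island w \<Longrightarrow> (w, v) \<in> P\<^sup>* \<Longrightarrow> has_island v"
  unfolding has_island_def using D_mono by blast

text \<open>No descendant of \<open>v\<close> has an island below it either. So each has at most
  \<open>degree\<close> children, and a path of \<open>depth\<close> steps below \<open>v\<close> is
  impossible because it would yield an island.\<close>

lemma clean_bounded:
  assumes "v \<in> V" "\<not> has_island v"
  shows "card (D v) \<le> clean_size"
proof -
  define L where "L i = {w. (w, v) \<in> P ^^ i}" for i
  have LV: "L i \<subseteq> V" for i
    using relpow_in_V assms(1) by (auto simp: L_def)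
  have card_L: "finite (L i) \<and> card (L i) \<le> degree ^ i" for i
  proof (induction i)
    case (Suc i)
    have "L (Suc i) = (\<Union>u\<in>L i. {c \<in> children u. \<not> has_island c})"
    proof -
      have "\<not> has_island c" if "(c, v) \<in> P ^^ Suc i" for c
        using has_island_mono[OF _ relpow_rtrancl[OF that]] assms(2) by blast
      then show ?thesis
        unfolding L_def children_def by (blast elim: relpow_Suc_E2 intro: relpow_Suc_I2)
    qed
    then have "card (L (Suc i)) \<le> (\<Sum>u\<in>L i. card {c \<in> children u. \<not> has_island c})"
      using card_UN_le[of "L i" "\<lambda>u. {c \<in> children u. \<not> has_island c}"] Suc by (simp only:)
    also have "\<dots> \<le> card (L i) * degree"
    proof -
      have "card {c \<in> children u. \<not> has_island c} \<le> degree" if "u \<in> L i" for u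
        using few_clean_children LV that by blast
      then show ?thesis
        using sum_bounded_above[of "L i" "\<lambda>u. card {c \<in> children u. \<not> has_island c}" degree] by simp
    qed
    also have "\<dots> \<le> degree ^ Suc i"
      using Suc by simp
    finally show ?case
      using LV finite_V finite_subset by blast
  qed (simp add: L_def)
  have "D v \<subseteq> (\<Union>i<depth. L i)"
  proof
    fix w assume "w \<in> D v"
    then obtain i where i: "(w, v) \<in> P ^^ i"
      by (auto simp: D_def rtrancl_is_UN_relpow)
    have "i < depth"
    proof (rule ccontr)
      assume "\<not> i < depth"
      then have "(w, v) \<in> P ^^ (i - depth) O P ^^ depth"
        using i relpow_add[of "i - depth" depth P] by simp
      then obtain u where "(u, v) \<in> P ^^ depth"
        by auto
      then show False
        using island_on_path assms unfolding has_island_def by blast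
    qed
    then show "w \<in> (\<Union>i<depth. L i)"
      using i by (auto simp: L_def)
  qed
  then have "card (D v) \<le> card (\<Union>i<depth. L i)"
    using card_L by (intro card_mono) auto
  also have "\<dots> \<le> (\<Sum>i<depth. card (L i))"
    by (rule card_UN_le) simp
  also have "\<dots> \<le> clean_size"
    unfolding clean_size_def using card_L by (intro sum_mono) auto
  finally show ?thesis .
qed

text \<open>Bounds the size of a vertex together with the subtrees of its island-free
  children.\<close>

definition node_cost :: nat where
  "node_cost = Suc (degree * clean_size)"

text \<open>The factor makes a branching into two pay exactly: two amounts of
  \<open>island_cost\<close> cover one \<open>node_cost\<close>, two paths of \<open>depth\<close>
  nodes, and one \<open>island_cost\<close> that is passed on.\<close>

definition island_cost :: nat where
  "island_cost = (2 * depth + 1) * node_cost"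

text \<open>The path from \<open>v\<close> down to \<open>y\<close> is kept free of islands, so that every \<open>depth\<close> steps it
  yields another one.\<close>

lemma many_islands_below:
  "v \<in> V \<Longrightarrow> has_island v \<Longrightarrow> \<exists>y j a. (y, v) \<in> P ^^ j \<and> j < depth \<and> pack E t (D y) a \<and>
    card (D v) + island_cost \<le> 2 * island_cost * a + j * node_cost"
proof (induction "card (D v)" arbitrary: v rule: less_induct)
  case less
  \<comment> \<open>In the inequality each of the \<open>a\<close> islands pays
    \<open>2 * island_cost\<close>, each of the \<open>j\<close> steps of the path pays
    \<open>node_cost\<close>, and the \<open>island_cost\<close> on the left is a reserve for later
    branchings.\<close>
  note v = less.prems(1)
  let ?N = "{c \<in> children v. \<not> has_island c}" and ?Q = "{c \<in> children v. has_island c}"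
  have fin: "finite ?N" "finite ?Q"
    using finite_children by auto
  have "children v = ?N \<union> ?Q"
    by blast
  then have "card (D v) = Suc (\<Sum>c\<in>?N \<union> ?Q. card (D c))"
    using card_D_children[OF v] by simp
  also have "(\<Sum>c\<in>?N \<union> ?Q. card (D c)) = (\<Sum>c\<in>?N. card (D c)) + (\<Sum>c\<in>?Q. card (D c))"
    using fin by (intro sum.union_disjoint) auto
  also have "(\<Sum>c\<in>?N. card (D c)) \<le> card ?N * clean_size"
    using sum_bounded_above[of ?N "\<lambda>c. card (D c)" clean_size] clean_bounded children_subset_V by auto
  also have "\<dots> \<le> degree * clean_size"
    using few_clean_children[OF v] by (rule mult_le_mono1)
  finally have card_D: "card (D v) \<le> node_cost + (\<Sum>c\<in>?Q. card (D c))"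
    by (simp add: node_cost_def)
  have "\<exists>y j a. (y, c) \<in> P ^^ j \<and> j < depth \<and> pack E t (D y) a \<and>
      card (D c) + island_cost \<le> 2 * island_cost * a + j * node_cost" if "c \<in> ?Q" for c
  proof (rule less.hyps)
    have "D c \<subseteq> D v" "v \<in> D v" "v \<notin> D c"
      using that D_mono[of c v] in_D_self[OF v] not_in_D_child by (auto simp: children_def)
    then show "card (D c) < card (D v)"
      using finite_D by (intro psubset_card_mono) auto
  qed (use that children_subset_V in auto)
  then have "\<forall>c\<in>?Q. \<exists>y j a. (y, c) \<in> P ^^ j \<and> j < depth \<and> pack E t (D y) a \<and>
      card (D c) + island_cost \<le> 2 * island_cost * a + j * node_cost"
    by blast
  from bchoice[OF this] obtain y where "\<forall>c\<in>?Q. \<exists>j a. (y c, c) \<in> P ^^ j \<and> j < depth \<and> pack E t (D (y c)) a \<and>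
      card (D c) + island_cost \<le> 2 * island_cost * a + j * node_cost" ..
  from bchoice[OF this] obtain j where "\<forall>c\<in>?Q. \<exists>a. (y c, c) \<in> P ^^ j c \<and> j c < depth \<and> pack E t (D (y c)) a \<and>
      card (D c) + island_cost \<le> 2 * island_cost * a + j c * node_cost" ..
  from bchoice[OF this] obtain a where IH: "\<And>c. c \<in> ?Q \<Longrightarrow> (y c, c) \<in> P ^^ j c \<and> j c < depth \<and> pack E t (D (y c)) (a c) \<and>
      card (D c) + island_cost \<le> 2 * island_cost * a c + j c * node_cost"
    by blast
  have depth: "0 < depth"
    by (rule depth_pos[OF v])
  have cost: "node_cost \<le> island_cost" "depth * node_cost \<le> island_cost"
    by (auto simp: island_cost_def algebra_simps)
  consider "?Q = {}" | c where "?Q = {c}" | "2 \<le> card ?Q"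
  proof -
    have "card ?Q = 0 \<or> card ?Q = 1 \<or> 2 \<le> card ?Q"
      by linarith
    then show thesis
      using that fin(2) by (metis (no_types, lifting) card_0_eq card_1_singletonE)
  qed
  then show ?case
  proof cases
    \<comment> \<open>Without such children \<open>D v\<close> has at most \<open>node_cost\<close>
      vertices, and its one island pays for them and for the reserve.\<close>
    case 1
    have "pack E t (D v) 1"
      using less.prems(2) pack_1 unfolding has_island_def by metis
    then show ?thesis
      using card_D cost(1) depth 1 by (intro exI[of _ v] exI[of _ 0] exI[of _ 1]) auto
  next
    \<comment> \<open>A single such child lengthens the path by one step, at a cost of
      \<open>node_cost\<close>.\<close>
    case (2 c)
    then have c: "(c, v) \<in> P" and "c \<in> ?Q"
      by (auto simp: children_def)
    note IHc = IH[OF \<open>c \<in> ?Q\<close>]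
    have step: "(y c, v) \<in> P ^^ Suc (j c)"
      using IHc c by auto
    have le: "card (D v) + island_cost \<le> 2 * island_cost * a c + Suc (j c) * node_cost"
      using card_D IHc by (simp add: 2)
    show ?thesis
    proof (cases "Suc (j c) < depth")
      case True
      then show ?thesis
        using step IHc le by blast
    next
      \<comment> \<open>A path of \<open>depth\<close> steps yields an island outside
        \<open>D (y c)\<close>. It pays for the whole path, which then restarts at
        \<open>v\<close>.\<close>
      case False
      then have eq: "Suc (j c) = depth"
        using IHc by simp
      then obtain S where S: "island E t S" "S \<subseteq> D v - D (y c)"
        using island_on_path[of "y c" v] step v by auto
      have "D (y c) \<subseteq> D v"
        using D_mono[OF relpow_rtrancl[OF step]] .
      then have "pack E t (D v) (1 + a c)"
        using pack_mono[OF pack_Un[OF pack_1[OF S(1)] _ , of "D v - D (y c)" "D (y c)" "a c"]] S(2) IHc by auto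
      moreover have "card (D v) + island_cost \<le> 2 * island_cost * (1 + a c) + 0 * node_cost"
        using le cost(2) unfolding eq by simp
      ultimately show ?thesis
        using depth by (intro exI[of _ v] exI[of _ 0] exI[of _ "1 + a c"]) auto
    qed
  next
    \<comment> \<open>At a branching the path restarts at \<open>v\<close>. The reserves of the
      \<open>q\<close> children cover their paths, the cost of \<open>v\<close> and the reserve for
      \<open>v\<close>.\<close>
    case 3
    define A where "A = (\<Sum>c\<in>?Q. a c)"
    define q where "q = card ?Q"
    have sub: "D (y c) \<subseteq> D c" if "c \<in> ?Q" for c
      using IH[OF that] D_mono relpow_rtrancl by blast
    have "pack E t (\<Union>c\<in>?Q. D c) A"
      unfolding A_def
    proof (rule pack_UN)
      show "disjoint_family_on D ?Q"
        using children_disjoint[of v] by (rule disjoint_family_on_mono[rotated]) auto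
      show "pack E t (D c) (a c)" if "c \<in> ?Q" for c
        using IH[OF that] sub[OF that] pack_mono by blast
    qed (rule fin)
    moreover have "(\<Union>c\<in>?Q. D c) \<subseteq> D v"
      using D_children[OF v] by blast
    ultimately have pack: "pack E t (D v) A"
      by (rule pack_mono)
    have "(\<Sum>c\<in>?Q. card (D c) + island_cost) \<le> (\<Sum>c\<in>?Q. 2 * island_cost * a c + depth * node_cost)"
    proof (rule sum_mono)
      fix c assume "c \<in> ?Q"
      then have "card (D c) + island_cost \<le> 2 * island_cost * a c + j c * node_cost" "j c \<le> depth"
        using IH by (auto intro: less_imp_le)
      then show "card (D c) + island_cost \<le> 2 * island_cost * a c + depth * node_cost"
        by (meson add_left_mono le_trans mult_le_mono1)
    qed
    then have sum: "(\<Sum>c\<in>?Q. card (D c)) + q * island_cost \<le> 2 * island_cost * A + q * (depth * node_cost)"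
      by (simp add: sum.distrib A_def q_def sum_distrib_left)
    obtain q' where q': "q = q' + 2"
      using 3 unfolding q_def by (metis add.commute le_Suc_ex)
    have "node_cost + q * (depth * node_cost) + island_cost \<le> q * island_cost"
      unfolding island_cost_def q' by (simp add: algebra_simps)
    then have "card (D v) + island_cost \<le> 2 * island_cost * A + 0 * node_cost"
      using card_D sum by linarith
    then show ?thesis
      using pack depth by (intro exI[of _ v] exI[of _ 0] exI[of _ A]) auto
  qed
qed

text \<open>The tree of a root has no outside neighbours, so it is an island and
  \<open>many_islands_below\<close> applies to the root. The reserve absorbs the remaining path
  cost, and the roots partition the vertices.\<close>

lemma many_islands: "\<exists>a. pack E t V a \<and> card V \<le> 2 * island_cost * a"
proof -
  have "\<exists>a. pack E t (D v) a \<and> card (D v) \<le> 2 * island_cost * a" if "v \<in> roots" for v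
  proof -
    have v: "v \<in> V"
      using that by (simp add: roots_def)
    have "E `` {w} - D v = {}" if "w \<in> D v" for w
      using nbh_root[OF \<open>v \<in> roots\<close>] that by (auto simp: nbh_def)
    then have "island E t (D v)"
      using in_D_self[OF v] t_pos unfolding island_def by (metis card.empty empty_iff less_eq_Suc_le One_nat_def)
    then have "has_island v"
      by (auto simp: has_island_def)
    then obtain y j a where *: "(y, v) \<in> P ^^ j" "j < depth" "pack E t (D y) a"
      "card (D v) + island_cost \<le> 2 * island_cost * a + j * node_cost"
      using many_islands_below[OF v] by blast
    have "j * node_cost \<le> depth * node_cost"
      using *(2) by simp
    also have "\<dots> \<le> island_cost"
      by (simp add: island_cost_def algebra_simps)
    finally have "card (D v) \<le> 2 * island_cost * a"
      using *(4) by linarith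
    then show ?thesis
      using *(3) pack_mono D_mono[OF relpow_rtrancl[OF *(1)]] by blast
  qed
  then obtain a where a: "\<And>v. v \<in> roots \<Longrightarrow> pack E t (D v) (a v) \<and> card (D v) \<le> 2 * island_cost * a v"
    by metis
  have "card V = (\<Sum>v\<in>roots. card (D v))"
    using card_UN_disjoint'[OF roots_disjoint finite_D finite_roots] UN_roots by simp
  also have "\<dots> \<le> (\<Sum>v\<in>roots. 2 * island_cost * a v)"
    using a by (intro sum_mono) auto
  also have "\<dots> = 2 * island_cost * (\<Sum>v\<in>roots. a v)"
    by (simp add: sum_distrib_left)
  finally show ?thesis
    using pack_UN[OF finite_roots roots_disjoint, of E t a] a UN_roots by auto
qed

end

section \<open>From tree decompositions to elimination orders\<close>

text \<open>Reachability in the library is relative to the vertex set; this makes no difference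
  because arcs stay among the vertices.\<close>

lemma strongly_connected_with_proj_iff:
  assumes "parcs H \<subseteq> pverts H \<times> pverts H"
  shows "strongly_connected (with_proj H) \<longleftrightarrow> conn (parcs H) (pverts H)"
proof -
  have "(u, v) \<in> rtrancl_on (pverts H) (parcs H) \<longleftrightarrow> (u, v) \<in> (parcs H)\<^sup>*"
    if "u \<in> pverts H" "v \<in> pverts H" for u v
  proof
    assume "(u, v) \<in> (parcs H)\<^sup>*"
    then show "(u, v) \<in> rtrancl_on (pverts H) (parcs H)"
      using that assms by (intro rtrancl_consistent_rtrancl_on) auto
  qed (rule rtrancl_on_rtranclI)
  then show ?thesis
    using assms by (auto simp: strongly_connected_def reachable_def conn_def Int_absorb2)
qed

lemma connected_induce_iff:
  assumes "sym (parcs G)"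
  shows "connected (with_proj G \<restriction> B) \<longleftrightarrow> conn (parcs G) B"
proof -
  have "parcs (mk_symmetric (with_proj G \<restriction> B)) = parcs G \<inter> B \<times> B"
    using symD[OF assms] by (auto simp: parcs_mk_symmetric)
  then show ?thesis
    unfolding connected_def by (subst strongly_connected_with_proj_iff) (auto simp: conn_def Int_assoc)
qed

lemma connected_with_proj_iff:
  assumes "sym (parcs G)" "parcs G \<subseteq> pverts G \<times> pverts G"
  shows "connected (with_proj G) \<longleftrightarrow> conn (parcs G) (pverts G)"
proof -
  have "parcs (mk_symmetric (with_proj G)) = parcs G"
    using symD[OF assms(1)] by (auto simp: parcs_mk_symmetric)
  then show ?thesis
    unfolding connected_def using assms by (subst strongly_connected_with_proj_iff) auto
qed

lemma pair_graph_iff: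
  "pair_graph G \<longleftrightarrow> finite (pverts G) \<and> parcs G \<subseteq> pverts G \<times> pverts G \<and> sym (parcs G) \<and> irrefl (parcs G)"
proof
  assume "pair_graph G"
  then interpret pair_graph G .
  show "finite (pverts G) \<and> parcs G \<subseteq> pverts G \<times> pverts G \<and> sym (parcs G) \<and> irrefl (parcs G)"
    using pair_finite_verts in_arcsD1 in_arcsD2 pair_sym_arcs no_loops'
    by (auto simp: symmetric_def intro!: irreflI) blast
next
  assume *: "finite (pverts G) \<and> parcs G \<subseteq> pverts G \<times> pverts G \<and> sym (parcs G) \<and> irrefl (parcs G)"
  then have "finite (parcs G)"
    using finite_subset by blast
  with * show "pair_graph G"
    by unfold_locales (auto simp: symmetric_def irrefl_def)
qed

text \<open>Cycles are vertex lists here, and \<open>ys \<noteq> []\<close> demands three vertices,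
  since the two arcs of one edge do not count as a cycle.\<close>

definition cycle_free :: "'a rel \<Rightarrow> bool" where
  "cycle_free F \<longleftrightarrow> (\<forall>x y ys. distinct (x # y # ys) \<longrightarrow> ys \<noteq> [] \<longrightarrow>
    successively (\<lambda>u v. (u, v) \<in> F) (x # y # ys) \<longrightarrow> (last ys, x) \<notin> F)"

text \<open>A bridge from vertex lists to the arc lists by which the library describes
  walks.\<close>

lemma arc_list_of_walk:
  "pcas x (zip (x # xs) xs) (last (x # xs))" "pawalk_verts x (zip (x # xs) xs) = x # xs"
  by (induction xs arbitrary: x) auto

lemma successively_imp_arcs: "successively (\<lambda>u v. (u, v) \<in> F) (x # xs) \<Longrightarrow> set (zip (x # xs) xs) \<subseteq> F"
  by (induction xs arbitrary: x) auto

lemma undirected_tree_cycle_free: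
  assumes "undirected_tree T"
  shows "cycle_free (parcs T)"
  unfolding cycle_free_def
proof (intro allI impI notI)
  interpret pair_graph T
    using assms by (simp add: undirected_tree_def)
  fix x y ys
  assume *: "distinct (x # y # ys)" "ys \<noteq> []" "successively (\<lambda>u v. (u, v) \<in> parcs T) (x # y # ys)"
    "(last ys, x) \<in> parcs T"
  \<comment> \<open>\<open>zs\<close> closes the cycle by returning to \<open>x\<close>.\<close>
  define zs where "zs = y # ys @ [x]"
  have "successively (\<lambda>u v. (u, v) \<in> parcs T) (x # zs)"
    using *(2-4) by (auto simp: zs_def successively_append_iff successively_Cons hd_append split: list.splits)
  then have "set (zip (x # zs) zs) \<subseteq> parcs T"
    by (rule successively_imp_arcs)
  moreover have "x \<in> pverts T"
    using *(4) in_arcsD2 by blast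
  moreover have "pcas x (zip (x # zs) zs) x"
    using arc_list_of_walk(1)[of x zs] by (simp add: zs_def)
  ultimately have "awalk x (zip (x # zs) zs) x"
    by (simp add: awalk_def)
  then have "cycle (zip (x # zs) zs)"
    using *(1) arc_list_of_walk(2)[of x zs] unfolding cycle_def by (auto simp: zs_def)
  moreover have "3 \<le> length (zip (x # zs) zs)"
    using *(2) by (cases ys) (auto simp: zs_def)
  ultimately show False
    using assms unfolding undirected_tree_def by blast
qed

text \<open>The first vertex of a longest path is a leaf: a further neighbour would either extend
  the path or close a cycle.\<close>

lemma leaf_exists:
  assumes "finite N" "conn F N" "sym F" "irrefl F" "cycle_free F" "2 \<le> card N"
  obtains l l' where "l \<in> N" "l' \<in> N" "l \<noteq> l'" "\<And>y. y \<in> N \<Longrightarrow> (l, y) \<in> F \<Longrightarrow> y = l'"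
proof -
  define path where "path xs \<longleftrightarrow> distinct xs \<and> set xs \<subseteq> N \<and> successively (\<lambda>u v. (u, v) \<in> F) xs" for xs
  obtain u where "u \<in> N"
    using assms(2) by (auto simp: conn_def)
  have "card (N - {u}) \<noteq> 0"
    using assms(6) \<open>u \<in> N\<close> by simp
  then have "N - {u} \<noteq> {}"
    by (metis card.empty)
  then obtain w where "w \<in> N" "u \<noteq> w"
    by auto
  then obtain ws where ws: "path ws" "ws \<noteq> []" "hd ws = u" "last ws = w"
    using conn_imp_path[OF assms(2) \<open>u \<in> N\<close> \<open>w \<in> N\<close>] unfolding path_def by metis
  have "length xs \<le> card N" if "path xs" for xs
    using that assms(1) unfolding path_def by (metis card_mono distinct_card)
  then obtain xs where xs: "path xs" "\<And>ys. path ys \<Longrightarrow> length ys \<le> length xs"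
    using ex_has_greatest_nat[of path ws length "Suc (card N)"] ws(1) le_imp_less_Suc by blast
  have "2 \<le> length ws"
    using ws(2-4) \<open>u \<noteq> w\<close> by (cases ws rule: remdups_adj.cases) auto
  then have "2 \<le> length xs"
    using xs(2)[OF ws(1)] by simp
  then obtain l l' zs where eq: "xs = l # l' # zs"
    by (metis Suc_le_length_iff numeral_2_eq_2)
  show thesis
  proof (rule that)
    show "l \<in> N" "l' \<in> N" "l \<noteq> l'"
      using xs(1) by (auto simp: eq path_def)
    fix y assume y: "y \<in> N" "(l, y) \<in> F"
    show "y = l'"
    proof (rule ccontr)
      assume "y \<noteq> l'"
      have "y \<noteq> l"
        using y(2) assms(4) by (auto simp: irrefl_def)
      have "y \<in> set zs"
      proof (rule ccontr)
        assume "y \<notin> set zs"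
        then have "path (y # xs)"
          using xs(1) y \<open>y \<noteq> l\<close> \<open>y \<noteq> l'\<close> symD[OF assms(3)] by (auto simp: path_def eq)
        then show False
          using xs(2) by fastforce
      qed
      then obtain as bs where zs: "zs = as @ y # bs"
        by (auto simp: in_set_conv_decomp)
      \<comment> \<open>The path up to \<open>y\<close>, together with the edge from
        \<open>y\<close> to \<open>l\<close>, is a cycle with at least the three vertices
        \<open>l\<close>, \<open>l'\<close> and \<open>y\<close>.\<close>
      have "xs = (l # l' # as @ [y]) @ bs"
        by (simp add: eq zs)
      then have "distinct (l # l' # as @ [y])" "successively (\<lambda>u v. (u, v) \<in> F) (l # l' # as @ [y])"
        using xs(1) unfolding path_def by (metis distinct_append, metis successively_append_iff)
      then show False
        using assms(5) symD[OF assms(3) y(2)] unfolding cycle_free_def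
        by (metis append_is_Nil_conv last_snoc not_Cons_self2)
    qed
  qed
qed

text \<open>A path between other vertices cannot pass through \<open>l\<close>, since both
  neighbours of \<open>l\<close> on the path would be \<open>l'\<close>.\<close>

lemma conn_remove_leaf:
  assumes "conn F S" "sym F" "S - {l} \<noteq> {}" "\<And>y. y \<in> S \<Longrightarrow> (l, y) \<in> F \<Longrightarrow> y = l'"
  shows "conn F (S - {l})"
  unfolding conn_def
proof (intro conjI ballI)
  fix x y assume xy: "x \<in> S - {l}" "y \<in> S - {l}"
  then obtain xs where xs: "distinct xs" "xs \<noteq> []" "hd xs = x" "last xs = y" "set xs \<subseteq> S"
      "successively (\<lambda>u v. (u, v) \<in> F) xs"
    using conn_imp_path[OF assms(1)] by (metis DiffD1)
  have "l \<notin> set xs"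
  proof
    assume "l \<in> set xs"
    then obtain as bs where eq: "xs = as @ l # bs"
      by (auto simp: in_set_conv_decomp)
    then have "as \<noteq> []" "bs \<noteq> []"
      using xs(3,4) xy by auto
    then have "(last as, l) \<in> F" "(l, hd bs) \<in> F" "last as \<in> set as" "hd bs \<in> set bs"
      using xs(6) by (auto simp: eq successively_append_iff successively_Cons)
    then have "last as = l'" "hd bs = l'"
      using assms(4) symD[OF assms(2)] xs(5) by (auto simp: eq subset_iff)
    then show False
      using xs(1) \<open>last as \<in> set as\<close> \<open>hd bs \<in> set bs\<close> by (auto simp: eq)
  qed
  then have "set xs \<subseteq> S - {l}"
    using xs(5) by auto
  moreover have "(x, y) \<in> (F \<inter> set xs \<times> set xs)\<^sup>*"
    using conn_set[OF assms(2) xs(6,2)] xs(2-4) unfolding conn_def by (metis hd_in_set last_in_set)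
  ultimately show "(x, y) \<in> (F \<inter> (S - {l}) \<times> (S - {l}))\<^sup>*"
    by (meson Int_mono Sigma_mono order_refl rtrancl_mono subsetD)
qed (rule assms(3))

text \<open>The last clause speaks of bags instead of edges, so that the induction over the tree
  does not mention the graph.\<close>

definition elimination_order ::
  "'a set \<Rightarrow> 'b set \<Rightarrow> ('b \<Rightarrow> 'a set) \<Rightarrow> nat \<Rightarrow> ('a \<Rightarrow> nat) \<Rightarrow> ('a \<Rightarrow> 'a set) \<Rightarrow> bool" where
  "elimination_order V N bag k ord U \<longleftrightarrow> inj_on ord V \<and>
    (\<forall>v\<in>V. U v \<subseteq> V \<and> card (U v) \<le> k \<and> (\<forall>u\<in>U v. ord u < ord v) \<and>
      (\<forall>u\<in>U v. \<forall>w\<in>U v. ord u < ord w \<longrightarrow> u \<in> U w)) \<and>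
    (\<forall>x\<in>N. \<forall>u\<in>bag x. \<forall>v\<in>bag x. ord u < ord v \<longrightarrow> u \<in> U v)"

text \<open>Take a leaf \<open>l\<close> of the tree and its neighbour \<open>l'\<close>. If the bag
  of \<open>l\<close> is contained in that of \<open>l'\<close>, delete the leaf. Otherwise some
  \<open>v0\<close> occurs in the bag of \<open>l\<close> only; it is put last in the order, with
  the rest of that bag as its earlier neighbours.\<close>

lemma elimination_order_exists:
  fixes V :: "'a set" and N :: "'b set"
  assumes "finite N" "conn F N" "sym F" "irrefl F" "cycle_free F" "finite V" "(\<Union>x\<in>N. bag x) = V"
    "\<And>x. x \<in> N \<Longrightarrow> card (bag x) \<le> Suc k" "\<And>v. v \<in> V \<Longrightarrow> conn F {x \<in> N. v \<in> bag x}"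
  shows "\<exists>ord U. elimination_order V N bag k ord U"
  using assms
proof (induction "card N + card V" arbitrary: N V bag rule: less_induct)
  case less
  note fin = less.prems(1,6) and bags = less.prems(7) and width = less.prems(8)
  have "N \<noteq> {}"
    using less.prems(2) by (auto simp: conn_def)
  show ?case
  proof (cases "2 \<le> card N")
    case False
    then have "card N = 1"
      using \<open>N \<noteq> {}\<close> fin(1) by (metis One_nat_def Suc_1 card_eq_0_iff le_Suc_eq not_less_eq_eq le_0_eq linorder_le_cases)
    then obtain x where N: "N = {x}"
      by (rule card_1_singletonE)
    then have x: "bag x = V"
      using bags by simp
    obtain ord :: "'a \<Rightarrow> nat" where ord: "inj_on ord V"
      using finite_imp_inj_to_nat_seg[OF fin(2)] by blast
    \<comment> \<open>With a single bag every order works, since a vertex has at most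
      \<open>k\<close> others in the bag.\<close>
    have "card {u \<in> V. ord u < ord v} \<le> k" if "v \<in> V" for v
    proof -
      have "card {u \<in> V. ord u < ord v} \<le> card (V - {v})"
        using fin(2) by (intro card_mono) auto
      then show ?thesis
        using that width[of x] fin(2) by (simp add: N x)
    qed
    then show ?thesis
      using ord by (intro exI[of _ ord] exI[of _ "\<lambda>v. {u \<in> V. ord u < ord v}"])
        (auto simp: elimination_order_def N x)
  next
    case True
    obtain l l' where l: "l \<in> N" "l' \<in> N" "l \<noteq> l'" "\<And>y. y \<in> N \<Longrightarrow> (l, y) \<in> F \<Longrightarrow> y = l'"
      using leaf_exists[OF fin(1) less.prems(2-5) True] by metis
    show ?thesis
    proof (cases "bag l \<subseteq> bag l'")
      case True
      have "\<exists>ord U. elimination_order V (N - {l}) bag k ord U"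
      proof (rule less.hyps)
        show "card (N - {l}) + card V < card N + card V"
          using card_Diff1_less[OF fin(1) l(1)] by simp
        show "conn F (N - {l})"
          by (rule conn_remove_leaf[OF less.prems(2,3), of l l']) (use l in auto)
        show "(\<Union>x\<in>N - {l}. bag x) = V"
          using bags True l(2,3) by blast
        show "conn F {x \<in> N - {l}. v \<in> bag x}" if "v \<in> V" for v
        proof -
          have "{x \<in> N. v \<in> bag x} - {l} \<noteq> {}"
            using less.prems(9)[OF that] True l(2,3) unfolding conn_def by blast
          then have "conn F ({x \<in> N. v \<in> bag x} - {l})"
            by (rule conn_remove_leaf[OF less.prems(9)[OF that] less.prems(3), of l l']) (use l(4) in auto)
          moreover have "{x \<in> N. v \<in> bag x} - {l} = {x \<in> N - {l}. v \<in> bag x}"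
            by blast
          ultimately show ?thesis
            by simp
        qed
      qed (use less.prems in auto)
      then obtain ord U where "elimination_order V (N - {l}) bag k ord U"
        by blast
      moreover have "\<exists>x'\<in>N - {l}. bag x \<subseteq> bag x'" if "x \<in> N" for x
        using that True l(2,3) by (cases "x = l") auto
      ultimately have "elimination_order V N bag k ord U"
        unfolding elimination_order_def by (meson subsetD)
      then show ?thesis
        by blast
    next
      case False
      then obtain v0 where v0: "v0 \<in> bag l" "v0 \<notin> bag l'"
        by auto
      have v0V: "v0 \<in> V"
        using v0(1) l(1) bags by blast
      \<comment> \<open>The nodes whose bags contain \<open>v0\<close> are connected, and the only
        way out of \<open>l\<close> leads to \<open>l'\<close>, whose bag does not contain
        \<open>v0\<close>.\<close>
      have only: "x = l" if "x \<in> N" "v0 \<in> bag x" for x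
      proof (rule ccontr)
        assume "x \<noteq> l"
        then have "{x \<in> N. v0 \<in> bag x} \<inter> {l} \<noteq> {}" "\<not> {x \<in> N. v0 \<in> bag x} \<subseteq> {l}"
          using that l(1) v0(1) by auto
        then obtain z y where "(z, y) \<in> F" "z \<in> {x \<in> N. v0 \<in> bag x} \<inter> {l}" "y \<in> {x \<in> N. v0 \<in> bag x} - {l}"
          by (rule conn_crosses[OF less.prems(9)[OF v0V]])
        then show False
          using l(4) v0(2) by blast
      qed
      define V' where "V' = V - {v0}"
      define bag' where "bag' x = bag x - {v0}" for x
      have finbag: "finite (bag x)" if "x \<in> N" for x
      proof (rule finite_subset[OF _ fin(2)])
        show "bag x \<subseteq> V"
          using that bags by blast
      qed
      have "\<exists>ord U. elimination_order V' N bag' k ord U"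
      proof (rule less.hyps)
        show "card N + card V' < card N + card V"
          using card_Diff1_less[OF fin(2) v0V] by (simp add: V'_def)
        show "(\<Union>x\<in>N. bag' x) = V'"
          using bags by (auto simp: bag'_def V'_def)
        show "card (bag' x) \<le> Suc k" if "x \<in> N" for x
          using width[OF that] card_Diff1_le[of "bag x" v0] by (simp add: bag'_def)
        show "conn F {x \<in> N. v \<in> bag' x}" if "v \<in> V'" for v
          using less.prems(9)[of v] that by (simp add: bag'_def V'_def)
      qed (use less.prems in \<open>auto simp: V'_def\<close>)
      then obtain ord U where IH: "elimination_order V' N bag' k ord U"
        by blast
      \<comment> \<open>A position after all used ones; inserting \<open>0\<close> covers the case
        that no vertex is left.\<close>
      define b where "b = Suc (Max (insert 0 (ord ` V')))"
      have finV': "finite V'"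
        using fin(2) by (simp add: V'_def)
      have b: "ord u < b" if "u \<in> V'" for u
        using that finV' unfolding b_def by (simp add: less_Suc_eq_le)
      have sub: "bag' l \<subseteq> V'"
        using l(1) bags by (auto simp: bag'_def V'_def)
      have "card (bag' l) \<le> k"
        using width[OF l(1)] v0(1) finbag[OF l(1)] by (simp add: bag'_def)
      have "elimination_order V N bag k (ord(v0 := b)) (U(v0 := bag' l))"
        unfolding elimination_order_def
      proof (intro conjI ballI impI)
        show "inj_on (ord(v0 := b)) V"
        proof (rule inj_onI)
          fix u v assume uv: "u \<in> V" "v \<in> V" and eq: "(ord(v0 := b)) u = (ord(v0 := b)) v"
          show "u = v"
          proof (cases "u = v0 \<or> v = v0")
            case True
            then show ?thesis
              using eq uv b[of u] b[of v] by (auto simp: V'_def split: if_splits)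
          next
            case False
            then have "u \<in> V'" "v \<in> V'" "ord u = ord v"
              using uv eq by (auto simp: V'_def)
            then show ?thesis
              using IH unfolding elimination_order_def by (meson inj_onD)
          qed
        qed
      next
        fix v assume "v \<in> V"
        have v: "v \<in> V'" if "v \<noteq> v0"
          using that \<open>v \<in> V\<close> by (simp add: V'_def)
        have IHv: "U v \<subseteq> V'" "card (U v) \<le> k" "\<And>u. u \<in> U v \<Longrightarrow> ord u < ord v"
          "\<And>u w. u \<in> U v \<Longrightarrow> w \<in> U v \<Longrightarrow> ord u < ord w \<Longrightarrow> u \<in> U w" if "v \<noteq> v0"
          using IH v[OF that] unfolding elimination_order_def by blast+
        show "(U(v0 := bag' l)) v \<subseteq> V"
          using IHv(1) sub by (auto simp: V'_def)
        show "card ((U(v0 := bag' l)) v) \<le> k"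
          using IHv(2) \<open>card (bag' l) \<le> k\<close> by simp
        fix u assume u: "u \<in> (U(v0 := bag' l)) v"
        then have uV: "u \<in> V'"
          using IHv(1) sub by (auto split: if_splits)
        then show "(ord(v0 := b)) u < (ord(v0 := b)) v"
          using u IHv(3) b by (auto simp: V'_def split: if_splits)
        fix w assume w: "w \<in> (U(v0 := bag' l)) v" and less: "(ord(v0 := b)) u < (ord(v0 := b)) w"
        then have "w \<in> V'"
          using IHv(1) sub by (auto split: if_splits)
        with uV less have less': "ord u < ord w" and "w \<noteq> v0"
          by (auto simp: V'_def)
        have "u \<in> U w"
        proof (cases "v = v0")
          \<comment> \<open>For \<open>v0\<close> both vertices lie in the bag of \<open>l\<close>,
            so the clause on bags gives the clique condition.\<close>
          case True
          then show ?thesis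
            using IH u w less' l(1) unfolding elimination_order_def by simp
        next
          case False
          then show ?thesis
            using IHv(4) u w less' by simp
        qed
        with \<open>w \<noteq> v0\<close> show "u \<in> (U(v0 := bag' l)) w"
          by simp
      next
        fix x u v
        assume x: "x \<in> N" and u: "u \<in> bag x" and v: "v \<in> bag x" and less: "(ord(v0 := b)) u < (ord(v0 := b)) v"
        have "u \<in> V" "v \<in> V"
          using x u v bags by auto
        then have "u \<noteq> v0"
          using less b[of v] by (auto simp: V'_def split: if_splits)
        show "u \<in> (U(v0 := bag' l)) v"
        proof (cases "v = v0")
          case True
          then show ?thesis
            using only[OF x] v u \<open>u \<noteq> v0\<close> by (auto simp: bag'_def)
        next
          case False
          then show ?thesis
            using IH x u v less \<open>u \<noteq> v0\<close> unfolding elimination_order_def by (simp add: bag'_def)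
        qed
      qed
      then show ?thesis
        by blast
    qed
  qed
qed

text \<open>Ensures that the least element in the definition of \<open>treewidth\<close> is
  attained.\<close>

lemma trivial_tree_decomposition:
  assumes "pair_graph G"
  shows "tree_decomposition G \<lparr>pverts = {0 :: nat}, parcs = {}\<rparr> (\<lambda>_. pverts G)"
proof -
  let ?T = "\<lparr>pverts = {0 :: nat}, parcs = {}\<rparr>"
  have T: "pair_graph ?T"
    by (simp add: pair_graph_iff sym_def irrefl_def)
  interpret T: pair_graph ?T
    by (rule T)
  have "\<not> T.cycle p" for p
    by (auto simp: T.cycle_def T.awalk_def)
  moreover have "connected (with_proj ?T)"
    by (subst connected_with_proj_iff) (auto simp: sym_def)
  ultimately have "undirected_tree ?T"
    using T by (simp add: undirected_tree_def)
  moreover have "connected (with_proj ?T \<restriction> {x \<in> pverts ?T. v \<in> pverts G})" if "v \<in> pverts G" for v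
    using that by (subst connected_induce_iff) (auto simp: sym_def conn_def)
  ultimately show ?thesis
    using assms unfolding tree_decomposition_def pair_graph_iff by auto
qed

lemma treewidth_imp_elimination:
  assumes G: "pair_graph G" and tw: "treewidth G \<le> k"
  shows "\<exists>ord U. elimination (pverts G) (parcs G) ord U k"
proof -
  let ?dec = "\<lambda>k. \<exists>(T :: nat pair_pre_digraph) bag.
      tree_decomposition G T bag \<and> (\<forall>x\<in>pverts T. card (bag x) \<le> k + 1)"
  have "?dec (card (pverts G))"
    using trivial_tree_decomposition[OF G] by (intro exI conjI) auto
  then have "?dec (treewidth G)"
    unfolding treewidth_def by (rule LeastI)
  then obtain T :: "nat pair_pre_digraph" and bag where T: "tree_decomposition G T bag"
      and width: "\<And>x. x \<in> pverts T \<Longrightarrow> card (bag x) \<le> treewidth G + 1"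
    by blast
  have tree: "undirected_tree T" and bags: "(\<Union>x\<in>pverts T. bag x) = pverts G"
    and edges: "\<forall>(u, v)\<in>parcs G. \<exists>x\<in>pverts T. u \<in> bag x \<and> v \<in> bag x"
    and conn: "\<forall>v\<in>pverts G. connected (with_proj T \<restriction> {x \<in> pverts T. v \<in> bag x})"
    using T unfolding tree_decomposition_def by blast+
  have T': "finite (pverts T)" "parcs T \<subseteq> pverts T \<times> pverts T" "sym (parcs T)" "irrefl (parcs T)"
    "connected (with_proj T)"
    using tree by (auto simp: undirected_tree_def pair_graph_iff)
  have G': "finite (pverts G)" "parcs G \<subseteq> pverts G \<times> pverts G" "sym (parcs G)" "irrefl (parcs G)"
    using G by (auto simp: pair_graph_iff)
  obtain ord U where ord: "elimination_order (pverts G) (pverts T) bag k ord U"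
  proof -
    have "\<exists>ord U. elimination_order (pverts G) (pverts T) bag k ord U"
    proof (rule elimination_order_exists[OF T'(1) _ T'(3,4) undirected_tree_cycle_free[OF tree] G'(1) bags])
      show "conn (parcs T) (pverts T)"
        using connected_with_proj_iff[OF T'(3,2)] T'(5) by simp
      show "card (bag x) \<le> Suc k" if "x \<in> pverts T" for x
        using width[OF that] tw by simp
      show "conn (parcs T) {x \<in> pverts T. v \<in> bag x}" if "v \<in> pverts G" for v
        using conn that connected_induce_iff[OF T'(3)] by blast
    qed
    then show thesis
      using that by blast
  qed
  have "elimination (pverts G) (parcs G) ord U k"
  proof
    fix u v assume uv: "(u, v) \<in> parcs G"
    then have "ord u < ord v \<or> ord v < ord u"
      using G' ord unfolding elimination_order_def irrefl_def inj_on_def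
      by (metis SigmaD1 SigmaD2 linorder_neqE_nat subsetD)
    moreover obtain x where "x \<in> pverts T" "u \<in> bag x" "v \<in> bag x"
      using edges uv by blast
    ultimately show "u \<in> U v \<or> v \<in> U u"
      using ord unfolding elimination_order_def by blast
  qed (use G' ord in \<open>auto simp: elimination_order_def\<close>)
  then show ?thesis
    by blast
qed

section \<open>Minors obtained from models\<close>

lemma minorI:
  assumes "sym (parcs G)"
    and "\<And>x. x \<in> pverts H \<Longrightarrow> conn (parcs G) (B x) \<and> B x \<subseteq> pverts G"
    and "disjoint_family_on B (pverts H)"
    and "\<And>x y. (x, y) \<in> parcs H \<Longrightarrow> \<exists>u\<in>B x. \<exists>v\<in>B y. (u, v) \<in> parcs G"
  shows "minor H G"
  unfolding minor_def using assms
  by (intro exI[of _ B]) (auto simp: connected_induce_iff disjoint_family_on_def)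

lemma subgraph_imp_minor:
  assumes "sym (parcs G)" "subgraph (with_proj H) (with_proj G)"
  shows "minor H G"
  using assms by (intro minorI[of _ _ "\<lambda>x. {x}"]) (auto simp: subgraph_def disjoint_family_on_def)

lemma hubs_enumeration:
  assumes "hubs V E n \<Q> W"
  obtains q :: "nat \<Rightarrow> 'a set" where "\<And>i. i < n \<Longrightarrow> conn E (q i) \<and> q i \<subseteq> V \<and> q i \<in> \<Q>"
    "disjoint_family_on q {..<n}" "\<And>i w. i < n \<Longrightarrow> w \<in> W \<Longrightarrow> E `` {w} \<inter> q i \<noteq> {}"
proof -
  have Q: "disjoint \<Q>" "finite \<Q>" "card \<Q> = n"
      "\<And>Q. Q \<in> \<Q> \<Longrightarrow> conn E Q \<and> Q \<subseteq> V \<and> (\<forall>w\<in>W. E `` {w} \<inter> Q \<noteq> {})"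
    using assms by (auto simp: hubs_def)
  obtain q where q: "bij_betw q {..<n} \<Q>"
    using ex_bij_betw_nat_finite[OF Q(2)] Q(3) atLeast0LessThan by metis
  then have "q i \<in> \<Q>" if "i < n" for i
    using that bij_betw_apply by fastforce
  moreover have "disjoint_family_on q {..<n}"
    unfolding disjoint_family_on_def
  proof (intro ballI impI)
    fix i j assume "i \<in> {..<n}" "j \<in> {..<n}" "i \<noteq> j"
    then have "q i \<in> \<Q>" "q j \<in> \<Q>" "q i \<noteq> q j"
      using q by (auto simp: bij_betw_def inj_on_def)
    then show "q i \<inter> q j = {}"
      by (rule disjointD[OF Q(1)])
  qed
  ultimately show thesis
    using that[of q] Q(4) by blast
qed

lemma star_model_minor:
  assumes "sym (parcs G)" "star_model (pverts G) (parcs G) t m"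
  obtains H :: "nat pair_pre_digraph"
  where "pair_graph H" "complete_bipartite_digraph t m (with_proj H)" "minor H G"
proof -
  obtain \<Q> W where hubs: "hubs (pverts G) (parcs G) t \<Q> W" and W: "finite W" "card W = m"
      "W \<subseteq> pverts G" "W \<inter> \<Union>\<Q> = {}"
    using assms(2) unfolding star_model_def by blast
  obtain q where q: "\<And>i. i < t \<Longrightarrow> conn (parcs G) (q i) \<and> q i \<subseteq> pverts G \<and> q i \<in> \<Q>"
      "disjoint_family_on q {..<t}" "\<And>i w. i < t \<Longrightarrow> w \<in> W \<Longrightarrow> parcs G `` {w} \<inter> q i \<noteq> {}"
    using hubs_enumeration[OF hubs] by blast
  obtain w where w: "bij_betw w {..<m} W"
    using ex_bij_betw_nat_finite[OF W(1)] W(2) atLeast0LessThan by metis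
  have wW: "w i \<in> W" if "i < m" for i
    using w that bij_betw_apply by fastforce
  \<comment> \<open>The hubs receive the numbers below \<open>t\<close>, the vertices of
    \<open>W\<close> those from \<open>t\<close> on.\<close>
  define H where "H = \<lparr>pverts = {..<t + m}, parcs = {..<t} \<times> {t..<t + m} \<union> {t..<t + m} \<times> {..<t}\<rparr>"
  define B where "B i = (if i < t then q i else {w (i - t)})" for i
  have H: "complete_bipartite_digraph t m (with_proj H)"
    unfolding complete_bipartite_digraph_pair_def H_def
    by (rule conjI, simp, rule exI[of _ "{..<t}"], rule exI[of _ "{t..<t + m}"]) auto
  show thesis
  proof (rule that[OF pair_graphI_complete_bipartite[OF H] H], rule minorI[OF assms(1)])
    show "conn (parcs G) (B x) \<and> B x \<subseteq> pverts G" if "x \<in> pverts H" for x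
      using that q(1)[of x] wW[of "x - t"] W(3) by (auto simp: B_def H_def)
    have "q i \<inter> {w j} = {}" if "i < t" "j < m" for i j
      using q(1)[OF that(1)] wW[OF that(2)] W(4) by blast
    moreover have "w i \<noteq> w j" if "i < m" "j < m" "i \<noteq> j" for i j
      using w that by (auto simp: bij_betw_def inj_on_def)
    ultimately show "disjoint_family_on B (pverts H)"
      using q(2) unfolding disjoint_family_on_def B_def H_def by (auto simp: less_diff_conv2)
    show "\<exists>u\<in>B x. \<exists>v\<in>B y. (u, v) \<in> parcs G" if "(x, y) \<in> parcs H" for x y
    proof -
      have *: "\<exists>u\<in>B x. \<exists>v\<in>B y. (u, v) \<in> parcs G \<and> (v, u) \<in> parcs G"
        if "x < t" "t \<le> y" "y < t + m" for x y
      proof -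
        have "y - t < m"
          using that by simp
        then obtain u where "u \<in> q x" "(w (y - t), u) \<in> parcs G"
          using q(3)[OF \<open>x < t\<close> wW] by blast
        then show ?thesis
          using that symD[OF assms(1)] by (auto simp: B_def)
      qed
      have "x < t \<and> t \<le> y \<and> y < t + m \<or> y < t \<and> t \<le> x \<and> x < t + m"
        using \<open>(x, y) \<in> parcs H\<close> by (auto simp: H_def)
      then show ?thesis
        using *[of x y] *[of y x] by blast
    qed
  qed
qed

text \<open>The list is cut right after each vertex of \<open>W\<close>. The clause on
  \<open>hd xs\<close> strengthens the induction: it makes the piece that ends in \<open>w\<close>
  adjacent to the first of the remaining pieces.\<close>

lemma path_pieces:
  assumes "sym E"
  shows "distinct xs \<Longrightarrow> successively (\<lambda>x y. (x, y) \<in> E) xs \<Longrightarrow> W \<subseteq> set xs \<Longrightarrow> card W = m \<Longrightarrow>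
    \<exists>P :: nat \<Rightarrow> 'a set. (\<forall>j<m. conn E (P j) \<and> P j \<subseteq> set xs \<and> P j \<inter> W \<noteq> {}) \<and> disjoint_family_on P {..<m} \<and>
      (\<forall>j. Suc j < m \<longrightarrow> (\<exists>u\<in>P j. \<exists>v\<in>P (Suc j). (u, v) \<in> E)) \<and> (0 < m \<longrightarrow> hd xs \<in> P 0)"
proof (induction m arbitrary: xs W)
  case 0
  then show ?case
    by (auto simp: disjoint_family_on_def)
next
  case (Suc m)
  have "\<exists>x\<in>set xs. x \<in> W"
    using Suc.prems(3,4) by (metis card.empty nat.distinct(1) subset_empty subsetI subsetD)
  then obtain ys w zs where xs: "xs = ys @ w # zs" and w: "w \<in> W" "\<forall>y\<in>set ys. y \<notin> W"
    using split_list_first_prop[of xs "\<lambda>x. x \<in> W"] by blast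
  have "finite W"
    using Suc.prems(3) finite_subset by auto
  have sub: "W - {w} \<subseteq> set zs" "card (W - {w}) = m"
    using Suc.prems(3,4) w \<open>finite W\<close> by (auto simp: xs)
  have zs: "distinct zs" "successively (\<lambda>x y. (x, y) \<in> E) zs"
    using Suc.prems(1,2) by (auto simp: xs successively_append_iff successively_Cons)
  obtain P :: "nat \<Rightarrow> 'a set" where P: "\<And>j. j < m \<Longrightarrow> conn E (P j) \<and> P j \<subseteq> set zs \<and> P j \<inter> (W - {w}) \<noteq> {}"
      "disjoint_family_on P {..<m}" "\<And>j. Suc j < m \<Longrightarrow> \<exists>u\<in>P j. \<exists>v\<in>P (Suc j). (u, v) \<in> E"
      "0 < m \<Longrightarrow> hd zs \<in> P 0"
    using Suc.IH[OF zs sub] by blast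
  define P' where "P' j = (case j of 0 \<Rightarrow> set (ys @ [w]) | Suc i \<Rightarrow> P i)" for j
  have P'_simps: "P' 0 = set (ys @ [w])" "\<And>i. P' (Suc i) = P i"
    by (auto simp: P'_def)
  have "successively (\<lambda>x y. (x, y) \<in> E) ((ys @ [w]) @ zs)"
    using Suc.prems(2) by (simp add: xs)
  then have "successively (\<lambda>x y. (x, y) \<in> E) (ys @ [w])"
    using successively_append_iff by blast
  then have "conn E (P' 0)"
    unfolding P'_simps by (rule conn_set[OF assms]) simp
  then have "\<forall>j<Suc m. conn E (P' j) \<and> P' j \<subseteq> set xs \<and> P' j \<inter> W \<noteq> {}"
    using P(1) w(1) by (auto simp: xs P'_def split: nat.split)
  moreover have "disjoint_family_on P' {..<Suc m}"
    unfolding disjoint_family_on_def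
  proof (intro ballI impI)
    have *: "set (ys @ [w]) \<inter> P i = {}" if "i < m" for i
      using P(1)[OF that] Suc.prems(1) by (auto simp: xs)
    fix i j assume "i \<in> {..<Suc m}" "j \<in> {..<Suc m}" "i \<noteq> j"
    then show "P' i \<inter> P' j = {}"
      using P(2) * unfolding disjoint_family_on_def
      by (cases i; cases j) (auto simp: P'_simps simp del: set_append)
  qed
  moreover have "\<exists>u\<in>P' j. \<exists>v\<in>P' (Suc j). (u, v) \<in> E" if "Suc j < Suc m" for j
  proof (cases j)
    case 0
    then have "0 < m"
      using that by simp
    then have "zs \<noteq> []"
      using sub by (metis card.empty less_irrefl list.set(1) subset_empty)
    then have "(w, hd zs) \<in> E"
      using Suc.prems(2) by (auto simp: xs successively_append_iff successively_Cons)
    then show ?thesis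
      using P(4)[OF \<open>0 < m\<close>] by (auto simp: 0 P'_simps)
  next
    case (Suc i)
    then show ?thesis
      using P(3)[of i] that by (simp add: P'_simps)
  qed
  moreover have "hd xs \<in> P' 0"
    by (cases ys) (auto simp: P'_simps xs)
  ultimately show ?case
    by blast
qed

lemma indep_join_path_pair_graph:
  assumes "indep_join_path n m G"
  shows "pair_graph G"
proof -
  obtain U xs where *: "finite U" "distinct xs" "length xs = m" "U \<inter> set xs = {}"
      "pverts G = U \<union> set xs"
      "parcs G = U \<times> set xs \<union> set xs \<times> U \<union>
        {(xs ! i, xs ! Suc i) | i. Suc i < m} \<union> {(xs ! Suc i, xs ! i) | i. Suc i < m}"
    using assms unfolding indep_join_path_def by blast
  have "irrefl (parcs G)"
    using * by (auto simp: irrefl_def nth_eq_iff_index_eq)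
  moreover have "sym (parcs G)"
    unfolding *(6) by (intro symI) blast
  moreover have "parcs G \<subseteq> pverts G \<times> pverts G"
    unfolding *(5,6) using *(3) by auto
  ultimately show ?thesis
    using *(1,5) by (simp add: pair_graph_iff)
qed

lemma path_model_minor:
  assumes "sym (parcs G)" "path_model (pverts G) (parcs G) n m"
  obtains H :: "nat pair_pre_digraph" where "pair_graph H" "indep_join_path n m H" "minor H G"
proof -
  obtain \<Q> W xs where hubs: "hubs (pverts G) (parcs G) n \<Q> W" and W: "finite W" "card W = m"
      "W \<subseteq> set xs" and xs: "distinct xs" "successively (\<lambda>x y. (x, y) \<in> parcs G) xs"
      "set xs \<subseteq> pverts G" "set xs \<inter> \<Union>\<Q> = {}"
    using assms(2) unfolding path_model_def by blast
  obtain q where q: "\<And>i. i < n \<Longrightarrow> conn (parcs G) (q i) \<and> q i \<subseteq> pverts G \<and> q i \<in> \<Q>"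
      "disjoint_family_on q {..<n}" "\<And>i w. i < n \<Longrightarrow> w \<in> W \<Longrightarrow> parcs G `` {w} \<inter> q i \<noteq> {}"
    using hubs_enumeration[OF hubs] by blast
  obtain P :: "nat \<Rightarrow> 'a set" where P: "\<And>j. j < m \<Longrightarrow> conn (parcs G) (P j) \<and> P j \<subseteq> set xs \<and> P j \<inter> W \<noteq> {}"
      "disjoint_family_on P {..<m}" "\<And>j. Suc j < m \<Longrightarrow> \<exists>u\<in>P j. \<exists>v\<in>P (Suc j). (u, v) \<in> parcs G"
    using path_pieces[OF assms(1) xs(1,2) W(3,2)] by blast
  \<comment> \<open>The path receives the numbers from \<open>n\<close> on, and piece
    \<open>j\<close> becomes the branch set of \<open>n + j\<close>.\<close>
  define ps where "ps = [n..<n + m]"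
  define H where "H = \<lparr>pverts = {..<n} \<union> set ps, parcs = {..<n} \<times> set ps \<union> set ps \<times> {..<n} \<union>
        {(ps ! i, ps ! Suc i) | i. Suc i < m} \<union> {(ps ! Suc i, ps ! i) | i. Suc i < m}\<rparr>"
  define B where "B i = (if i < n then q i else P (i - n))" for i
  have H: "indep_join_path n m H"
    unfolding indep_join_path_def H_def
    by (rule exI[of _ "{..<n}"], rule exI[of _ ps]) (auto simp: ps_def)
  have nth: "ps ! i = n + i" if "i < m" for i
    using that by (simp add: ps_def)
  have hub: "\<exists>u\<in>B x. \<exists>v\<in>B y. (u, v) \<in> parcs G \<and> (v, u) \<in> parcs G"
    if x: "x < n" and y: "y \<in> set ps" for x y
  proof -
    obtain w where w: "w \<in> P (y - n) \<inter> W"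
      using P(1)[of "y - n"] y by (fastforce simp: ps_def)
    then obtain u where "u \<in> q x" "(w, u) \<in> parcs G"
      using q(3)[OF x, of w] by blast
    then show ?thesis
      using x y w symD[OF assms(1)] by (fastforce simp: B_def ps_def)
  qed
  have step: "\<exists>u\<in>B (ps ! i). \<exists>v\<in>B (ps ! Suc i). (u, v) \<in> parcs G \<and> (v, u) \<in> parcs G" if "Suc i < m" for i
    using P(3)[OF that] symD[OF assms(1)] that by (auto simp: B_def nth)
  show thesis
  proof (rule that[OF indep_join_path_pair_graph[OF H] H], rule minorI[OF assms(1)])
    show "conn (parcs G) (B x) \<and> B x \<subseteq> pverts G" if "x \<in> pverts H" for x
    proof (cases "x < n")
      case True
      then show ?thesis
        using q(1)[of x] by (simp add: B_def)
    next
      case False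
      then have "x - n < m"
        using that by (auto simp: H_def ps_def)
      then show ?thesis
        using False P(1)[of "x - n"] xs(3) by (auto simp: B_def)
    qed
    have "q i \<inter> P j = {}" if "i < n" "j < m" for i j
      using q(1)[OF that(1)] P(1)[OF that(2)] xs(4) by blast
    then have *: "q i \<inter> P j = {}" "P j \<inter> q i = {}" if "i < n" "j < m" for i j
      using that by blast+
    have **: "P i \<inter> P j = {}" if "i < m" "j < m" "i \<noteq> j" for i j
      using P(2) that by (auto simp: disjoint_family_on_def)
    show "disjoint_family_on B (pverts H)"
      unfolding disjoint_family_on_def
    proof (intro ballI impI)
      fix i j assume "i \<in> pverts H" "j \<in> pverts H" "i \<noteq> j"
      then have "i < n + m" "j < n + m" "i \<noteq> j"
        by (auto simp: H_def ps_def)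
      then show "B i \<inter> B j = {}"
        using *[of i "j - n"] *[of j "i - n"] **[of "i - n" "j - n"] q(2)
        by (auto simp: B_def disjoint_family_on_def)
    qed
    show "\<exists>u\<in>B x. \<exists>v\<in>B y. (u, v) \<in> parcs G" if arc: "(x, y) \<in> parcs H" for x y
    proof -
      consider "x < n" "y \<in> set ps" | "y < n" "x \<in> set ps"
        | i where "x = ps ! i" "y = ps ! Suc i" "Suc i < m" | i where "x = ps ! Suc i" "y = ps ! i" "Suc i < m"
        using arc by (auto simp: H_def)
      then show ?thesis
        by cases (use hub[of x y] hub[of y x] step in blast)+
    qed
  qed
qed

lemma excludes_both_imp_no_model:
  assumes "minor_closed_class \<G>" "excludes_both \<G> t m" "G \<in> \<G>"
  shows "\<not> star_model (pverts G) (parcs G) t m" "\<not> path_model (pverts G) (parcs G) (t - 1) m"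
proof -
  have *: "H \<in> \<G>" if "pair_graph H" "minor H G" for H
    using assms(1,3) that unfolding minor_closed_class_def by blast
  have "pair_graph G"
    using assms(1,3) unfolding minor_closed_class_def by blast
  then have sym: "sym (parcs G)"
    by (simp add: pair_graph_iff)
  show "\<not> star_model (pverts G) (parcs G) t m"
  proof
    assume "star_model (pverts G) (parcs G) t m"
    then obtain H :: "nat pair_pre_digraph" where "pair_graph H" "minor H G" "complete_bipartite_digraph t m (with_proj H)"
      using star_model_minor[OF sym] by blast
    then show False
      using *[of H] assms(2) unfolding excludes_both_def by blast
  qed
  show "\<not> path_model (pverts G) (parcs G) (t - 1) m"
  proof
    assume "path_model (pverts G) (parcs G) (t - 1) m"
    then obtain H :: "nat pair_pre_digraph" where "pair_graph H" "minor H G" "indep_join_path (t - 1) m H"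
      using path_model_minor[OF sym] by blast
    then show False
      using *[of H] assms(2) unfolding excludes_both_def by blast
  qed
qed

section \<open>The three parameters\<close>

lemma t_island_iff:
  assumes "pair_graph G"
  shows "t_island G t S \<longleftrightarrow> S \<subseteq> pverts G \<and> island (parcs G) t S"
proof -
  have "{u \<in> pverts G - S. (v, u) \<in> parcs G} = parcs G `` {v} - S" for v
    using assms by (auto simp: pair_graph_iff)
  then show ?thesis
    by (auto simp: t_island_def island_def)
qed

text \<open>This and the next two definitions isolate the properties of \<open>t\<close> behind the
  three infima, so that the parameters agree once the properties agree for all positive
  \<open>t\<close>.\<close>

definition pcol_bound :: "graph_class \<Rightarrow> nat \<Rightarrow> bool" where
  "pcol_bound \<G> t \<longleftrightarrow> (\<exists>\<epsilon>>0::real. \<forall>G\<in>\<G>. \<exists>\<S>. (\<forall>S\<in>\<S>. t_island G t S) \<and> disjoint \<S> \<and>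
        real (card \<S>) \<ge> \<epsilon> * real (card (pverts G)))"

definition percolation_bound :: "graph_class \<Rightarrow> nat \<Rightarrow> bool" where
  "percolation_bound \<G> t \<longleftrightarrow> (\<exists>\<epsilon>>0. \<forall>G\<in>\<G>. pverts G \<noteq> {} \<longrightarrow> resistant \<epsilon> t G)"

definition col_bound :: "graph_class \<Rightarrow> nat \<Rightarrow> bool" where
  "col_bound \<G> t \<longleftrightarrow> (\<exists>C\<ge>1. \<forall>G\<in>\<G>. col C G \<le> enat t)"

text \<open>The first vertex of the island to become active would need \<open>t\<close> active
  neighbours, and until then all active vertices lie outside the island.\<close>

lemma activates_avoids_island:
  assumes "activates G t A0 A" "pair_graph G" "t_island G t S" "S \<inter> A0 = {}"
  shows "S \<inter> A = {}"
  using assms(1)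
proof induction
  case (step A v)
  have "v \<notin> S"
  proof
    assume "v \<in> S"
    have "parcs G \<subseteq> pverts G \<times> pverts G"
      using assms(2) by (simp add: pair_graph_iff)
    then have "{u \<in> A. (v, u) \<in> parcs G} \<subseteq> {u \<in> pverts G - S. (v, u) \<in> parcs G}"
      using step.IH by blast
    moreover have "finite {u \<in> pverts G - S. (v, u) \<in> parcs G}"
      using assms(2) by (simp add: pair_graph_iff)
    ultimately have "card {u \<in> A. (v, u) \<in> parcs G} \<le> card {u \<in> pverts G - S. (v, u) \<in> parcs G}"
      by (rule card_mono[rotated])
    then show False
      using step.hyps(3) assms(3) \<open>v \<in> S\<close> unfolding t_island_def by (meson leD le_trans)
  qed
  with step.IH show ?case
    by simp
qed (rule assms(4))

lemma pcol_imp_percolation_bound: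
  assumes "\<forall>G\<in>\<G>. pair_graph G" "pcol_bound \<G> t"
  shows "percolation_bound \<G> t"
proof -
  obtain \<epsilon> where eps: "0 < \<epsilon>" "\<And>G. G \<in> \<G> \<Longrightarrow> \<exists>\<S>. (\<forall>S\<in>\<S>. t_island G t S) \<and> disjoint \<S> \<and>
        real (card \<S>) \<ge> \<epsilon> * real (card (pverts G))"
    using assms(2) unfolding pcol_bound_def by blast
  \<comment> \<open>A percolating set meets each of the disjoint islands and is thus at least as
    large as their number; halving \<open>\<epsilon>\<close> makes the contradiction strict.\<close>
  have "resistant (\<epsilon> / 2) t G" if G: "G \<in> \<G>" "pverts G \<noteq> {}" for G
    unfolding resistant_def
  proof
    assume "\<exists>A0\<subseteq>pverts G. real (card A0) \<le> \<epsilon> / 2 * real (card (pverts G)) \<and> percolates G t A0"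
    then obtain A0 where A0: "A0 \<subseteq> pverts G" "real (card A0) \<le> \<epsilon> / 2 * real (card (pverts G))"
        "activates G t A0 (pverts G)"
      unfolding percolates_def by blast
    obtain \<S> where S: "\<forall>S\<in>\<S>. t_island G t S" "disjoint \<S>" "real (card \<S>) \<ge> \<epsilon> * real (card (pverts G))"
      using eps(2)[OF G(1)] by blast
    have pg: "pair_graph G"
      using assms(1) G(1) by blast
    then have fin: "finite (pverts G)"
      by (simp add: pair_graph_iff)
    have "S \<inter> A0 \<noteq> {}" if "S \<in> \<S>" for S
    proof
      assume "S \<inter> A0 = {}"
      then have "S \<inter> pverts G = {}"
        using activates_avoids_island[OF A0(3) pg] S(1) that by blast
      moreover have "S \<noteq> {}" "S \<subseteq> pverts G"
        using S(1) that unfolding t_island_def by blast+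
      ultimately show False
        by blast
    qed
    then have "card \<S> \<le> card A0"
      using S(2) finite_subset[OF A0(1) fin] by (intro card_disjoint_le)
    then have "\<epsilon> * real (card (pverts G)) \<le> \<epsilon> / 2 * real (card (pverts G))"
      using S(3) A0(2) by linarith
    moreover have "0 < \<epsilon> * real (card (pverts G))"
      using eps(1) G(2) fin by (simp add: card_gt_0_iff)
    ultimately show False
      by simp
  qed
  then show ?thesis
    unfolding percolation_bound_def using eps(1) half_gt_zero by blast
qed

text \<open>Averaging: if all members were larger than \<open>1 / \<epsilon>\<close>, their union
  would have more elements than \<open>V\<close>.\<close>

lemma small_member:
  assumes "disjoint \<S>" "\<And>S. S \<in> \<S> \<Longrightarrow> S \<subseteq> V" "finite V" "0 < \<epsilon>"
    "\<epsilon> * real (card V) \<le> real (card \<S>)" "V \<noteq> {}"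
  obtains S where "S \<in> \<S>" "real (card S) \<le> 1 / \<epsilon>"
proof -
  have fin: "finite \<S>"
    using assms(2,3) by (intro finite_subset[of \<S> "Pow V"]) auto
  have "\<exists>S\<in>\<S>. real (card S) \<le> 1 / \<epsilon>"
  proof (rule ccontr)
    assume "\<not> ?thesis"
    then have large: "\<And>S. S \<in> \<S> \<Longrightarrow> 1 / \<epsilon> < real (card S)"
      by auto
    have pos: "0 < \<epsilon> * real (card V)"
      using assms(3,4,6) by (simp add: card_gt_0_iff)
    then have "\<S> \<noteq> {}"
      using assms(5) by auto
    have "real (card \<S>) * (1 / \<epsilon>) = (\<Sum>S\<in>\<S>. 1 / \<epsilon>)"
      by simp
    also have "\<dots> < (\<Sum>S\<in>\<S>. real (card S))"
      using large fin \<open>\<S> \<noteq> {}\<close> by (intro sum_strict_mono) auto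
    also have "\<dots> = real (card (\<Union>\<S>))"
      using assms(1) finite_subset[OF assms(2) assms(3)] by (subst card_Union_disjoint) auto
    also have "\<dots> \<le> real (card V)"
      using assms(2,3) by (simp add: Sup_le_iff card_mono)
    finally show False
      using assms(4,5) by (simp add: field_simps)
  qed
  then show thesis
    using that by blast
qed

text \<open>Subgraphs are minors and so belong to the class; each has linearly many disjoint
  islands, one of which is small.\<close>

lemma pcol_imp_col_bound:
  assumes "minor_closed_class \<G>" "pcol_bound \<G> t" "1 \<le> t"
  shows "col_bound \<G> t"
proof -
  obtain \<epsilon> where eps: "0 < \<epsilon>" "\<And>G. G \<in> \<G> \<Longrightarrow> \<exists>\<S>. (\<forall>S\<in>\<S>. t_island G t S) \<and> disjoint \<S> \<and>
        real (card \<S>) \<ge> \<epsilon> * real (card (pverts G))"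
    using assms(2) unfolding pcol_bound_def by blast
  \<comment> \<open>\<open>1 / \<epsilon>\<close> is rounded up, and \<open>Suc\<close> ensures
    \<open>C \<ge> 1\<close>.\<close>
  define C where "C = Suc (nat \<lceil>1 / \<epsilon>\<rceil>)"
  have "col C G \<le> enat t" if "G \<in> \<G>" for G
    unfolding col_def
  proof (rule Inf_lower, rule CollectI, rule exI[of _ t], intro conjI allI impI)
    fix H assume H: "pair_graph H \<and> subgraph (with_proj H) (with_proj G) \<and> pverts H \<noteq> {}"
    have "pair_graph G"
      using assms(1) that unfolding minor_closed_class_def by blast
    then have "minor H G"
      using H by (intro subgraph_imp_minor) (auto simp: pair_graph_iff)
    then have "H \<in> \<G>"
      using assms(1) that H unfolding minor_closed_class_def by blast
    then obtain \<S> where S: "\<forall>S\<in>\<S>. t_island H t S" "disjoint \<S>" "real (card \<S>) \<ge> \<epsilon> * real (card (pverts H))"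
      using eps(2) by blast
    obtain S where "S \<in> \<S>" "real (card S) \<le> 1 / \<epsilon>"
      using small_member[OF S(2) _ _ eps(1) S(3)] H S(1) by (auto simp: t_island_def pair_graph_iff)
    then have "real (card S) \<le> real (nat \<lceil>1 / \<epsilon>\<rceil>)"
      using real_nat_ceiling_ge[of "1 / \<epsilon>"] by linarith
    then have "t_island H t S \<and> card S \<le> C"
      using S(1) \<open>S \<in> \<S>\<close> by (simp add: C_def)
    then show "\<exists>S. t_island H t S \<and> card S \<le> C"
      by blast
  qed (use assms(3) in auto)
  then show ?thesis
    unfolding col_bound_def C_def by (intro exI[of _ "Suc (nat \<lceil>1 / \<epsilon>\<rceil>)"]) auto
qed

lemma excludes_imp_pcol_bound:
  assumes "minor_closed_class \<G>" "bounded_treewidth \<G>" "1 \<le> t" "excludes_both \<G> t m"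
  shows "pcol_bound \<G> t"
proof -
  obtain k where k: "\<And>G. G \<in> \<G> \<Longrightarrow> treewidth G \<le> k"
    using assms(2) unfolding bounded_treewidth_def by blast
  \<comment> \<open>The constant depends on \<open>k\<close> and \<open>m\<close> only, not on the
    graph; \<open>Suc\<close> makes it positive.\<close>
  define c where "c = Suc (2 * obstruction_free.island_cost k m)"
  have "\<exists>\<S>. (\<forall>S\<in>\<S>. t_island G t S) \<and> disjoint \<S> \<and> real (card \<S>) \<ge> 1 / real c * real (card (pverts G))"
    if G: "G \<in> \<G>" for G
  proof -
    have pg: "pair_graph G"
      using assms(1) G unfolding minor_closed_class_def by blast
    then obtain ord U where "elimination (pverts G) (parcs G) ord U k"
      using treewidth_imp_elimination k[OF G] by blast
    then interpret elimination "pverts G" "parcs G" ord U k .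
    interpret obstruction_free "pverts G" "parcs G" ord U k t m
      using excludes_both_imp_no_model[OF assms(1,4) G] assms(3) by unfold_locales
    obtain a where a: "pack (parcs G) t (pverts G) a" "card (pverts G) \<le> c * a"
      using many_islands by (auto simp: c_def intro: le_trans)
    then obtain \<S> where S: "disjoint \<S>" "card \<S> = a" "\<forall>S\<in>\<S>. island (parcs G) t S \<and> S \<subseteq> pverts G"
      unfolding pack_def by blast
    have "real (card (pverts G)) \<le> real c * real a"
      using a(2) by (metis of_nat_le_iff of_nat_mult)
    then have "1 / real c * real (card (pverts G)) \<le> real a"
      by (simp add: c_def field_simps)
    moreover have "\<forall>S\<in>\<S>. t_island G t S"
      using S(3) t_island_iff[OF pg] by simp
    ultimately show ?thesis
      using S(1,2) by auto
  qed
  moreover have "0 < 1 / real c"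
    by (simp add: c_def)
  ultimately show ?thesis
    unfolding pcol_bound_def by blast
qed

section \<open>The two obstructions and the lower bounds\<close>

lemma indep_join_path_cases:
  assumes "indep_join_path n m G"
  obtains U xs where "finite U" "card U = n" "distinct xs" "length xs = m" "U \<inter> set xs = {}"
    "pverts G = U \<union> set xs" "\<forall>u\<in>U. \<forall>x\<in>set xs. (u, x) \<in> parcs G \<and> (x, u) \<in> parcs G"
    "\<forall>i. Suc i < m \<longrightarrow> (xs ! i, xs ! Suc i) \<in> parcs G \<and> (xs ! Suc i, xs ! i) \<in> parcs G"
proof -
  obtain U xs where *: "finite U" "card U = n" "distinct xs" "length xs = m" "U \<inter> set xs = {}"
      "pverts G = U \<union> set xs"
      "parcs G = U \<times> set xs \<union> set xs \<times> U \<union>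
        {(xs ! i, xs ! Suc i) | i. Suc i < m} \<union> {(xs ! Suc i, xs ! i) | i. Suc i < m}"
    using assms unfolding indep_join_path_def by (elim exE conjE)
  show thesis
    by (rule that[OF *(1-6)]) (auto simp: *(7))
qed

lemma complete_bipartite_cases:
  assumes "complete_bipartite_digraph t m (with_proj G)"
  obtains U W where "finite U" "finite W" "card U = t" "card W = m" "U \<inter> W = {}" "pverts G = U \<union> W"
    "\<forall>u\<in>U. \<forall>w\<in>W. (u, w) \<in> parcs G \<and> (w, u) \<in> parcs G"
proof -
  obtain U W where "finite (pverts G)" "pverts G = U \<union> W" "U \<inter> W = {}" "card U = t" "card W = m"
      "parcs G = U \<times> W \<union> W \<times> U"
    using assms unfolding complete_bipartite_digraph_pair_def by blast
  then show thesis
    using that[of U W] by auto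
qed

text \<open>Activation runs along the path: the next vertex sees all of \<open>U\<close> and its
  predecessor.\<close>

lemma activates_indep_join_path:
  assumes U: "finite U" "card U = t" "U \<inter> set xs = {}" "distinct xs" "pverts G = U \<union> set xs"
    and adj: "\<And>u x. u \<in> U \<Longrightarrow> x \<in> set xs \<Longrightarrow> (x, u) \<in> parcs G"
      "\<And>i. Suc i < length xs \<Longrightarrow> (xs ! Suc i, xs ! i) \<in> parcs G"
  shows "j < length xs \<Longrightarrow> activates G (Suc t) (insert (xs ! 0) U) (U \<union> set (take (Suc j) xs))"
proof (induction j)
  case 0
  then have "U \<union> set (take (Suc 0) xs) = insert (xs ! 0) U"
    by (cases xs) auto
  then show ?case
    using activates.start by metis
next
  case (Suc j)
  let ?A = "U \<union> set (take (Suc j) xs)" and ?v = "xs ! Suc j"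
  have "?v \<notin> set (take (Suc j) xs)"
    using Suc.prems U(4) by (auto simp: in_set_conv_nth nth_eq_iff_index_eq)
  then have v: "?v \<in> pverts G - ?A"
    using Suc.prems U(3,5) nth_mem[OF Suc.prems] by auto
  have j: "xs ! j \<in> set (take (Suc j) xs)" "xs ! j \<in> set xs"
    using Suc.prems by (auto simp: take_Suc_conv_app_nth)
  have "insert (xs ! j) U \<subseteq> {u \<in> ?A. (?v, u) \<in> parcs G}"
    using j adj Suc.prems nth_mem[OF Suc.prems] by auto
  then have "card (insert (xs ! j) U) \<le> card {u \<in> ?A. (?v, u) \<in> parcs G}"
    using U(1) by (intro card_mono) auto
  moreover have "xs ! j \<notin> U"
    using j(2) U(3) by blast
  ultimately have "Suc t \<le> card {u \<in> ?A. (?v, u) \<in> parcs G}"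
    using U(1,2) by simp
  then have "activates G (Suc t) (insert (xs ! 0) U) (insert ?v ?A)"
    using activates.step[OF Suc.IH v] Suc.prems by simp
  moreover have "insert ?v ?A = U \<union> set (take (Suc (Suc j)) xs)"
    using Suc.prems by (simp add: take_Suc_conv_app_nth insert_commute)
  ultimately show ?case
    by simp
qed

lemma activates_complete_bipartite:
  assumes "finite U" "finite X" "X \<subseteq> W" "U \<inter> W = {}" "pverts G = U \<union> W"
    "\<And>u w. u \<in> U \<Longrightarrow> w \<in> W \<Longrightarrow> (w, u) \<in> parcs G"
  shows "activates G (card U) U (U \<union> X)"
  using assms(2,3)
proof (induction X rule: finite_induct)
  case empty
  then show ?case
    using activates.start by (metis sup_bot_right)
next
  case (insert w X)
  have "card U \<le> card {u \<in> U \<union> X. (w, u) \<in> parcs G}"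
    using assms(1,6) insert by (intro card_mono) auto
  then have "activates G (card U) U (insert w (U \<union> X))"
    using insert assms(4,5) by (intro activates.step) auto
  then show ?case
    by simp
qed

text \<open>In both graphs some set of at most \<open>t\<close> vertices percolates, and for large
  \<open>m\<close> this is at most an \<open>\<epsilon>\<close> fraction of all vertices.\<close>

lemma percolation_bound_imp_excludes:
  assumes "percolation_bound \<G> t" "1 \<le> t"
  shows "\<exists>m. excludes_both \<G> t m"
proof -
  obtain \<epsilon> where eps: "0 < \<epsilon>" "\<And>G. G \<in> \<G> \<Longrightarrow> pverts G \<noteq> {} \<Longrightarrow> resistant \<epsilon> t G"
    using assms(1) unfolding percolation_bound_def by blast
  obtain m0 :: nat where m0: "real t / \<epsilon> \<le> real m0"
    using real_arch_simple by blast
  \<comment> \<open>\<open>Suc\<close> guarantees that the path has a first vertex and the graph is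
    non-empty.\<close>
  define m where "m = Suc m0"
  have small: "real a \<le> \<epsilon> * real b" if "a \<le> t" "m \<le> b" for a b
  proof -
    have "real a \<le> real t"
      using that by simp
    also have "\<dots> \<le> \<epsilon> * real m0"
      using m0 eps(1) by (simp add: field_simps)
    also have "\<dots> \<le> \<epsilon> * real b"
      using that(2) eps(1) by (simp add: m_def)
    finally show ?thesis .
  qed
  have no_perc: False if "G \<in> \<G>" "A0 \<subseteq> pverts G" "card A0 \<le> t" "m \<le> card (pverts G)" "percolates G t A0" for G A0
  proof -
    have "pverts G \<noteq> {}"
      using that(4) by (auto simp: m_def)
    then show False
      using eps(2)[OF that(1)] small[OF that(3,4)] that(2,5) unfolding resistant_def by blast
  qed
  have "\<not> complete_bipartite_digraph t m (with_proj G)" if "G \<in> \<G>" for G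
  proof
    assume "complete_bipartite_digraph t m (with_proj G)"
    then obtain U W where *: "finite U" "finite W" "card U = t" "card W = m" "U \<inter> W = {}" "pverts G = U \<union> W"
      "\<forall>u\<in>U. \<forall>w\<in>W. (u, w) \<in> parcs G \<and> (w, u) \<in> parcs G"
      by (rule complete_bipartite_cases)
    have "percolates G t U"
      using activates_complete_bipartite[of U W W G] * by (auto simp: percolates_def)
    then show False
      using no_perc[OF that, of U] * by (auto simp: card_Un_disjoint)
  qed
  moreover have "\<not> indep_join_path (t - 1) m G" if "G \<in> \<G>" for G
  proof
    assume "indep_join_path (t - 1) m G"
    then obtain U xs where *: "finite U" "card U = t - 1" "distinct xs" "length xs = m" "U \<inter> set xs = {}"
      "pverts G = U \<union> set xs" "\<forall>u\<in>U. \<forall>x\<in>set xs. (u, x) \<in> parcs G \<and> (x, u) \<in> parcs G"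
      "\<forall>i. Suc i < m \<longrightarrow> (xs ! i, xs ! Suc i) \<in> parcs G \<and> (xs ! Suc i, xs ! i) \<in> parcs G"
      by (rule indep_join_path_cases)
    have "activates G (Suc (t - 1)) (insert (xs ! 0) U) (U \<union> set (take (Suc m0) xs))"
      using * by (intro activates_indep_join_path) (auto simp: m_def)
    then have "percolates G t (insert (xs ! 0) U)"
      using *(4,6) assms(2) by (simp add: percolates_def m_def)
    moreover have "insert (xs ! 0) U \<subseteq> pverts G"
      using *(4,6) by (auto simp: m_def)
    moreover have "card (insert (xs ! 0) U) \<le> t"
      using *(1,2) assms(2) by (simp add: card_insert_if)
    moreover have "m \<le> card (pverts G)"
      using * by (simp add: card_Un_disjoint distinct_card)
    ultimately show False
      using no_perc[OF that] by blast
  qed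
  ultimately show ?thesis
    unfolding excludes_both_def by blast
qed

lemma not_t_island:
  assumes "pair_graph G" "v \<in> S" "X \<subseteq> pverts G - S" "\<And>u. u \<in> X \<Longrightarrow> (v, u) \<in> parcs G" "t \<le> card X"
  shows "\<not> t_island G t S"
proof
  assume "t_island G t S"
  then have "card {u \<in> pverts G - S. (v, u) \<in> parcs G} < t"
    using assms(2) by (simp add: t_island_def)
  moreover have "card X \<le> card {u \<in> pverts G - S. (v, u) \<in> parcs G}"
    using assms(1,3,4) by (intro card_mono) (auto simp: pair_graph_iff)
  ultimately show False
    using assms(5) by simp
qed

text \<open>A vertex of \<open>U\<close> in a small island would see \<open>t\<close> vertices
  outside it, so the island avoids \<open>U\<close>. Then some vertex of the island sees all
  \<open>t\<close> elements of \<open>U\<close>, or in the second graph the \<open>t - 1\<close>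
  elements of \<open>U\<close> and a path neighbour outside the island.\<close>

lemma col_bound_imp_excludes:
  assumes "\<forall>G\<in>\<G>. pair_graph G" "col_bound \<G> t" "1 \<le> t"
  shows "\<exists>m. excludes_both \<G> t m"
proof -
  obtain C where C: "\<And>G. G \<in> \<G> \<Longrightarrow> col C G \<le> enat t"
    using assms(2) unfolding col_bound_def by blast
  have island: "\<exists>S. t_island G t S \<and> card S \<le> C" if G: "G \<in> \<G>" "pverts G \<noteq> {}" for G
  proof -
    interpret pair_graph G
      using assms(1) G(1) by blast
    \<comment> \<open>A strict bound on the infimum yields an actual value
      \<open>t' \<le> t\<close>, and every \<open>t'\<close>-island is also a
      \<open>t\<close>-island.\<close>
    have "col C G < enat (Suc t)"
      using C[OF G(1)] by (metis enat_ord_simps(2) le_less_trans lessI)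
    then obtain t' where t': "t' < Suc t"
        "\<forall>H. pair_graph H \<and> subgraph (with_proj H) (with_proj G) \<and> pverts H \<noteq> {} \<longrightarrow> (\<exists>S. t_island H t' S \<and> card S \<le> C)"
      unfolding col_def Inf_less_iff by auto
    then obtain S where "t_island G t' S" "card S \<le> C"
      using pair_graph subgraph_refl G(2) by blast
    then show ?thesis
      using t'(1) unfolding t_island_def by (meson less_Suc_eq_le less_le_trans)
  qed
  define m where "m = C + t + 1"
  have many: "t \<le> card (X - S)" if "card X = m" "card S \<le> C" "finite S" for X S :: "nat set"
    using diff_card_le_card_Diff[OF that(3), of X] that by (simp add: m_def)
  have "\<not> complete_bipartite_digraph t m (with_proj G)" if G: "G \<in> \<G>" for G
  proof
    assume "complete_bipartite_digraph t m (with_proj G)"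
    then obtain U W where *: "finite U" "finite W" "card U = t" "card W = m" "U \<inter> W = {}" "pverts G = U \<union> W"
      "\<forall>u\<in>U. \<forall>w\<in>W. (u, w) \<in> parcs G \<and> (w, u) \<in> parcs G"
      by (rule complete_bipartite_cases)
    have pg: "pair_graph G"
      using assms(1) G by blast
    have "pverts G \<noteq> {}"
      using *(4,6) by (auto simp: m_def)
    then obtain S where S: "t_island G t S" "card S \<le> C"
      using island[OF G] by blast
    then have sub: "S \<subseteq> U \<union> W" "S \<noteq> {}" and "finite S"
      using *(1,2,6) finite_subset by (auto simp: t_island_def)
    have "v \<notin> S" if "v \<in> U" for v
      using not_t_island[OF pg, of v S "W - S" t] many[OF *(4) S(2) \<open>finite S\<close>] that * S(1) by blast
    then obtain w where "w \<in> S" "w \<in> W" "U \<inter> S = {}"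
      using sub by blast
    then show False
      using not_t_island[OF pg, of w S U t] * S(1) by blast
  qed
  moreover have "\<not> indep_join_path (t - 1) m G" if G: "G \<in> \<G>" for G
  proof
    assume "indep_join_path (t - 1) m G"
    then obtain U xs where *: "finite U" "card U = t - 1" "distinct xs" "length xs = m" "U \<inter> set xs = {}"
      "pverts G = U \<union> set xs" "\<forall>u\<in>U. \<forall>x\<in>set xs. (u, x) \<in> parcs G \<and> (x, u) \<in> parcs G"
      "\<forall>i. Suc i < m \<longrightarrow> (xs ! i, xs ! Suc i) \<in> parcs G \<and> (xs ! Suc i, xs ! i) \<in> parcs G"
      by (rule indep_join_path_cases)
    have pg: "pair_graph G"
      using assms(1) G by blast
    have card_xs: "card (set xs) = m"
      using *(3,4) by (simp add: distinct_card)
    have "pverts G \<noteq> {}"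
      using *(4,6) by (auto simp: m_def)
    then obtain S where S: "t_island G t S" "card S \<le> C"
      using island[OF G] by blast
    then have sub: "S \<subseteq> U \<union> set xs" "S \<noteq> {}" and "finite S"
      using *(1,6) finite_subset by (auto simp: t_island_def)
    have "v \<notin> S" if "v \<in> U" for v
      using not_t_island[OF pg, of v S "set xs - S" t] many[OF card_xs S(2) \<open>finite S\<close>] that * S(1) by blast
    then have US: "U \<inter> S = {}"
      by blast
    have "xs \<noteq> []"
      using *(4) by (auto simp: m_def)
    moreover have "successively (\<lambda>x y. (x, y) \<in> parcs G) xs"
      using *(4,8) by (simp add: successively_conv_nth)
    ultimately have "conn (parcs G) (set xs)"
      using pg by (intro conn_set) (auto simp: pair_graph_iff)
    moreover have "set xs \<inter> S \<noteq> {}"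
      using sub US by blast
    moreover have "\<not> set xs \<subseteq> S"
      using card_xs S(2) card_mono[OF \<open>finite S\<close>, of "set xs"] by (auto simp: m_def)
    ultimately obtain v u where vu: "(v, u) \<in> parcs G" "v \<in> set xs \<inter> S" "u \<in> set xs - S"
      by (rule conn_crosses)
    have "t \<le> card (insert u U)"
      using vu(3) * by (auto simp: card_insert_if)
    then show False
      using not_t_island[OF pg, of v S "insert u U" t] vu US * S(1) by blast
  qed
  ultimately show ?thesis
    unfolding excludes_both_def by blast
qed

text \<open>All neighbours of the last vertex in the order are among the at most \<open>k\<close>
  elements of its set \<open>U v\<close>.\<close>

lemma (in elimination) small_degree_vertex:
  assumes "V \<noteq> {}"
  shows "\<exists>v\<in>V. card (E `` {v}) \<le> k"
proof -
  have "Max (ord ` V) \<in> ord ` V"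
    using finite_V assms by (intro Max_in) auto
  then obtain v where v: "Max (ord ` V) = ord v" "v \<in> V"
    by (rule imageE)
  have "E `` {v} \<subseteq> U v"
  proof
    fix u assume "u \<in> E `` {v}"
    then have u: "(v, u) \<in> E" "u \<in> V"
      using E_subset by auto
    have "ord u \<le> ord v"
      using finite_V u(2) v(1) by (metis Max_ge finite_imageI imageI)
    then have "v \<notin> U u"
      using U_less[OF u(2)] by fastforce
    then show "u \<in> U v"
      using U_edge[OF u(1)] by blast
  qed
  then show ?thesis
    using card_mono[OF finite_U[OF v(2)]] U_card[OF v(2)] v(2) le_trans by blast
qed

text \<open>Makes the common value finite: for \<open>t = k + 2\<close> and \<open>m = k + 1\<close>
  all degrees in both graphs exceed \<open>k\<close>, which treewidth at most \<open>k\<close> rules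
  out.\<close>

lemma bounded_treewidth_imp_excludes:
  assumes "\<forall>G\<in>\<G>. pair_graph G" "bounded_treewidth \<G>"
  shows "\<exists>t\<ge>1. \<exists>m. excludes_both \<G> t m"
proof -
  obtain k where k: "\<And>G. G \<in> \<G> \<Longrightarrow> treewidth G \<le> k"
    using assms(2) unfolding bounded_treewidth_def by blast
  have degree: False if G: "G \<in> \<G>" "pverts G \<noteq> {}" and
    X: "\<And>v. v \<in> pverts G \<Longrightarrow> \<exists>X\<subseteq>parcs G `` {v}. k < card X" for G
  proof -
    have pg: "pair_graph G"
      using assms(1) G(1) by blast
    then obtain ord U where "elimination (pverts G) (parcs G) ord U k"
      using treewidth_imp_elimination k[OF G(1)] by blast
    then obtain v where v: "v \<in> pverts G" "card (parcs G `` {v}) \<le> k"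
      using elimination.small_degree_vertex G(2) by blast
    obtain X where "X \<subseteq> parcs G `` {v}" "k < card X"
      using X[OF v(1)] by blast
    moreover have "finite (parcs G `` {v})"
    proof (rule finite_subset)
      show "parcs G `` {v} \<subseteq> pverts G"
        using pg unfolding pair_graph_iff by blast
    qed (use pg in \<open>simp add: pair_graph_iff\<close>)
    ultimately show False
      using card_mono[of "parcs G `` {v}" X] v(2) by simp
  qed
  have "excludes_both \<G> (k + 2) (k + 1)"
    unfolding excludes_both_def
  proof (intro conjI notI)
    assume "\<exists>G\<in>\<G>. complete_bipartite_digraph (k + 2) (k + 1) (with_proj G)"
    then obtain G where G: "G \<in> \<G>" "complete_bipartite_digraph (k + 2) (k + 1) (with_proj G)"
      by blast
    obtain U W where *: "finite U" "finite W" "card U = k + 2" "card W = k + 1" "U \<inter> W = {}" "pverts G = U \<union> W"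
      "\<forall>u\<in>U. \<forall>w\<in>W. (u, w) \<in> parcs G \<and> (w, u) \<in> parcs G"
      using G(2) by (rule complete_bipartite_cases)
    show False
    proof (rule degree[OF G(1)])
      show "pverts G \<noteq> {}"
        using *(3,6) by auto
      fix v assume "v \<in> pverts G"
      then have "W \<subseteq> parcs G `` {v} \<or> U \<subseteq> parcs G `` {v}"
        using *(6,7) by blast
      moreover have "k < card W" "k < card U"
        using *(3,4) by auto
      ultimately show "\<exists>X\<subseteq>parcs G `` {v}. k < card X"
        by blast
    qed
  next
    assume "\<exists>G\<in>\<G>. indep_join_path (k + 2 - 1) (k + 1) G"
    then obtain G where G: "G \<in> \<G>" "indep_join_path (k + 2 - 1) (k + 1) G"
      by blast
    obtain U xs where *: "finite U" "card U = k + 2 - 1" "distinct xs" "length xs = k + 1" "U \<inter> set xs = {}"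
      "pverts G = U \<union> set xs" "\<forall>u\<in>U. \<forall>x\<in>set xs. (u, x) \<in> parcs G \<and> (x, u) \<in> parcs G"
      "\<forall>i. Suc i < k + 1 \<longrightarrow> (xs ! i, xs ! Suc i) \<in> parcs G \<and> (xs ! Suc i, xs ! i) \<in> parcs G"
      using G(2) by (rule indep_join_path_cases)
    show False
    proof (rule degree[OF G(1)])
      show "pverts G \<noteq> {}"
        using *(2,6) by auto
      fix v assume "v \<in> pverts G"
      then have "set xs \<subseteq> parcs G `` {v} \<or> U \<subseteq> parcs G `` {v}"
        using *(6,7) by blast
      moreover have "k < card (set xs)" "k < card U"
        using *(2-4) by (auto simp: distinct_card)
      ultimately show "\<exists>X\<subseteq>parcs G `` {v}. k < card X"
        by blast
    qed
  qed
  then show ?thesis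
    by (intro exI[of _ "k + 2"]) auto
qed

theorem theorem17:
  fixes \<G> :: graph_class
  assumes "minor_closed_class \<G>" and "bounded_treewidth \<G>"
  shows "pcol_star \<G> = percolation_threshold \<G> \<and>
    percolation_threshold \<G> = col_star \<G> \<and>
    (\<exists>t\<ge>1. col_star \<G> = enat t \<and> (\<exists>m. excludes_both \<G> t m) \<and>
      (\<forall>s\<ge>1. (\<exists>m. excludes_both \<G> s m) \<longrightarrow> t \<le> s))"
proof -
  have graphs: "\<forall>G\<in>\<G>. pair_graph G"
    using assms(1) by (simp add: minor_closed_class_def)
  let ?ex = "\<lambda>t. \<exists>m. excludes_both \<G> t m"
  \<comment> \<open>Exclusion gives \<open>pcol_bound\<close>, which gives the other two properties,
    and each of these gives exclusion back.\<close>
  have bounds: "(pcol_bound \<G> t \<longleftrightarrow> ?ex t) \<and> (percolation_bound \<G> t \<longleftrightarrow> ?ex t) \<and> (col_bound \<G> t \<longleftrightarrow> ?ex t)"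
    if "1 \<le> t" for t
    using excludes_imp_pcol_bound[OF assms that] pcol_imp_percolation_bound[OF graphs]
      percolation_bound_imp_excludes[OF _ that] pcol_imp_col_bound[OF assms(1) _ that]
      col_bound_imp_excludes[OF graphs _ that] by blast
  define T where "T = {t. 1 \<le> t \<and> ?ex t}"
  have "pcol_star \<G> = Inf {enat t | t. 1 \<le> t \<and> pcol_bound \<G> t}"
      "percolation_threshold \<G> = Inf {enat t | t. 1 \<le> t \<and> percolation_bound \<G> t}"
      "col_star \<G> = Inf {enat t | t. 1 \<le> t \<and> col_bound \<G> t}"
    by (simp_all only: pcol_star_def percolation_threshold_def col_star_def
        pcol_bound_def percolation_bound_def col_bound_def)
  moreover have "{enat t | t. 1 \<le> t \<and> P t} = enat ` T" if "\<And>t. 1 \<le> t \<Longrightarrow> P t \<longleftrightarrow> ?ex t" for P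
    using that by (auto simp: T_def)
  ultimately have stars: "pcol_star \<G> = Inf (enat ` T)" "percolation_threshold \<G> = Inf (enat ` T)"
      "col_star \<G> = Inf (enat ` T)"
    using bounds by presburger+
  have "T \<noteq> {}"
    using bounded_treewidth_imp_excludes[OF graphs assms(2)] by (auto simp: T_def)
  then have least: "Inf T \<in> T" "\<And>s. s \<in> T \<Longrightarrow> Inf T \<le> s"
    by (auto simp: Inf_nat_def1 wellorder_Inf_le1)
  \<comment> \<open>\<open>T\<close> is a non-empty set of naturals, so the infimum is attained and
    finite.\<close>
  have "Inf (enat ` T) = enat (Inf T)"
    using least by (intro antisym Inf_lower Inf_greatest) auto
  then show ?thesis
    using stars least by (auto simp: T_def)
qed

end
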